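(* Let $\delta>0$ and let $L\ge 0$ be a constant. Assume that $f$ satisfies $$f(x,s,\xi)s\le\delta s^2+L|\xi||s|+h(x)|s|\quad\text{for all } x\in\Omega,\ s\in\mathbb R,\ \xi\in\mathbb R^d.$$ Let $\mu\ge\max\{0,\varepsilon-\lambda_1\}$, $0<t\le1$, let $\omega\subseteq\Omega$ be open, and let $v_0\le0\le v_1$ be measurable functions on $\Omega$. Let $u$ be a weak solution of problem $(P_{\mu,t,\omega,v_0,v_1})$. Then $u\in L_{q^{**}}(\Omega)$ and $$\|u\|_{L_{q^{**}}(\Omega)}\le C\left(\|u\|_{L_2(\Omega)}+\|h\|_{L_q(\Omega)}\right)$$ for a constant $C>0$ depending only on $d,q,\delta$ and $L$.
   Context: Let $\Omega\subseteq\mathbb R^d$ be an arbitrary open set. $\lambda_1=\lambda_1(\Omega)\ge0$ denotes the largest real number such that $\lambda_1\|u\|^2_{L_2(\Omega)}\le\|\nabla u\|^2_{L_2(\Omega)}$ for all $u\in H^1_0(\Omega)$. Fix $\varepsilon>0$. $f:\Omega\times\mathbb R\times\mathbb R^d\to\mathbb R$ is a Carathéodory function: it is measurable in $x$ for fixed $(s,\xi)$, and continuous in $(s,\xi)$ for almost every $x$. Fix $q\ge2$ with $q\neq d/2$, and $0\le h\in L_2(\Omega)\cap L_q(\Omega)$. Put $q^{**}=qd/(d-2q)$ if $q<d/2$ and $q^{**}=\infty$ if $q>d/2$. Problem $(P_{\mu,t,\omega,v_0,v_1})$: let $\mu\ge0$, $0<t\le1$, let $\omega\subseteq\Omega$ be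 open, and let $v_0\le0\le v_1$ be measurable functions on $\Omega$. Set $$\sigma(x,s)=\max\{v_0(x),\min\{s,v_1(x)\}\},\qquad b_\sigma(x,s,\xi)=f(x,\sigma(x,s),\xi)+\mu\sigma(x,s).$$ A weak solution of $-\Delta u+\mu u=t\,b_\sigma(x,u,\nabla u)\chi_\omega$ in $\Omega$, $u=0$ on $\partial\Omega$, is a function $u\in H^1_0(\Omega)$ with $b_\sigma(\cdot,u,\nabla u)\chi_\omega\in L_2(\Omega)$ and $$\int_\Omega\nabla u\cdot\nabla\varphi\,dx+\mu\int_\Omega u\varphi\,dx=t\int_\omega b_\sigma(x,u,\nabla u)\varphi\,dx$$ for all $\varphi\in C_c^\infty(\Omega)$. *)

theory Defs
  imports "HOL-Analysis.Analysis" "HOL-Probability.Essential_Supremum"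
begin

section \<open>Smooth functions and test functions\<close>

text \<open>Partial derivative of a (classically differentiable) function in direction b.\<close>
definition pderiv_dir :: "('a::euclidean_space \<Rightarrow> real) \<Rightarrow> 'a \<Rightarrow> 'a \<Rightarrow> real" where
  "pderiv_dir \<phi> b x = frechet_derivative \<phi> (at x) b"

text \<open>Classical gradient.\<close>
definition cgrad :: "('a::euclidean_space \<Rightarrow> real) \<Rightarrow> 'a \<Rightarrow> 'a" where
  "cgrad \<phi> x = (\<Sum>b\<in>Basis. pderiv_dir \<phi> b x *\<^sub>R b)"

text \<open>C^k functions on the whole space.\<close>
fun Ck :: "nat \<Rightarrow> ('a::euclidean_space \<Rightarrow> real) \<Rightarrow> bool" where
  "Ck 0 \<phi> = continuous_on UNIV \<phi>"
| "Ck (Suc k) \<phi> = ((\<forall>x. \<phi> differentiable (at x)) \<and> continuous_on UNIV \<phi>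
                     \<and> (\<forall>b\<in>Basis. Ck k (pderiv_dir \<phi> b)))"

definition smooth :: "('a::euclidean_space \<Rightarrow> real) \<Rightarrow> bool" where
  "smooth \<phi> \<longleftrightarrow> (\<forall>k. Ck k \<phi>)"

definition tsupport :: "('a::euclidean_space \<Rightarrow> real) \<Rightarrow> 'a set" where
  "tsupport \<phi> = closure {x. \<phi> x \<noteq> 0}"

text \<open>C_c^\<infinity>(\<Omega>)\<close>
definition test_fun :: "'a::euclidean_space set \<Rightarrow> ('a \<Rightarrow> real) \<Rightarrow> bool" where
  "test_fun \<Omega> \<phi> \<longleftrightarrow> smooth \<phi> \<and> compact (tsupport \<phi>) \<and> tsupport \<phi> \<subseteq> \<Omega>"

section \<open>Lebesgue spaces on \<Omega>\<close>

definition L2 :: "'a::euclidean_space set \<Rightarrow> ('a \<Rightarrow> 'b::euclidean_space) \<Rightarrow> bool" where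
  "L2 \<Omega> u \<longleftrightarrow> u \<in> borel_measurable (lebesgue_on \<Omega>)
                 \<and> integrable (lebesgue_on \<Omega>) (\<lambda>x. (norm (u x))\<^sup>2)"

text \<open>Exponent p \<in> [1,\<infinity>], p = \<infinity> meaning the essential supremum.\<close>
definition Lp_space :: "ereal \<Rightarrow> 'a::euclidean_space set \<Rightarrow> ('a \<Rightarrow> real) \<Rightarrow> bool" where
  "Lp_space p \<Omega> u \<longleftrightarrow> u \<in> borel_measurable (lebesgue_on \<Omega>) \<and>
     (if p = \<infinity> then esssup (lebesgue_on \<Omega>) (\<lambda>x. ereal \<bar>u x\<bar>) < \<infinity>
      else integrable (lebesgue_on \<Omega>) (\<lambda>x. \<bar>u x\<bar> powr (real_of_ereal p)))"

definition Lp_norm :: "ereal \<Rightarrow> 'a::euclidean_space set \<Rightarrow> ('a \<Rightarrow> real) \<Rightarrow> real" where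
  "Lp_norm p \<Omega> u =
     (if p = \<infinity> then real_of_ereal (esssup (lebesgue_on \<Omega>) (\<lambda>x. ereal \<bar>u x\<bar>))
      else (\<integral>x. \<bar>u x\<bar> powr (real_of_ereal p) \<partial>lebesgue_on \<Omega>) powr (1 / real_of_ereal p))"

section \<open>Sobolev space H^1_0\<close>

text \<open>g is the weak gradient of u on \<Omega>.\<close>
definition weak_grad :: "'a::euclidean_space set \<Rightarrow> ('a \<Rightarrow> real) \<Rightarrow> ('a \<Rightarrow> 'a) \<Rightarrow> bool" where
  "weak_grad \<Omega> u g \<longleftrightarrow> (\<forall>\<phi>. test_fun \<Omega> \<phi> \<longrightarrow> (\<forall>b\<in>Basis.
      (\<integral>x. u x * pderiv_dir \<phi> b x \<partial>lebesgue_on \<Omega>) = - (\<integral>x. (g x \<bullet> b) * \<phi> x \<partial>lebesgue_on \<Omega>)))"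

text \<open>u \<in> H^1_0(\<Omega>) with weak gradient g: the H^1-closure of C_c^\<infinity>(\<Omega>).\<close>
definition H10 :: "'a::euclidean_space set \<Rightarrow> ('a \<Rightarrow> real) \<Rightarrow> ('a \<Rightarrow> 'a) \<Rightarrow> bool" where
  "H10 \<Omega> u g \<longleftrightarrow> L2 \<Omega> u \<and> L2 \<Omega> g \<and> weak_grad \<Omega> u g \<and>
     (\<exists>\<phi>::nat \<Rightarrow> 'a \<Rightarrow> real. (\<forall>n. test_fun \<Omega> (\<phi> n)) \<and>
        (\<lambda>n. \<integral>x. (u x - \<phi> n x)\<^sup>2 \<partial>lebesgue_on \<Omega>) \<longlonglongrightarrow> 0 \<and>
        (\<lambda>n. \<integral>x. (norm (g x - cgrad (\<phi> n) x))\<^sup>2 \<partial>lebesgue_on \<Omega>) \<longlonglongrightarrow> 0)"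

text \<open>First Dirichlet eigenvalue (best Poincare constant).\<close>
definition lambda1 :: "'a::euclidean_space set \<Rightarrow> real" where
  "lambda1 \<Omega> = Sup {c. 0 \<le> c \<and> (\<forall>u g. H10 \<Omega> u g \<longrightarrow>
      c * (\<integral>x. (u x)\<^sup>2 \<partial>lebesgue_on \<Omega>) \<le> (\<integral>x. (norm (g x))\<^sup>2 \<partial>lebesgue_on \<Omega>))}"

section \<open>The problem\<close>

definition carath :: "'a::euclidean_space set \<Rightarrow> ('a \<Rightarrow> real \<Rightarrow> 'a \<Rightarrow> real) \<Rightarrow> bool" where
  "carath \<Omega> f \<longleftrightarrow> (\<forall>s \<xi>. (\<lambda>x. f x s \<xi>) \<in> borel_measurable (lebesgue_on \<Omega>)) \<and>
     (AE x in lebesgue_on \<Omega>. continuous_on UNIV (\<lambda>(s, \<xi>). f x s \<xi>))"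

definition trunc :: "('a \<Rightarrow> real) \<Rightarrow> ('a \<Rightarrow> real) \<Rightarrow> 'a \<Rightarrow> real \<Rightarrow> real" where
  "trunc v0 v1 x s = max (v0 x) (min s (v1 x))"

definition b_sigma :: "('a \<Rightarrow> real \<Rightarrow> 'a \<Rightarrow> real) \<Rightarrow> real \<Rightarrow> ('a \<Rightarrow> real) \<Rightarrow> ('a \<Rightarrow> real)
    \<Rightarrow> 'a \<Rightarrow> real \<Rightarrow> 'a \<Rightarrow> real" where
  "b_sigma f \<mu> v0 v1 x s \<xi> = f x (trunc v0 v1 x s) \<xi> + \<mu> * trunc v0 v1 x s"

text \<open>u is a weak solution of (P_{\<mu>,t,\<omega>,v0,v1}).\<close>
definition weak_sol :: "'a::euclidean_space set \<Rightarrow> ('a \<Rightarrow> real \<Rightarrow> 'a \<Rightarrow> real) \<Rightarrow> real \<Rightarrow> real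
    \<Rightarrow> 'a set \<Rightarrow> ('a \<Rightarrow> real) \<Rightarrow> ('a \<Rightarrow> real) \<Rightarrow> ('a \<Rightarrow> real) \<Rightarrow> bool" where
  "weak_sol \<Omega> f \<mu> t \<omega> v0 v1 u \<longleftrightarrow> (\<exists>g. H10 \<Omega> u g \<and>
     L2 \<Omega> (\<lambda>x. b_sigma f \<mu> v0 v1 x (u x) (g x) * indicator \<omega> x) \<and>
     (\<forall>\<phi>. test_fun \<Omega> \<phi> \<longrightarrow>
        (\<integral>x. g x \<bullet> cgrad \<phi> x \<partial>lebesgue_on \<Omega>) + \<mu> * (\<integral>x. u x * \<phi> x \<partial>lebesgue_on \<Omega>)
        = t * (\<integral>x. b_sigma f \<mu> v0 v1 x (u x) (g x) * \<phi> x \<partial>lebesgue_on \<omega>)))"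

text \<open>q^{**}\<close>
definition qss :: "nat \<Rightarrow> real \<Rightarrow> ereal" where
  "qss d q = (if q < real d / 2 then ereal (q * real d / (real d - 2 * q)) else \<infinity>)"

end

(* The solution is tested with Phi(u) for nondecreasing C1 functions Phi with bounded derivative. Since
   b_sigma(x,u,grad u) sgn u <= (delta + mu)|u| + L |grad u| + h, the terms with mu cancel and what is
   left is an energy inequality not involving mu, t, omega, v0, v1. From it one gets the
   L_infinity bound by De Giorgi's iteration over levels if q > d/2, and the bound in
   L_(qd/(d-2q)) by a single Moser step with exponent beta = q(d-2)/(2(d-2q)) if q < d/2.

   The only functional inequality needed is Faber-Krahn: integrating
   |u(x+y) - u(x)|^2 over x is at most |y|^2 times the Dirichlet integral; averaging
   over y in a ball with twice the measure of {u /= 0} bounds the L2 norm. Sobolev's inequality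
   follows from it by dyadic truncation. *)
theory Submission
  imports Defs
begin


section \<open>Test functions\<close>

text \<open>The estimates are shaped by \<Omega> being arbitrary, possibly irregular and of infinite
  measure. Members of \<open>H10\<close> are therefore extended by zero and handled only as limits
  of test functions, and the sets to which Faber-Krahn is applied get finite measure from
  Chebyshev's inequality. The term L |grad u| |\<Phi>(u)| is absorbed by half of \<phi>(u) |grad
  u|^2, where \<phi> is the derivative of \<Phi>, once |\<Phi>| is dominated by \<phi> X; this is
  the origin of the auxiliary function X in \<open>energy_class\<close>. For q < d/2 the exponent
  \<beta> is forced: with p = 2d/(d - 2), Sobolev's inequality controls |u| to the power \<beta> p,
  while h in L_q is paired with |u| to the power 2 \<beta> - 1, whose conjugate power q/(q - 1) has
  to reproduce the exponent \<beta> p. The equation \<beta> p = (2 \<beta> - 1) q/(q - 1) has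
  exactly one solution, and there \<beta> p = qd/(d - 2q). Absorbing a power of an unknown norm
  requires that norm to be finite, so powers are truncated at a height N and bounded uniformly in
  N.\<close>

lemma pderiv_dir_eqI:
  assumes "(\<phi> has_derivative D) (at x)"
  shows "pderiv_dir \<phi> b x = D b"
  unfolding pderiv_dir_def using frechet_derivative_at[OF assms] by simp

lemma Ck_const: "Ck k (\<lambda>x. c)"
proof (induction k arbitrary: c)
  case (Suc k)
  have "pderiv_dir (\<lambda>x. c) b = (\<lambda>x. 0)" for b :: 'a
    by (rule ext, rule pderiv_dir_eqI[where D = "\<lambda>_. 0"]) simp
  then show ?case using Suc by simp
qed simp

text \<open>The Leibniz rule in \<open>Ck_mult\<close> multiplies a derivative of class k by an
  undifferentiated factor of class \<open>Suc k\<close>; this brings both to the same class.\<close>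

lemma Ck_Suc_D: "Ck (Suc k) \<phi> \<Longrightarrow> Ck k \<phi>"
proof (induction k arbitrary: \<phi>)
  case (Suc k)
  from Suc.prems have "Ck (Suc k) (pderiv_dir \<phi> b)" if "b \<in> Basis" for b
    using that by simp
  with Suc.IH have "Ck k (pderiv_dir \<phi> b)" if "b \<in> Basis" for b using that by blast
  then show ?case using Suc.prems by simp
qed simp

lemma Ck_add: "Ck k \<phi> \<Longrightarrow> Ck k \<psi> \<Longrightarrow> Ck k (\<lambda>x. \<phi> x + \<psi> x)"
proof (induction k arbitrary: \<phi> \<psi>)
  case 0
  then show ?case by (auto intro: continuous_on_add)
next
  case (Suc k)
  have d: "\<phi> differentiable (at x)" "\<psi> differentiable (at x)" for x
    using Suc.prems by auto
  note f = d[THEN frechet_derivative_works[THEN iffD1]]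
  have "pderiv_dir (\<lambda>x. \<phi> x + \<psi> x) b = (\<lambda>x. pderiv_dir \<phi> b x + pderiv_dir \<psi> b x)" for b
    by (rule ext, subst pderiv_dir_eqI[OF has_derivative_add[OF f]]) (simp add: pderiv_dir_def)
  then show ?case using Suc d by (auto intro!: continuous_on_add)
qed

lemma Ck_mult: "Ck k \<phi> \<Longrightarrow> Ck k \<psi> \<Longrightarrow> Ck k (\<lambda>x. \<phi> x * \<psi> x)"
proof (induction k arbitrary: \<phi> \<psi>)
  case 0
  then show ?case by (auto intro: continuous_on_mult)
next
  case (Suc k)
  have d: "\<phi> differentiable (at x)" "\<psi> differentiable (at x)" for x
    using Suc.prems by auto
  note f = d[THEN frechet_derivative_works[THEN iffD1]]
  have e: "pderiv_dir (\<lambda>x. \<phi> x * \<psi> x) b = (\<lambda>x. \<phi> x * pderiv_dir \<psi> b x + pderiv_dir \<phi> b x * \<psi> x)" for b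
    by (rule ext, subst pderiv_dir_eqI[OF has_derivative_mult[OF f]]) (simp add: pderiv_dir_def)
  have "Ck k \<phi>" "Ck k \<psi>" using Suc.prems by (blast intro: Ck_Suc_D)+
  then have "Ck k (pderiv_dir (\<lambda>x. \<phi> x * \<psi> x) b)" if "b \<in> Basis" for b
    unfolding e using Suc that by (intro Ck_add Suc.IH) auto
  then show ?case using Suc.prems d by (auto intro!: continuous_on_mult differentiable_mult)
qed

lemma smooth_polynomial:
  assumes "smooth \<phi>"
  shows "smooth (\<lambda>x. \<Sum>i\<le>(n::nat). a i * \<phi> x ^ Suc i)"
proof -
  have p0: "Ck k \<phi>" for k using assms by (simp add: smooth_def)
  have pow: "Ck k (\<lambda>x. \<phi> x ^ i)" for k i
    by (induction i) (auto intro!: Ck_const Ck_mult p0)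
  have "Ck k (\<lambda>x. \<Sum>i\<le>n. a i * \<phi> x ^ Suc i)" for k
    by (induction n) (auto intro!: Ck_add Ck_mult Ck_const p0 pow simp del: power_Suc)
  then show ?thesis by (simp add: smooth_def)
qed

text \<open>Every term carries a positive power of \<phi>, so the sum vanishes wherever \<phi> does
  and the support cannot grow.\<close>

lemma test_fun_polynomial:
  assumes "test_fun \<Omega> \<phi>"
  shows "test_fun \<Omega> (\<lambda>x. \<Sum>i\<le>(n::nat). a i * \<phi> x ^ Suc i)"
proof -
  have "{x. (\<Sum>i\<le>n. a i * \<phi> x ^ Suc i) \<noteq> 0} \<subseteq> {x. \<phi> x \<noteq> 0}"
    by auto
  then have s: "tsupport (\<lambda>x. \<Sum>i\<le>n. a i * \<phi> x ^ Suc i) \<subseteq> tsupport \<phi>"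
    unfolding tsupport_def by (rule closure_mono)
  moreover have "compact (tsupport (\<lambda>x. \<Sum>i\<le>n. a i * \<phi> x ^ Suc i))"
    using assms s compact_Int_closed[of "tsupport \<phi>" "tsupport (\<lambda>x. \<Sum>i\<le>n. a i * \<phi> x ^ Suc i)"]
    by (simp add: test_fun_def tsupport_def Int_absorb1)
  ultimately show ?thesis
    using assms smooth_polynomial by (auto simp: test_fun_def)
qed

lemma test_fun_Ck: "test_fun \<Omega> \<phi> \<Longrightarrow> Ck k \<phi>"
  by (simp add: test_fun_def smooth_def)

lemma test_fun_continuous: "test_fun \<Omega> \<phi> \<Longrightarrow> continuous_on UNIV \<phi>"
  using test_fun_Ck[of \<Omega> \<phi> 0] by simp

lemma test_fun_has_derivative:
  fixes \<phi> :: "'a::euclidean_space \<Rightarrow> real"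
  assumes "test_fun \<Omega> \<phi>"
  shows "(\<phi> has_derivative (\<lambda>h. cgrad \<phi> x \<bullet> h)) (at x)"
proof -
  have "\<phi> differentiable (at x)" using test_fun_Ck[OF assms, of 1] by simp
  then have d: "(\<phi> has_derivative frechet_derivative \<phi> (at x)) (at x)"
    by (rule frechet_derivative_works[THEN iffD1])
  then interpret linear "frechet_derivative \<phi> (at x)" by (rule has_derivative_linear)
  have "frechet_derivative \<phi> (at x) h = cgrad \<phi> x \<bullet> h" for h
  proof -
    have "frechet_derivative \<phi> (at x) h = frechet_derivative \<phi> (at x) (\<Sum>b\<in>Basis. (h \<bullet> b) *\<^sub>R b)"
      by (simp add: euclidean_representation)
    also have "\<dots> = (\<Sum>b\<in>Basis. (h \<bullet> b) * frechet_derivative \<phi> (at x) b)"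
      by (simp add: sum scaleR)
    also have "\<dots> = cgrad \<phi> x \<bullet> h"
      by (simp add: cgrad_def pderiv_dir_def inner_sum_right inner_commute[of _ h] mult.commute)
    finally show ?thesis .
  qed
  then show ?thesis using d by (metis ext)
qed

lemma cgrad_eqI:
  fixes \<phi> :: "'a::euclidean_space \<Rightarrow> real"
  assumes "(\<phi> has_derivative (\<lambda>h. v \<bullet> h)) (at x)"
  shows "cgrad \<phi> x = v"
  by (simp add: cgrad_def pderiv_dir_eqI[OF assms] euclidean_representation)

lemma test_fun_continuous_cgrad:
  assumes "test_fun \<Omega> \<phi>"
  shows "continuous_on UNIV (cgrad \<phi>)"
proof -
  have "Ck 0 (pderiv_dir \<phi> b)" if "b \<in> Basis" for b
    using test_fun_Ck[OF assms, of "Suc 0"] that by simp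
  then show ?thesis unfolding cgrad_def[abs_def] by (intro continuous_intros) auto
qed

text \<open>The complement of the support is open, so \<phi> is locally the zero function there and
  its gradient vanishes too. Integrals over \<Omega> may thus be taken over the whole space.\<close>

lemma test_fun_outside:
  assumes "test_fun \<Omega> \<phi>" "x \<notin> tsupport \<phi>"
  shows "\<phi> x = 0" "cgrad \<phi> x = 0"
proof -
  have z: "\<phi> y = 0" if "y \<notin> tsupport \<phi>" for y
    using that closure_subset[of "{x. \<phi> x \<noteq> 0}"] unfolding tsupport_def by blast
  show "\<phi> x = 0" using z assms by simp
  have "open (- tsupport \<phi>)" by (simp add: tsupport_def open_Compl)
  moreover have "((\<lambda>_. 0) has_derivative (\<lambda>h. 0 \<bullet> h)) (at x)" by simp
  ultimately have "(\<phi> has_derivative (\<lambda>h. 0 \<bullet> h)) (at x)"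
    using z assms(2) has_derivative_transform_within_open[of "\<lambda>_. 0" _ x UNIV "- tsupport \<phi>" \<phi>]
    by auto
  then show "cgrad \<phi> x = 0" by (rule cgrad_eqI)
qed

lemma test_fun_cgrad_compose:
  assumes "test_fun \<Omega> \<phi>" "(P has_real_derivative P') (at (\<phi> x))"
  shows "cgrad (\<lambda>x. P (\<phi> x)) x = P' *\<^sub>R cgrad \<phi> x"
proof (rule cgrad_eqI)
  show "((\<lambda>x. P (\<phi> x)) has_derivative (\<lambda>h. (P' *\<^sub>R cgrad \<phi> x) \<bullet> h)) (at x)"
    using has_derivative_compose[OF test_fun_has_derivative[OF assms(1), of x]
        assms(2)[unfolded has_field_derivative_def]]
    by simp
qed

lemma integrable_lborel_compact_support:
  fixes f :: "'a::euclidean_space \<Rightarrow> 'b::euclidean_space"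
  assumes "continuous_on UNIV f" "compact K" "\<And>x. x \<notin> K \<Longrightarrow> f x = 0"
  shows "integrable lborel f"
proof -
  have "integrable lborel (\<lambda>x. indicator K x *\<^sub>R f x)"
    using assms by (intro borel_integrable_compact) (auto intro: continuous_on_subset)
  moreover have "(\<lambda>x. indicator K x *\<^sub>R f x) = f"
    using assms(3) by (auto simp: indicator_def fun_eq_iff)
  ultimately show ?thesis by simp
qed

lemma test_fun_integrable:
  assumes "test_fun \<Omega> \<phi>"
  shows "integrable lborel (\<lambda>x. (\<phi> x)\<^sup>2)" "integrable lborel (\<lambda>x. (norm (cgrad \<phi> x))\<^sup>2)"
proof -
  have "compact (tsupport \<phi>)" using assms by (simp add: test_fun_def)
  then show "integrable lborel (\<lambda>x. (\<phi> x)\<^sup>2)" "integrable lborel (\<lambda>x. (norm (cgrad \<phi> x))\<^sup>2)"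
    using test_fun_outside[OF assms] test_fun_continuous[OF assms] test_fun_continuous_cgrad[OF assms]
    by (auto intro!: integrable_lborel_compact_support[where K = "tsupport \<phi>"] continuous_intros)
qed

lemma test_fun_borel:
  assumes "test_fun \<Omega> \<phi>"
  shows "\<phi> \<in> borel_measurable borel" "cgrad \<phi> \<in> borel_measurable borel"
  using test_fun_continuous[OF assms] test_fun_continuous_cgrad[OF assms]
  by (auto intro: borel_measurable_continuous_onI)

lemma test_fun_bounded:
  assumes "test_fun \<Omega> \<phi>"
  obtains R where "R > 0" "\<And>x. \<bar>\<phi> x\<bar> \<le> R"
proof -
  have "compact (\<phi> ` tsupport \<phi>)"
    using assms test_fun_continuous[OF assms]
    by (intro compact_continuous_image) (auto simp: test_fun_def intro: continuous_on_subset)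
  then obtain R where R: "R > 0" "\<forall>y\<in>\<phi> ` tsupport \<phi>. norm y \<le> R"
    using compact_imp_bounded bounded_pos by blast
  have "\<bar>\<phi> x\<bar> \<le> R" for x
    using R test_fun_outside(1)[OF assms, of x] by (cases "x \<in> tsupport \<phi>") auto
  then show ?thesis using that R by blast
qed


section \<open>Square integrable functions\<close>

text \<open>The counterpart of \<open>L2\<close> over an arbitrary measure. It is used with
  \<open>lborel\<close>, where Tonelli's theorem and translation invariance apply to Borel
  functions.\<close>

definition sq_int :: "'c measure \<Rightarrow> ('c \<Rightarrow> 'b::euclidean_space) \<Rightarrow> bool" where
  "sq_int M v \<longleftrightarrow> v \<in> borel_measurable M \<and> integrable M (\<lambda>x. (norm (v x))\<^sup>2)"

lemma norm_add_sq_le: "(norm (a + b))\<^sup>2 \<le> 2 * (norm a)\<^sup>2 + 2 * (norm (b::'b::real_inner))\<^sup>2"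
  using zero_le_power2[of "norm (a - b)"]
  by (simp add: power2_norm_eq_inner inner_add_left inner_add_right inner_diff_left inner_diff_right inner_commute)

lemma norm_diff_sq_le: "(norm (a - b))\<^sup>2 \<le> 2 * (norm a)\<^sup>2 + 2 * (norm (b::'b::real_inner))\<^sup>2"
  using norm_add_sq_le[of a "- b"] by simp

lemma sq_int_bound:
  assumes "v \<in> borel_measurable M" "integrable M w" "\<And>x. (norm (v x))\<^sup>2 \<le> w x"
  shows "sq_int M v"
  unfolding sq_int_def using assms
  by (auto intro!: Bochner_Integration.integrable_bound[OF assms(2)] AE_I2)
     (use assms(3) in \<open>simp add: order_trans[OF assms(3) abs_ge_self]\<close>)

lemma sq_int_add: "sq_int M v \<Longrightarrow> sq_int M w \<Longrightarrow> sq_int M (\<lambda>x. v x + w x)"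
  by (rule sq_int_bound[where w = "\<lambda>x. 2 * (norm (v x))\<^sup>2 + 2 * (norm (w x))\<^sup>2"])
     (auto simp: sq_int_def norm_add_sq_le)

lemma sq_int_diff: "sq_int M v \<Longrightarrow> sq_int M w \<Longrightarrow> sq_int M (\<lambda>x. v x - w x)"
  by (rule sq_int_bound[where w = "\<lambda>x. 2 * (norm (v x))\<^sup>2 + 2 * (norm (w x))\<^sup>2"])
     (auto simp: sq_int_def norm_diff_sq_le)

lemma sq_int_scaleR: "sq_int M v \<Longrightarrow> sq_int M (\<lambda>x. c *\<^sub>R v x)"
  by (auto simp: sq_int_def power_mult_distrib)

lemma sq_int_scaleR_bounded:
  assumes "sq_int M v" "c \<in> borel_measurable M" "\<And>x. \<bar>c x\<bar> \<le> B"
  shows "sq_int M (\<lambda>x. c x *\<^sub>R v x)"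
proof (rule sq_int_bound)
  show "integrable M (\<lambda>x. B\<^sup>2 * (norm (v x))\<^sup>2)" using assms by (simp add: sq_int_def)
  show "(norm (c x *\<^sub>R v x))\<^sup>2 \<le> B\<^sup>2 * (norm (v x))\<^sup>2" for x
    using assms(3)[of x] by (auto simp: power_mult_distrib intro!: mult_right_mono abs_le_square_iff[THEN iffD1])
qed (use assms in \<open>auto simp: sq_int_def\<close>)

lemma sq_int_inner_integrable:
  assumes "sq_int M v" "sq_int M w"
  shows "integrable M (\<lambda>x. v x \<bullet> w x)"
proof (rule Bochner_Integration.integrable_bound)
  show "integrable M (\<lambda>x. (norm (v x))\<^sup>2 + (norm (w x))\<^sup>2)" using assms by (simp add: sq_int_def)
  show "(\<lambda>x. v x \<bullet> w x) \<in> borel_measurable M" using assms by (auto simp: sq_int_def)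
  have "norm (v x \<bullet> w x) \<le> (norm (v x))\<^sup>2 + (norm (w x))\<^sup>2" for x
  proof -
    have "norm (v x \<bullet> w x) \<le> norm (v x) * norm (w x)"
      using Cauchy_Schwarz_ineq2[of "v x" "w x"] by simp
    moreover have "0 \<le> norm (v x) * norm (w x)" by simp
    ultimately show ?thesis
      using sum_squares_bound[of "norm (v x)" "norm (w x)"] by linarith
  qed
  then show "AE x in M. norm (v x \<bullet> w x) \<le> norm ((norm (v x))\<^sup>2 + (norm (w x))\<^sup>2)"
    by (intro AE_I2) (simp only: real_norm_def abs_of_nonneg add_nonneg_nonneg zero_le_power2)
qed

text \<open>The integral of |v - t w|^2 is a quadratic in t that is never negative; evaluating it at
  its minimiser \<open>?B / ?C\<close> gives the inequality.\<close>

lemma sq_int_Cauchy_Schwarz: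
  assumes "sq_int M v" "sq_int M w"
  shows "\<bar>\<integral>x. v x \<bullet> w x \<partial>M\<bar> \<le> sqrt (\<integral>x. (norm (v x))\<^sup>2 \<partial>M) * sqrt (\<integral>x. (norm (w x))\<^sup>2 \<partial>M)"
proof -
  let ?A = "\<integral>x. (norm (v x))\<^sup>2 \<partial>M" and ?B = "\<integral>x. v x \<bullet> w x \<partial>M" and ?C = "\<integral>x. (norm (w x))\<^sup>2 \<partial>M"
  have i: "integrable M (\<lambda>x. (norm (v x))\<^sup>2)" "integrable M (\<lambda>x. v x \<bullet> w x)" "integrable M (\<lambda>x. (norm (w x))\<^sup>2)"
    using assms sq_int_inner_integrable by (auto simp: sq_int_def)
  have q: "0 \<le> ?A - 2 * t * ?B + t\<^sup>2 * ?C" for t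
  proof -
    have "0 \<le> (\<integral>x. (norm (v x - t *\<^sub>R w x))\<^sup>2 \<partial>M)" by simp
    also have "(\<lambda>x. (norm (v x - t *\<^sub>R w x))\<^sup>2) =
        (\<lambda>x. (norm (v x))\<^sup>2 - 2 * t * (v x \<bullet> w x) + t\<^sup>2 * (norm (w x))\<^sup>2)"
      unfolding power2_norm_eq_inner
      by (simp add: inner_diff_left inner_diff_right inner_commute algebra_simps power2_eq_square[of t])
    also have "(\<integral>x. \<dots> x \<partial>M) = ?A - 2 * t * ?B + t\<^sup>2 * ?C"
      using i by simp
    finally show ?thesis .
  qed
  have "?B\<^sup>2 \<le> ?A * ?C"
  proof (cases "?C = 0")
    case True
    have "?B = 0"
    proof (rule ccontr)
      assume "?B \<noteq> 0"
      \<comment> \<open>With \<open>?C = 0\<close> the quadratic is affine in t, and at this t it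
        takes the value -1.\<close>
      then show False using q[of "(?A + 1) / (2 * ?B)"] True by (simp add: field_simps)
    qed
    then show ?thesis using True by simp
  next
    case False
    then have "?C > 0" by (simp add: less_le)
    then show ?thesis using q[of "?B / ?C"] by (simp add: field_simps power2_eq_square)
  qed
  then show ?thesis
    by (metis real_sqrt_abs real_sqrt_le_mono real_sqrt_mult)
qed

lemma sq_int_inner_tendsto:
  assumes "sq_int M f" "sq_int M v" "\<And>n. sq_int M (w n)"
    and "(\<lambda>n. \<integral>x. (norm (v x - w n x))\<^sup>2 \<partial>M) \<longlonglongrightarrow> 0"
  shows "(\<lambda>n. \<integral>x. f x \<bullet> w n x \<partial>M) \<longlonglongrightarrow> (\<integral>x. f x \<bullet> v x \<partial>M)"
proof -
  have "(\<lambda>n. (\<integral>x. f x \<bullet> w n x \<partial>M) - (\<integral>x. f x \<bullet> v x \<partial>M)) \<longlonglongrightarrow> 0"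
  proof (rule Lim_null_comparison)
    show "\<forall>\<^sub>F n in sequentially. norm ((\<integral>x. f x \<bullet> w n x \<partial>M) - (\<integral>x. f x \<bullet> v x \<partial>M)) \<le>
        sqrt (\<integral>x. (norm (f x))\<^sup>2 \<partial>M) * sqrt (\<integral>x. (norm (v x - w n x))\<^sup>2 \<partial>M)"
    proof (rule always_eventually, rule allI)
      fix n
      have "(\<integral>x. f x \<bullet> v x \<partial>M) - (\<integral>x. f x \<bullet> w n x \<partial>M) = (\<integral>x. f x \<bullet> (v x - w n x) \<partial>M)"
        unfolding inner_diff_right
        using sq_int_inner_integrable[OF assms(1,2)] sq_int_inner_integrable[OF assms(1) assms(3)[of n]] by simp
      then show "norm ((\<integral>x. f x \<bullet> w n x \<partial>M) - (\<integral>x. f x \<bullet> v x \<partial>M)) \<le>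
        sqrt (\<integral>x. (norm (f x))\<^sup>2 \<partial>M) * sqrt (\<integral>x. (norm (v x - w n x))\<^sup>2 \<partial>M)"
        using sq_int_Cauchy_Schwarz[OF assms(1) sq_int_diff[OF assms(2) assms(3)[of n]]]
        by (simp add: abs_minus_commute)
    qed
    have "(\<lambda>n. sqrt (\<integral>x. (norm (f x))\<^sup>2 \<partial>M) * sqrt (\<integral>x. (norm (v x - w n x))\<^sup>2 \<partial>M)) \<longlonglongrightarrow>
      sqrt (\<integral>x. (norm (f x))\<^sup>2 \<partial>M) * sqrt 0"
      by (intro tendsto_intros assms)
    then show "(\<lambda>n. sqrt (\<integral>x. (norm (f x))\<^sup>2 \<partial>M) * sqrt (\<integral>x. (norm (v x - w n x))\<^sup>2 \<partial>M)) \<longlonglongrightarrow> 0"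
      by simp
  qed
  then show ?thesis using LIM_zero_iff by blast
qed

text \<open>Since |w|^2 = |v - w|^2 + 2 v \<bullet> w - |v|^2, only the inner product with the fixed
  function v has to converge.\<close>

lemma sq_int_norm_tendsto:
  assumes "sq_int M v" "\<And>n. sq_int M (w n)"
    and "(\<lambda>n. \<integral>x. (norm (v x - w n x))\<^sup>2 \<partial>M) \<longlonglongrightarrow> 0"
  shows "(\<lambda>n. \<integral>x. (norm (w n x))\<^sup>2 \<partial>M) \<longlonglongrightarrow> (\<integral>x. (norm (v x))\<^sup>2 \<partial>M)"
proof -
  have i: "integrable M (\<lambda>x. (norm (v x))\<^sup>2)" "integrable M (\<lambda>x. v x \<bullet> w n x)" "integrable M (\<lambda>x. (norm (w n x))\<^sup>2)"
    "integrable M (\<lambda>x. (norm (v x - w n x))\<^sup>2)" for n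
    using assms(1,2) sq_int_inner_integrable[OF assms(1) assms(2)[of n]] sq_int_diff[OF assms(1) assms(2)[of n]]
    by (auto simp: sq_int_def)
  have "(\<integral>x. (norm (w n x))\<^sup>2 \<partial>M) = (\<integral>x. (norm (v x - w n x))\<^sup>2 \<partial>M) + 2 * (\<integral>x. v x \<bullet> w n x \<partial>M) - (\<integral>x. (norm (v x))\<^sup>2 \<partial>M)" for n
  proof -
    have "(\<lambda>x. (norm (w n x))\<^sup>2) = (\<lambda>x. (norm (v x - w n x))\<^sup>2 + 2 * (v x \<bullet> w n x) - (norm (v x))\<^sup>2)"
      by (simp add: power2_norm_eq_inner inner_diff_left inner_diff_right inner_commute algebra_simps)
    then show ?thesis using i by simp
  qed
  moreover have "(\<lambda>n. (\<integral>x. (norm (v x - w n x))\<^sup>2 \<partial>M) + 2 * (\<integral>x. v x \<bullet> w n x \<partial>M) - (\<integral>x. (norm (v x))\<^sup>2 \<partial>M))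
     \<longlonglongrightarrow> 0 + 2 * (\<integral>x. v x \<bullet> v x \<partial>M) - (\<integral>x. (norm (v x))\<^sup>2 \<partial>M)"
    by (intro tendsto_intros assms sq_int_inner_tendsto)
  ultimately show ?thesis by (simp add: power2_norm_eq_inner)
qed

lemma sq_int_AE_subseq:
  assumes "sq_int M v" "\<And>n. sq_int M (w n)"
    and "(\<lambda>n. \<integral>x. (norm (v x - w n x))\<^sup>2 \<partial>M) \<longlonglongrightarrow> 0"
  obtains r where "strict_mono r" "AE x in M. (\<lambda>n. w (r n) x) \<longlonglongrightarrow> v x"
proof -
  have "\<exists>r. strict_mono r \<and> (AE x in M. (\<lambda>n. (norm (v x - w (r n) x))\<^sup>2) \<longlonglongrightarrow> 0)"
    using assms(3) sq_int_diff[OF assms(1) assms(2)]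
    by (intro tendsto_L1_AE_subseq) (auto simp: sq_int_def)
  then obtain r where r: "strict_mono r" "AE x in M. (\<lambda>n. (norm (v x - w (r n) x))\<^sup>2) \<longlonglongrightarrow> 0"
    by blast
  have "AE x in M. (\<lambda>n. w (r n) x) \<longlonglongrightarrow> v x"
    using r(2)
  proof eventually_elim
    case (elim x)
    then have "(\<lambda>n. sqrt ((norm (v x - w (r n) x))\<^sup>2)) \<longlonglongrightarrow> sqrt 0" by (rule tendsto_real_sqrt)
    then have "(\<lambda>n. v x - w (r n) x) \<longlonglongrightarrow> 0" by (simp add: tendsto_norm_zero_iff)
    then have "(\<lambda>n. v x - (v x - w (r n) x)) \<longlonglongrightarrow> v x - 0" by (intro tendsto_intros)
    then show ?case by simp
  qed
  with r that show ?thesis by blast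
qed

text \<open>Elements of \<open>H\<^sup>1\<^sub>0(\<Omega>)\<close>, extended by zero and represented by Borel functions.\<close>
definition H0 :: "'a::euclidean_space set \<Rightarrow> ('a \<Rightarrow> real) \<Rightarrow> ('a \<Rightarrow> 'a) \<Rightarrow> bool" where
  "H0 \<Omega> u g \<longleftrightarrow> u \<in> borel_measurable borel \<and> g \<in> borel_measurable borel \<and>
     sq_int lborel u \<and> sq_int lborel g \<and>
     (\<exists>\<phi>. (\<forall>n::nat. test_fun \<Omega> (\<phi> n)) \<and>
       (\<lambda>n. \<integral>x. (norm (u x - \<phi> n x))\<^sup>2 \<partial>lborel) \<longlonglongrightarrow> 0 \<and>
       (\<lambda>n. \<integral>x. (norm (g x - cgrad (\<phi> n) x))\<^sup>2 \<partial>lborel) \<longlonglongrightarrow> 0)"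

lemma test_fun_sq_int:
  assumes "test_fun \<Omega> \<phi>"
  shows "sq_int lborel \<phi>" "sq_int lborel (cgrad \<phi>)"
  using test_fun_integrable[OF assms] test_fun_borel[OF assms] by (auto simp: sq_int_def)

text \<open>Passing to a subsequence adds pointwise convergence. The chain rule needs it: the
  derivative of the outer function is merely continuous and bounded, so its values along the
  approximation converge only through dominated convergence.\<close>

lemma H0_approx:
  assumes "H0 \<Omega> u g"
  obtains \<phi> where "\<forall>n::nat. test_fun \<Omega> (\<phi> n)"
    "(\<lambda>n. \<integral>x. (norm (u x - \<phi> n x))\<^sup>2 \<partial>lborel) \<longlonglongrightarrow> 0"
    "(\<lambda>n. \<integral>x. (norm (g x - cgrad (\<phi> n) x))\<^sup>2 \<partial>lborel) \<longlonglongrightarrow> 0"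
    "AE x in lborel. (\<lambda>n. \<phi> n x) \<longlonglongrightarrow> u x"
proof -
  from assms obtain \<phi> where \<phi>: "\<And>n::nat. test_fun \<Omega> (\<phi> n)"
    "(\<lambda>n. \<integral>x. (norm (u x - \<phi> n x))\<^sup>2 \<partial>lborel) \<longlonglongrightarrow> 0"
    "(\<lambda>n. \<integral>x. (norm (g x - cgrad (\<phi> n) x))\<^sup>2 \<partial>lborel) \<longlonglongrightarrow> 0"
    unfolding H0_def by blast
  have "sq_int lborel u" using assms by (simp add: H0_def)
  from sq_int_AE_subseq[OF this test_fun_sq_int(1)[OF \<phi>(1)] \<phi>(2)]
  obtain r where r: "strict_mono r" "AE x in lborel. (\<lambda>n. \<phi> (r n) x) \<longlonglongrightarrow> u x" .
  show ?thesis
    by (rule that[of "\<lambda>n. \<phi> (r n)", OF _ _ _ r(2)])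
       (use \<phi>(1) LIMSEQ_subseq_LIMSEQ[OF \<phi>(2) r(1)] LIMSEQ_subseq_LIMSEQ[OF \<phi>(3) r(1)] in \<open>simp_all add: o_def\<close>)
qed


section \<open>Chain rule and translations\<close>

text \<open>As \<Phi> is only C1, its composition with a test function need not be smooth. On the
  bounded range of \<psi> a polynomial approximates \<open>\<phi>'\<close> by Stone-Weierstrass, and
  its antiderivative composed with \<psi> is again a test function. The errors are relative to
  |\<psi>| and |grad \<psi>|, hence square integrable over the whole space.\<close>

lemma test_fun_chain_approx:
  fixes \<Phi> \<phi>' :: "real \<Rightarrow> real"
  assumes \<psi>: "test_fun \<Omega> \<psi>" and e: "e > 0"
    and d: "\<And>s. (\<Phi> has_real_derivative \<phi>' s) (at s)" and c: "continuous_on UNIV \<phi>'" and z: "\<Phi> 0 = 0"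
  obtains \<zeta> where "test_fun \<Omega> \<zeta>" "\<And>x. \<bar>\<Phi> (\<psi> x) - \<zeta> x\<bar> \<le> e * \<bar>\<psi> x\<bar>"
    "\<And>x. norm (\<phi>' (\<psi> x) *\<^sub>R cgrad \<psi> x - cgrad \<zeta> x) \<le> e * norm (cgrad \<psi> x)"
proof -
  obtain R where R: "R > 0" "\<And>x. \<bar>\<psi> x\<bar> \<le> R" using test_fun_bounded[OF \<psi>] by metis
  obtain p where p: "real_polynomial_function p" "\<And>s. s \<in> {-R..R} \<Longrightarrow> \<bar>\<phi>' s - p s\<bar> < e"
    using Stone_Weierstrass_real_polynomial_function[of "{-R..R}" \<phi>' e] e c
    by (metis compact_Icc continuous_on_subset subset_UNIV)
  then obtain a n where pa: "p = (\<lambda>x. \<Sum>i\<le>n. a i * x ^ i)"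
    unfolding real_polynomial_function_iff_sum by blast
  \<comment> \<open>The antiderivative without constant term: it keeps the support of \<psi> and
    agrees with \<Phi> at 0.\<close>
  define P where "P = (\<lambda>s. \<Sum>i\<le>n. (a i / (real i + 1)) * s ^ Suc i)"
  have dP: "(P has_real_derivative p s) (at s)" for s
  proof -
    have "(P has_real_derivative (\<Sum>i\<le>n. (a i / (real i + 1)) * (real (Suc i) * s ^ i))) (at s)"
      unfolding P_def by (intro DERIV_sum DERIV_cmult) (use DERIV_pow[of "Suc _" s] in simp)
    also have "(\<Sum>i\<le>n. (a i / (real i + 1)) * (real (Suc i) * s ^ i)) = p s"
      unfolding pa by (intro sum.cong refl) (simp add: field_simps)
    finally show ?thesis .
  qed
  have P0: "P 0 = 0" by (simp add: P_def)
  define \<zeta> where "\<zeta> = (\<lambda>x. P (\<psi> x))"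
  have in_R: "\<psi> x \<in> {-R..R}" for x using R(2)[of x] by auto
  show ?thesis
  proof (rule that[of \<zeta>])
    show "test_fun \<Omega> \<zeta>" unfolding \<zeta>_def P_def by (rule test_fun_polynomial[OF \<psi>])
    show "\<bar>\<Phi> (\<psi> x) - \<zeta> x\<bar> \<le> e * \<bar>\<psi> x\<bar>" for x
    proof -
      have "norm ((\<Phi> (\<psi> x) - P (\<psi> x)) - (\<Phi> 0 - P 0)) \<le> e * norm (\<psi> x - 0)"
      proof (rule field_differentiable_bound[where S = "{-R..R}"])
        show "((\<lambda>s. \<Phi> s - P s) has_field_derivative \<phi>' s - p s) (at s within {-R..R})" for s
          by (rule has_field_derivative_at_within[OF DERIV_diff[OF d dP]])
        show "norm (\<phi>' s - p s) \<le> e" if "s \<in> {-R..R}" for s using p(2)[OF that] by simp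
      qed (use in_R[of x] R(1) in simp_all)
      then show ?thesis by (simp add: z P0 \<zeta>_def)
    qed
    show "norm (\<phi>' (\<psi> x) *\<^sub>R cgrad \<psi> x - cgrad \<zeta> x) \<le> e * norm (cgrad \<psi> x)" for x
    proof -
      have "cgrad \<zeta> x = p (\<psi> x) *\<^sub>R cgrad \<psi> x"
        unfolding \<zeta>_def by (rule test_fun_cgrad_compose[OF \<psi> dP])
      then have "\<phi>' (\<psi> x) *\<^sub>R cgrad \<psi> x - cgrad \<zeta> x = (\<phi>' (\<psi> x) - p (\<psi> x)) *\<^sub>R cgrad \<psi> x"
        by (simp add: scaleR_diff_left)
      then show ?thesis using p(2)[OF in_R[of x]] by (auto intro!: mult_right_mono)
    qed
  qed
qed

lemma sum3_sq_le: "(a + b + c)\<^sup>2 \<le> 3 * a\<^sup>2 + 3 * b\<^sup>2 + 3 * (c::real)\<^sup>2"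
  using zero_le_power2[of "a - b"] zero_le_power2[of "b - c"] zero_le_power2[of "a - c"]
  by (simp add: power2_eq_square algebra_simps)

lemma lborel_integrable_bounded_mult:
  fixes w :: "'a::euclidean_space \<Rightarrow> real"
  assumes "integrable lborel w" "c \<in> borel_measurable borel" "\<And>x. \<bar>c x\<bar> \<le> B"
  shows "integrable lborel (\<lambda>x. c x * w x)"
proof (rule Bochner_Integration.integrable_bound)
  show "integrable lborel (\<lambda>x. B * \<bar>w x\<bar>)" using assms(1) by simp
  show "(\<lambda>x. c x * w x) \<in> borel_measurable lborel"
    using assms(1,2) by measurable
  show "AE x in lborel. norm (c x * w x) \<le> norm (B * \<bar>w x\<bar>)"
  proof (rule AE_I2)
    fix x
    have "\<bar>c x\<bar> * \<bar>w x\<bar> \<le> B * \<bar>w x\<bar>" using assms(3)[of x] by (rule mult_right_mono) simp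
    also have "\<dots> \<le> \<bar>B\<bar> * \<bar>w x\<bar>" by (rule mult_right_mono) auto
    finally show "norm (c x * w x) \<le> norm (B * \<bar>w x\<bar>)" by (simp add: abs_mult)
  qed
qed

text \<open>The error of the gradients splits into three parts: the change of \<open>\<phi>'\<close>
  from u to the approximation, times grad u, which vanishes by dominated convergence; a bounded
  factor times the error of grad u; and the error of the polynomial. The continuity of
  \<open>\<phi>'\<close> is why every truncation used later has a continuous derivative.\<close>

theorem H0_chain:
  fixes \<Phi> \<phi>' :: "real \<Rightarrow> real"
  assumes H: "H0 \<Omega> u g"
    and d: "\<And>s. (\<Phi> has_real_derivative \<phi>' s) (at s)" and c: "continuous_on UNIV \<phi>'"
    and b: "\<And>s. \<bar>\<phi>' s\<bar> \<le> B" and z: "\<Phi> 0 = 0"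
  shows "H0 \<Omega> (\<lambda>x. \<Phi> (u x)) (\<lambda>x. \<phi>' (u x) *\<^sub>R g x)"
proof -
  have B: "B \<ge> 0" using b[of 0] by simp
  obtain \<psi> where \<psi>': "\<forall>n::nat. test_fun \<Omega> (\<psi> n)"
    "(\<lambda>n. \<integral>x. (norm (u x - \<psi> n x))\<^sup>2 \<partial>lborel) \<longlonglongrightarrow> 0"
    "(\<lambda>n. \<integral>x. (norm (g x - cgrad (\<psi> n) x))\<^sup>2 \<partial>lborel) \<longlonglongrightarrow> 0"
    "AE x in lborel. (\<lambda>n. \<psi> n x) \<longlonglongrightarrow> u x"
    using H0_approx[OF H] .
  note \<psi> = \<psi>'(1)[THEN spec] \<psi>'(2-4)
  define e where "e = (\<lambda>n::nat. inverse (real (Suc n)))"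
  have e: "0 < e n" "e n \<le> 1" for n by (auto simp: e_def divide_simps)
  have "\<exists>\<zeta>. test_fun \<Omega> \<zeta> \<and> (\<forall>x. \<bar>\<Phi> (\<psi> n x) - \<zeta> x\<bar> \<le> e n * \<bar>\<psi> n x\<bar>) \<and>
    (\<forall>x. norm (\<phi>' (\<psi> n x) *\<^sub>R cgrad (\<psi> n) x - cgrad \<zeta> x) \<le> e n * norm (cgrad (\<psi> n) x))" for n
    using test_fun_chain_approx[OF \<psi>(1) e(1) d c z] by metis
  then obtain \<zeta> where \<zeta>: "\<And>n. test_fun \<Omega> (\<zeta> n)"
    "\<And>n x. \<bar>\<Phi> (\<psi> n x) - \<zeta> n x\<bar> \<le> e n * \<bar>\<psi> n x\<bar>"
    "\<And>n x. norm (\<phi>' (\<psi> n x) *\<^sub>R cgrad (\<psi> n) x - cgrad (\<zeta> n) x) \<le> e n * norm (cgrad (\<psi> n) x)"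
    by metis
  have [measurable]: "u \<in> borel_measurable borel" "g \<in> borel_measurable borel"
    "\<psi> n \<in> borel_measurable borel" "cgrad (\<psi> n) \<in> borel_measurable borel"
    "\<zeta> n \<in> borel_measurable borel" "cgrad (\<zeta> n) \<in> borel_measurable borel" for n
    using H test_fun_borel[OF \<psi>(1)] test_fun_borel[OF \<zeta>(1)] by (auto simp: H0_def)
  have [measurable]: "\<phi>' \<in> borel_measurable borel" using c by (rule borel_measurable_continuous_onI)
  have [measurable]: "\<Phi> \<in> borel_measurable borel"
    by (intro borel_measurable_continuous_onI continuous_at_imp_continuous_on ballI DERIV_isCont[OF d])
  have sq: "sq_int lborel u" "sq_int lborel g" using H by (auto simp: H0_def)
  have sqn: "sq_int lborel (\<lambda>x. u x - \<psi> n x)" "sq_int lborel (\<lambda>x. g x - cgrad (\<psi> n) x)" for n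
    using sq_int_diff[OF sq(1) test_fun_sq_int(1)[OF \<psi>(1)]] sq_int_diff[OF sq(2) test_fun_sq_int(2)[OF \<psi>(1)]] by auto
  have int: "integrable lborel (\<lambda>x. (norm (u x))\<^sup>2)" "integrable lborel (\<lambda>x. (norm (g x))\<^sup>2)"
    "integrable lborel (\<lambda>x. (norm (u x - \<psi> n x))\<^sup>2)" "integrable lborel (\<lambda>x. (norm (g x - cgrad (\<psi> n) x))\<^sup>2)" for n
    using sq sqn by (auto simp: sq_int_def)
  have lip: "\<bar>\<Phi> s - \<Phi> r\<bar> \<le> B * \<bar>s - r\<bar>" for s r
    using field_differentiable_bound[of UNIV \<Phi> \<phi>' B s r] d b by simp
  have s1: "sq_int lborel (\<lambda>x. \<Phi> (u x))"
  proof (rule sq_int_bound)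
    show "integrable lborel (\<lambda>x. B\<^sup>2 * (norm (u x))\<^sup>2)" using int by simp
    show "(norm (\<Phi> (u x)))\<^sup>2 \<le> B\<^sup>2 * (norm (u x))\<^sup>2" for x
      using power_mono[OF lip[of "u x" 0], of 2] by (simp add: z power_mult_distrib)
  qed simp
  have s2: "sq_int lborel (\<lambda>x. \<phi>' (u x) *\<^sub>R g x)"
    by (rule sq_int_scaleR_bounded[OF sq(2) _ b]) simp
  have e0: "e \<longlonglongrightarrow> 0" unfolding e_def by (rule LIMSEQ_inverse_real_of_nat)
  \<comment> \<open>B is the Lipschitz constant of \<Phi>; the added 1 bounds \<open>e n\<close>
    after |\<psi>| is estimated by |u - \<psi>| + |u|.\<close>
  let ?a = "\<lambda>n. 2 * (B + 1)\<^sup>2 * (\<integral>x. (norm (u x - \<psi> n x))\<^sup>2 \<partial>lborel) + 2 * (e n)\<^sup>2 * (\<integral>x. (norm (u x))\<^sup>2 \<partial>lborel)"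
  have c1: "(\<lambda>n. \<integral>x. (norm (\<Phi> (u x) - \<zeta> n x))\<^sup>2 \<partial>lborel) \<longlonglongrightarrow> 0"
  proof (rule Lim_null_comparison)
    show "\<forall>\<^sub>F n in sequentially. norm (\<integral>x. (norm (\<Phi> (u x) - \<zeta> n x))\<^sup>2 \<partial>lborel) \<le>
       ?a n"
    proof (rule always_eventually, rule allI)
      fix n
      have "(norm (\<Phi> (u x) - \<zeta> n x))\<^sup>2 \<le> 2 * (B + 1)\<^sup>2 * (norm (u x - \<psi> n x))\<^sup>2 + 2 * (e n)\<^sup>2 * (norm (u x))\<^sup>2" for x
      proof -
        have "\<bar>\<psi> n x\<bar> \<le> \<bar>u x - \<psi> n x\<bar> + \<bar>u x\<bar>" by simp
        then have "e n * \<bar>\<psi> n x\<bar> \<le> e n * (\<bar>u x - \<psi> n x\<bar> + \<bar>u x\<bar>)" using e(1)[of n] by simp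
        moreover have "e n * \<bar>u x - \<psi> n x\<bar> \<le> 1 * \<bar>u x - \<psi> n x\<bar>" using e(2)[of n] by (intro mult_right_mono) auto
        ultimately have "\<bar>\<Phi> (u x) - \<zeta> n x\<bar> \<le> (B + 1) * \<bar>u x - \<psi> n x\<bar> + e n * \<bar>u x\<bar>"
          using lip[of "u x" "\<psi> n x"] \<zeta>(2)[of n x]
            abs_triangle_ineq[of "\<Phi> (u x) - \<Phi> (\<psi> n x)" "\<Phi> (\<psi> n x) - \<zeta> n x"]
          by (simp add: algebra_simps)
        then have "\<bar>\<Phi> (u x) - \<zeta> n x\<bar>\<^sup>2 \<le> ((B + 1) * \<bar>u x - \<psi> n x\<bar> + e n * \<bar>u x\<bar>)\<^sup>2"
          by (intro power_mono) auto
        also have "\<dots> \<le> 2 * ((B + 1) * \<bar>u x - \<psi> n x\<bar>)\<^sup>2 + 2 * (e n * \<bar>u x\<bar>)\<^sup>2"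
          using norm_add_sq_le[of "(B + 1) * \<bar>u x - \<psi> n x\<bar>" "e n * \<bar>u x\<bar>"] by simp
        finally show ?thesis by (simp add: power_mult_distrib)
      qed
      then have "(\<integral>x. (norm (\<Phi> (u x) - \<zeta> n x))\<^sup>2 \<partial>lborel) \<le>
         (\<integral>x. 2 * (B + 1)\<^sup>2 * (norm (u x - \<psi> n x))\<^sup>2 + 2 * (e n)\<^sup>2 * (norm (u x))\<^sup>2 \<partial>lborel)"
        using int sq_int_diff[OF s1 test_fun_sq_int(1)[OF \<zeta>(1)]]
        by (intro integral_mono) (auto simp: sq_int_def)
      then show "norm (\<integral>x. (norm (\<Phi> (u x) - \<zeta> n x))\<^sup>2 \<partial>lborel) \<le>
        ?a n"
        using int by simp
    qed
    have "?a
       \<longlonglongrightarrow> 2 * (B + 1)\<^sup>2 * 0 + 2 * 0\<^sup>2 * (\<integral>x. (norm (u x))\<^sup>2 \<partial>lborel)"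
      by (intro tendsto_intros \<psi> e0)
    then show "?a
       \<longlonglongrightarrow> 0" by simp
  qed
  have dom: "(\<lambda>n. \<integral>x. (\<phi>' (u x) - \<phi>' (\<psi> n x))\<^sup>2 * (norm (g x))\<^sup>2 \<partial>lborel) \<longlonglongrightarrow> (\<integral>x. 0 \<partial>(lborel :: 'a measure))"
  proof (rule integral_dominated_convergence)
    show "integrable lborel (\<lambda>x. (2 * B)\<^sup>2 * (norm (g x))\<^sup>2)" using int by simp
    show "AE x in lborel. (\<lambda>n. (\<phi>' (u x) - \<phi>' (\<psi> n x))\<^sup>2 * (norm (g x))\<^sup>2) \<longlonglongrightarrow> 0"
      using \<psi>(4)
    proof eventually_elim
      case (elim x)
      have "(\<lambda>n. \<phi>' (\<psi> n x)) \<longlonglongrightarrow> \<phi>' (u x)"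
        using continuous_on_tendsto_compose[OF c elim] by simp
      then have "(\<lambda>n. (\<phi>' (u x) - \<phi>' (\<psi> n x))\<^sup>2 * (norm (g x))\<^sup>2) \<longlonglongrightarrow> (\<phi>' (u x) - \<phi>' (u x))\<^sup>2 * (norm (g x))\<^sup>2"
        by (intro tendsto_intros)
      then show ?case by simp
    qed
    show "AE x in lborel. norm ((\<phi>' (u x) - \<phi>' (\<psi> n x))\<^sup>2 * (norm (g x))\<^sup>2) \<le> (2 * B)\<^sup>2 * (norm (g x))\<^sup>2" for n
    proof (rule AE_I2)
      fix x
      have "\<bar>\<phi>' (u x) - \<phi>' (\<psi> n x)\<bar> \<le> 2 * B" using b[of "u x"] b[of "\<psi> n x"] by linarith
      then have "\<bar>\<phi>' (u x) - \<phi>' (\<psi> n x)\<bar>\<^sup>2 \<le> (2 * B)\<^sup>2" by (intro power_mono) auto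
      then show "norm ((\<phi>' (u x) - \<phi>' (\<psi> n x))\<^sup>2 * (norm (g x))\<^sup>2) \<le> (2 * B)\<^sup>2 * (norm (g x))\<^sup>2"
        by (auto simp: abs_mult intro!: mult_right_mono)
    qed
  qed measurable
  let ?b = "\<lambda>n. 3 * (\<integral>x. (\<phi>' (u x) - \<phi>' (\<psi> n x))\<^sup>2 * (norm (g x))\<^sup>2 \<partial>lborel) +
       3 * (B + 1)\<^sup>2 * (\<integral>x. (norm (g x - cgrad (\<psi> n) x))\<^sup>2 \<partial>lborel) + 3 * (e n)\<^sup>2 * (\<integral>x. (norm (g x))\<^sup>2 \<partial>lborel)"
  have c2: "(\<lambda>n. \<integral>x. (norm (\<phi>' (u x) *\<^sub>R g x - cgrad (\<zeta> n) x))\<^sup>2 \<partial>lborel) \<longlonglongrightarrow> 0"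
  proof (rule Lim_null_comparison)
    show "\<forall>\<^sub>F n in sequentially. norm (\<integral>x. (norm (\<phi>' (u x) *\<^sub>R g x - cgrad (\<zeta> n) x))\<^sup>2 \<partial>lborel) \<le>
       ?b n"
    proof (rule always_eventually, rule allI)
      fix n
      let ?d = "\<lambda>x. (\<phi>' (u x) - \<phi>' (\<psi> n x))\<^sup>2 * (norm (g x))\<^sup>2"
      have ia: "integrable lborel ?d"
      proof (rule lborel_integrable_bounded_mult[OF int(2)])
        show "\<bar>(\<phi>' (u x) - \<phi>' (\<psi> n x))\<^sup>2\<bar> \<le> (2 * B)\<^sup>2" for x
        proof -
          have "\<bar>\<phi>' (u x) - \<phi>' (\<psi> n x)\<bar> \<le> 2 * B" using b[of "u x"] b[of "\<psi> n x"] by linarith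
          then have "\<bar>\<phi>' (u x) - \<phi>' (\<psi> n x)\<bar>\<^sup>2 \<le> (2 * B)\<^sup>2" by (intro power_mono) auto
          then show ?thesis by simp
        qed
      qed simp
      have "(norm (\<phi>' (u x) *\<^sub>R g x - cgrad (\<zeta> n) x))\<^sup>2 \<le>
         3 * ?d x + 3 * (B + 1)\<^sup>2 * (norm (g x - cgrad (\<psi> n) x))\<^sup>2 + 3 * (e n)\<^sup>2 * (norm (g x))\<^sup>2" for x
      proof -
        let ?g = "cgrad (\<psi> n) x"
        have "norm ?g \<le> norm (g x - ?g) + norm (g x)"
          by (metis norm_minus_commute norm_triangle_sub add.commute)
        then have "e n * norm ?g \<le> e n * (norm (g x - ?g) + norm (g x))" using e(1)[of n] by simp
        moreover have "e n * norm (g x - ?g) \<le> 1 * norm (g x - ?g)" using e(2)[of n] by (intro mult_right_mono) auto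
        ultimately have 3: "norm (\<phi>' (\<psi> n x) *\<^sub>R ?g - cgrad (\<zeta> n) x) \<le> norm (g x - ?g) + e n * norm (g x)"
          using \<zeta>(3)[of n x] by (simp add: algebra_simps)
        have 2: "norm (\<phi>' (\<psi> n x) *\<^sub>R (g x - ?g)) \<le> B * norm (g x - ?g)"
          using b by (auto intro!: mult_right_mono)
        have "\<phi>' (u x) *\<^sub>R g x - cgrad (\<zeta> n) x = (\<phi>' (u x) - \<phi>' (\<psi> n x)) *\<^sub>R g x
          + \<phi>' (\<psi> n x) *\<^sub>R (g x - ?g) + (\<phi>' (\<psi> n x) *\<^sub>R ?g - cgrad (\<zeta> n) x)"
          by (simp add: algebra_simps)
        then have "norm (\<phi>' (u x) *\<^sub>R g x - cgrad (\<zeta> n) x) \<le> norm ((\<phi>' (u x) - \<phi>' (\<psi> n x)) *\<^sub>R g x)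
          + norm (\<phi>' (\<psi> n x) *\<^sub>R (g x - ?g)) + norm (\<phi>' (\<psi> n x) *\<^sub>R ?g - cgrad (\<zeta> n) x)"
          by (metis norm_triangle_ineq norm_triangle_le add_right_mono)
        also have "\<dots> \<le> \<bar>\<phi>' (u x) - \<phi>' (\<psi> n x)\<bar> * norm (g x) + (B + 1) * norm (g x - ?g) + e n * norm (g x)"
          using 2 3 by (simp add: distrib_right)
        finally have "(norm (\<phi>' (u x) *\<^sub>R g x - cgrad (\<zeta> n) x))\<^sup>2 \<le>
          (\<bar>\<phi>' (u x) - \<phi>' (\<psi> n x)\<bar> * norm (g x) + (B + 1) * norm (g x - ?g) + e n * norm (g x))\<^sup>2"
          by (intro power_mono) auto
        also note sum3_sq_le
        finally show ?thesis by (simp add: power_mult_distrib)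
      qed
      then have "(\<integral>x. (norm (\<phi>' (u x) *\<^sub>R g x - cgrad (\<zeta> n) x))\<^sup>2 \<partial>lborel) \<le>
         (\<integral>x. 3 * ?d x + 3 * (B + 1)\<^sup>2 * (norm (g x - cgrad (\<psi> n) x))\<^sup>2 + 3 * (e n)\<^sup>2 * (norm (g x))\<^sup>2 \<partial>lborel)"
        using int ia sq_int_diff[OF s2 test_fun_sq_int(2)[OF \<zeta>(1)]]
        by (intro integral_mono) (auto simp: sq_int_def)
      then show "norm (\<integral>x. (norm (\<phi>' (u x) *\<^sub>R g x - cgrad (\<zeta> n) x))\<^sup>2 \<partial>lborel) \<le>
       ?b n"
        using int ia by simp
    qed
    have "?b
       \<longlonglongrightarrow> 3 * (\<integral>x. 0 \<partial>(lborel :: 'a measure)) + 3 * (B + 1)\<^sup>2 * 0 + 3 * 0\<^sup>2 * (\<integral>x. (norm (g x))\<^sup>2 \<partial>lborel)"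
      by (intro tendsto_intros \<psi> e0 dom)
    then show "?b
       \<longlonglongrightarrow> 0" by simp
  qed
  show ?thesis unfolding H0_def using s1 s2 c1 c2 \<zeta>(1) by (intro conjI exI[of _ \<zeta>]) auto
qed

section \<open>Translation estimate in terms of the Dirichlet integral\<close>

lemma nn_integral_lborel_translate:
  fixes f :: "'a::euclidean_space \<Rightarrow> ennreal"
  assumes "f \<in> borel_measurable borel"
  shows "(\<integral>\<^sup>+x. f (x + c) \<partial>lborel) = (\<integral>\<^sup>+x. f x \<partial>lborel)"
proof -
  have "(\<integral>\<^sup>+x. f x \<partial>lborel) = (\<integral>\<^sup>+x. f x \<partial>distr lborel borel ((+) c))"
    by (simp add: lborel_distr_plus)
  also have "\<dots> = (\<integral>\<^sup>+x. f (c + x) \<partial>lborel)"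
    by (rule nn_integral_distr) (use assms in auto)
  finally show ?thesis by (simp add: add.commute)
qed

lemma AE_lborel_translate:
  assumes "AE x in lborel. P (x::'a::euclidean_space)"
  shows "AE x in lborel. P (x + c)"
proof -
  have "AE x in distr lborel borel ((+) c). P x" by (subst lborel_distr_plus) (rule assms)
  then have "AE x in lborel. P (c + x)" by (rule AE_distrD[rotated]) simp
  then show ?thesis by (simp add: add.commute)
qed

text \<open>The increment D is the mean over [0, 1] of the directional derivative c along the
  segment, and integrating (c - D)^2 \<ge> 0 gives D^2 at most the integral of c^2. The bound is
  stated with nonnegative integrals so that Tonelli's theorem applies to it directly.\<close>

lemma test_fun_increment_sq:
  assumes t: "test_fun \<Omega> \<phi>"
  shows "ennreal ((\<phi> (x + y) - \<phi> x)\<^sup>2) \<le>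
    (\<integral>\<^sup>+s. ennreal ((norm y)\<^sup>2 * (norm (cgrad \<phi> (x + s *\<^sub>R y)))\<^sup>2) * indicator {0..1} s \<partial>lborel)"
proof -
  define c where "c s = cgrad \<phi> (x + s *\<^sub>R y) \<bullet> y" for s :: real
  define D where "D = \<phi> (x + y) - \<phi> x"
  have cont: "continuous_on {0..1} (\<lambda>s. cgrad \<phi> (x + s *\<^sub>R y))"
    by (rule continuous_on_compose2[OF test_fun_continuous_cgrad[OF t]]) (auto intro!: continuous_intros)
  then have cc: "continuous_on {0..1} c" unfolding c_def by (intro continuous_intros)
  have "((\<lambda>s. \<phi> (x + s *\<^sub>R y)) has_vector_derivative c s) (at s within {0..1})" for s
  proof -
    have "((\<lambda>s. x + s *\<^sub>R y) has_derivative (\<lambda>h. h *\<^sub>R y)) (at s)"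
      by (auto intro!: derivative_eq_intros)
    from has_derivative_compose[OF this test_fun_has_derivative[OF t]]
    have "((\<lambda>s. \<phi> (x + s *\<^sub>R y)) has_vector_derivative c s) (at s)"
      by (simp add: has_vector_derivative_def c_def)
    then show ?thesis by (rule has_vector_derivative_at_within)
  qed
  then have "(c has_integral \<phi> (x + 1 *\<^sub>R y) - \<phi> (x + 0 *\<^sub>R y)) {0..1}"
    by (intro fundamental_theorem_of_calculus) auto
  then have 1: "(c has_integral D) {0..1}" by (simp add: D_def)
  have 2: "((\<lambda>s. (c s)\<^sup>2) has_integral integral {0..1} (\<lambda>s. (c s)\<^sup>2)) {0..1}"
    by (intro integrable_integral integrable_continuous_real continuous_intros cc)
  have "((\<lambda>s. (c s)\<^sup>2 - 2 * D * c s + D\<^sup>2) has_integral integral {0..1} (\<lambda>s. (c s)\<^sup>2) - 2 * D * D + D\<^sup>2) {0..1}"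
    using has_integral_add[OF has_integral_diff[OF 2 has_integral_mult_right[OF 1, of "2 * D"]]
       has_integral_const_real[of "D\<^sup>2" 0 1]] by simp
  then have "0 \<le> integral {0..1} (\<lambda>s. (c s)\<^sup>2) - 2 * D * D + D\<^sup>2"
  proof (rule has_integral_nonneg)
    show "0 \<le> (c s)\<^sup>2 - 2 * D * c s + D\<^sup>2" for s
      using zero_le_power2[of "c s - D"] by (simp add: power2_diff algebra_simps)
  qed
  then have "D\<^sup>2 \<le> integral {0..1} (\<lambda>s. (c s)\<^sup>2)" by (simp add: power2_eq_square)
  also have "\<dots> \<le> integral {0..1} (\<lambda>s. (norm y)\<^sup>2 * (norm (cgrad \<phi> (x + s *\<^sub>R y)))\<^sup>2)"
  proof (rule integral_le)
    show "(c s)\<^sup>2 \<le> (norm y)\<^sup>2 * (norm (cgrad \<phi> (x + s *\<^sub>R y)))\<^sup>2" for s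
      using power_mono[OF Cauchy_Schwarz_ineq2[of "cgrad \<phi> (x + s *\<^sub>R y)" y], of 2]
      by (simp add: c_def power_mult_distrib mult.commute)
  qed (intro integrable_continuous_real continuous_intros cc cont)+
  finally have "ennreal (D\<^sup>2) \<le> ennreal (integral {0..1} (\<lambda>s. (norm y)\<^sup>2 * (norm (cgrad \<phi> (x + s *\<^sub>R y)))\<^sup>2))"
    by (rule ennreal_leI)
  also have "\<dots> = (\<integral>\<^sup>+s. ennreal ((norm y)\<^sup>2 * (norm (cgrad \<phi> (x + s *\<^sub>R y)))\<^sup>2) * indicator {0..1} s \<partial>lborel)"
  proof (rule nn_integral_has_integral_lebesgue'[symmetric])
    show "((\<lambda>s. (norm y)\<^sup>2 * (norm (cgrad \<phi> (x + s *\<^sub>R y)))\<^sup>2) has_integral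
      integral {0..1} (\<lambda>s. (norm y)\<^sup>2 * (norm (cgrad \<phi> (x + s *\<^sub>R y)))\<^sup>2)) {0..1}"
      by (intro integrable_integral integrable_continuous_real continuous_intros cont)
  qed simp
  finally show ?thesis by (simp add: D_def)
qed

text \<open>Exchanging the integrals, the inner one over x does not depend on s by translation
  invariance, so the average over the segment disappears.\<close>

lemma test_fun_translation:
  fixes \<phi> :: "'a::euclidean_space \<Rightarrow> real"
  assumes t: "test_fun \<Omega> \<phi>"
  shows "(\<integral>\<^sup>+x. ennreal ((\<phi> (x + y) - \<phi> x)\<^sup>2) \<partial>lborel) \<le> ennreal ((norm y)\<^sup>2 * (\<integral>x. (norm (cgrad \<phi> x))\<^sup>2 \<partial>lborel))"
proof -
  have [measurable]: "cgrad \<phi> \<in> borel_measurable borel" using test_fun_borel[OF t] by simp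
  let ?F = "\<lambda>x s. ennreal ((norm y)\<^sup>2 * (norm (cgrad \<phi> (x + s *\<^sub>R y)))\<^sup>2) * indicator {0..1::real} s"
  have "(\<integral>\<^sup>+x. ennreal ((\<phi> (x + y) - \<phi> x)\<^sup>2) \<partial>lborel) \<le> (\<integral>\<^sup>+x. \<integral>\<^sup>+s. ?F x s \<partial>lborel \<partial>lborel)"
    by (intro nn_integral_mono test_fun_increment_sq[OF t])
  also have "\<dots> = (\<integral>\<^sup>+s. \<integral>\<^sup>+x. ?F x s \<partial>lborel \<partial>lborel)"
    by (rule lborel_pair.Fubini'[symmetric]) measurable
  also have "\<dots> = (\<integral>\<^sup>+s. ennreal ((norm y)\<^sup>2) * (\<integral>\<^sup>+x. ennreal ((norm (cgrad \<phi> x))\<^sup>2) \<partial>lborel) * indicator {0..1::real} s \<partial>lborel)"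
  proof (rule nn_integral_cong)
    fix s :: real
    have "(\<integral>\<^sup>+x. ?F x s \<partial>lborel) = (\<integral>\<^sup>+x. ennreal ((norm y)\<^sup>2 * (norm (cgrad \<phi> x))\<^sup>2) * indicator {0..1::real} s \<partial>lborel)"
      by (rule nn_integral_lborel_translate) measurable
    also have "\<dots> = ennreal ((norm y)\<^sup>2) * (\<integral>\<^sup>+x. ennreal ((norm (cgrad \<phi> x))\<^sup>2) \<partial>lborel) * indicator {0..1::real} s"
      by (simp add: nn_integral_multc nn_integral_cmult ennreal_mult)
    finally show "(\<integral>\<^sup>+x. ?F x s \<partial>lborel) = \<dots>" .
  qed
  also have "\<dots> = ennreal ((norm y)\<^sup>2) * (\<integral>\<^sup>+x. ennreal ((norm (cgrad \<phi> x))\<^sup>2) \<partial>lborel)"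
    by (simp add: nn_integral_cmult)
  also have "\<dots> = ennreal ((norm y)\<^sup>2 * (\<integral>x. (norm (cgrad \<phi> x))\<^sup>2 \<partial>lborel))"
    by (subst nn_integral_eq_integral) (use test_fun_integrable[OF t] in \<open>auto simp: ennreal_mult\<close>)
  finally show ?thesis .
qed

text \<open>Fatou's lemma along an almost everywhere convergent approximation: only an upper bound
  of the left side is wanted, and the Dirichlet integrals on the right converge.\<close>

lemma H0_translation:
  fixes u :: "'a::euclidean_space \<Rightarrow> real"
  assumes H: "H0 \<Omega> u g"
  shows "(\<integral>\<^sup>+x. ennreal ((u (x + y) - u x)\<^sup>2) \<partial>lborel) \<le> ennreal ((norm y)\<^sup>2 * (\<integral>x. (norm (g x))\<^sup>2 \<partial>lborel))"
proof -
  obtain \<psi> where \<psi>': "\<forall>n::nat. test_fun \<Omega> (\<psi> n)"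
    "(\<lambda>n. \<integral>x. (norm (u x - \<psi> n x))\<^sup>2 \<partial>lborel) \<longlonglongrightarrow> 0"
    "(\<lambda>n. \<integral>x. (norm (g x - cgrad (\<psi> n) x))\<^sup>2 \<partial>lborel) \<longlonglongrightarrow> 0"
    "AE x in lborel. (\<lambda>n. \<psi> n x) \<longlonglongrightarrow> u x"
    using H0_approx[OF H] .
  note \<psi> = \<psi>'(1)[THEN spec] \<psi>'(2-4)
  have [measurable]: "\<psi> n \<in> borel_measurable borel" for n using test_fun_borel[OF \<psi>(1)] by auto
  have "AE x in lborel. (\<lambda>n. \<psi> n (x + y)) \<longlonglongrightarrow> u (x + y)" using \<psi>(4) by (rule AE_lborel_translate)
  with \<psi>(4) have "AE x in lborel. ennreal ((u (x + y) - u x)\<^sup>2) = liminf (\<lambda>n. ennreal ((\<psi> n (x + y) - \<psi> n x)\<^sup>2))"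
  proof eventually_elim
    case (elim x)
    then have "(\<lambda>n. ennreal ((\<psi> n (x + y) - \<psi> n x)\<^sup>2)) \<longlonglongrightarrow> ennreal ((u (x + y) - u x)\<^sup>2)"
      by (intro tendsto_ennrealI tendsto_intros)
    then show ?case by (rule lim_imp_Liminf[OF trivial_limit_sequentially, symmetric])
  qed
  then have "(\<integral>\<^sup>+x. ennreal ((u (x + y) - u x)\<^sup>2) \<partial>lborel) = (\<integral>\<^sup>+x. liminf (\<lambda>n. ennreal ((\<psi> n (x + y) - \<psi> n x)\<^sup>2)) \<partial>lborel)"
    by (rule nn_integral_cong_AE)
  also have "\<dots> \<le> liminf (\<lambda>n. \<integral>\<^sup>+x. ennreal ((\<psi> n (x + y) - \<psi> n x)\<^sup>2) \<partial>lborel)"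
    by (rule nn_integral_liminf) measurable
  also have "\<dots> \<le> liminf (\<lambda>n. ennreal ((norm y)\<^sup>2 * (\<integral>x. (norm (cgrad (\<psi> n) x))\<^sup>2 \<partial>lborel)))"
    by (intro Liminf_mono always_eventually allI test_fun_translation[OF \<psi>(1)])
  also have "\<dots> = ennreal ((norm y)\<^sup>2 * (\<integral>x. (norm (g x))\<^sup>2 \<partial>lborel))"
  proof -
    have "(\<lambda>n. \<integral>x. (norm (cgrad (\<psi> n) x))\<^sup>2 \<partial>lborel) \<longlonglongrightarrow> (\<integral>x. (norm (g x))\<^sup>2 \<partial>lborel)"
      using H \<psi> by (intro sq_int_norm_tendsto test_fun_sq_int) (auto simp: H0_def)
    then have "(\<lambda>n. ennreal ((norm y)\<^sup>2 * (\<integral>x. (norm (cgrad (\<psi> n) x))\<^sup>2 \<partial>lborel)))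
       \<longlonglongrightarrow> ennreal ((norm y)\<^sup>2 * (\<integral>x. (norm (g x))\<^sup>2 \<partial>lborel))"
      by (intro tendsto_ennrealI tendsto_intros)
    then show ?thesis by (simp add: lim_imp_Liminf)
  qed
  finally show ?thesis .
qed


section \<open>Faber--Krahn inequality\<close>

text \<open>Averaging the translation estimate over a ball of twice the measure of the support:
  for each \<open>x\<close>, the function \<open>u (x + \<cdot>)\<close> vanishes on at least half of the ball.\<close>
theorem Faber_Krahn:
  "\<exists>C>0. \<forall>\<Omega> (u :: 'a::euclidean_space \<Rightarrow> real) g m. H0 \<Omega> u g \<longrightarrow> 0 \<le> m \<longrightarrow>
     emeasure lborel {x. u x \<noteq> 0} \<le> ennreal m \<longrightarrow>
     (\<integral>x. (u x)\<^sup>2 \<partial>lborel) \<le> C * m powr (2 / real DIM('a)) * (\<integral>x. (norm (g x))\<^sup>2 \<partial>lborel)"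
proof -
  define d where "d = real DIM('a)"
  have d: "d > 0" by (simp add: d_def)
  define w where "w = unit_ball_vol d"
  have w: "w > 0" by (simp add: w_def d_def)
  have main: "(\<integral>x. (u x)\<^sup>2 \<partial>lborel) \<le> 2 * (2 / w) powr (2 / d) * m powr (2 / d) * (\<integral>x. (norm (g x))\<^sup>2 \<partial>lborel)"
    if H: "H0 \<Omega> u g" and m0: "0 \<le> m" and em: "emeasure lborel {x. u x \<noteq> 0} \<le> ennreal m"
    for \<Omega> and u :: "'a \<Rightarrow> real" and g m
  \<comment> \<open>For m = 0 the radius below would be 0 and the final division by m would fail;
    here u vanishes almost everywhere.\<close>
  proof (cases "m = 0")
    case True
    have [measurable]: "u \<in> borel_measurable borel" using H by (simp add: H0_def)
    have "{x. u x \<noteq> 0} \<in> sets lborel" by measurable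
    then have "{x. u x \<noteq> 0} \<in> null_sets lborel" using em True by (simp add: null_sets_def)
    then have "AE x in lborel. u x = 0" by (rule AE_I') auto
    then have "(\<integral>x. (u x)\<^sup>2 \<partial>lborel) = (\<integral>x. 0 \<partial>(lborel :: 'a measure))"
      by (intro integral_cong_AE) auto
    then show ?thesis using True by simp
  next
    case False
    then have m: "m > 0" using m0 by simp
    define D where "D = (\<integral>x. (norm (g x))\<^sup>2 \<partial>lborel)"
    have D: "D \<ge> 0" by (simp add: D_def)
    have [measurable]: "u \<in> borel_measurable borel" using H by (simp add: H0_def)
    \<comment> \<open>The radius for which the ball has measure 2m.\<close>
    define r where "r = (2 * m / w) powr (1 / d)"
    have r: "r > 0" using m w by (simp add: r_def)
    have "r ^ DIM('a) = r powr d" using r by (simp add: powr_realpow d_def)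
    also have "\<dots> = 2 * m / w" using d m w by (simp add: r_def powr_powr)
    finally have rd: "w * r ^ DIM('a) = 2 * m" using w by simp
    have eB: "emeasure lborel (ball 0 r :: 'a set) = ennreal (2 * m)"
      using r rd by (simp add: emeasure_ball w_def d_def)
    have r2: "r\<^sup>2 = (2 / w) powr (2 / d) * m powr (2 / d)"
    proof -
      have "r\<^sup>2 = r powr 2" using r by (simp add: powr_numeral)
      also have "\<dots> = (2 / w * m) powr (2 / d)" by (simp add: r_def powr_powr)
      also have "\<dots> = (2 / w) powr (2 / d) * m powr (2 / d)" by (rule powr_mult)
      finally show ?thesis .
    qed
    have [measurable]: "(ball 0 r :: 'a set) \<in> sets borel" by simp
    let ?F = "\<lambda>x y. ennreal ((u (x + y) - u x)\<^sup>2) * indicator (ball 0 r) y"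
    have low: "ennreal ((u x)\<^sup>2) * ennreal m \<le> (\<integral>\<^sup>+y. ?F x y \<partial>lborel)" for x
    proof -
      let ?Z = "{y \<in> ball 0 r. u (x + y) = 0}" and ?N = "{y. u (x + y) \<noteq> 0}"
      have "emeasure lborel ?N = (\<integral>\<^sup>+y. indicator ?N y \<partial>lborel)"
        by (rule nn_integral_indicator[symmetric]) measurable
      also have "\<dots> = (\<integral>\<^sup>+y. indicator {z. u z \<noteq> 0} (y + x) \<partial>lborel)"
        by (intro nn_integral_cong) (auto simp: indicator_def add.commute)
      also have "\<dots> = emeasure lborel {z. u z \<noteq> 0}"
        by (subst nn_integral_lborel_translate) auto
      finally have N: "emeasure lborel ?N \<le> ennreal m" using em by simp
      have "ennreal m + ennreal m = emeasure lborel (ball 0 r :: 'a set)"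
        using m eB by (simp add: ennreal_plus[symmetric] del: ennreal_plus)
      also have "\<dots> \<le> emeasure lborel (?Z \<union> ?N)" by (rule emeasure_mono) auto
      also have "\<dots> \<le> emeasure lborel ?Z + emeasure lborel ?N" by (rule emeasure_subadditive) measurable
      also have "\<dots> \<le> ennreal m + emeasure lborel ?Z" using N by (simp add: add.commute add_mono)
      finally have "ennreal m \<le> emeasure lborel ?Z"
        by (simp add: ennreal_add_left_cancel_le)
      then have "ennreal ((u x)\<^sup>2) * ennreal m \<le> ennreal ((u x)\<^sup>2) * emeasure lborel ?Z"
        by (rule mult_left_mono) simp
      also have "\<dots> = (\<integral>\<^sup>+y. ennreal ((u x)\<^sup>2) * indicator ?Z y \<partial>lborel)"
        by (subst nn_integral_cmult_indicator) auto
      also have "\<dots> \<le> (\<integral>\<^sup>+y. ?F x y \<partial>lborel)"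
        by (intro nn_integral_mono) (auto simp: indicator_def)
      finally show ?thesis .
    qed
    have i: "integrable lborel (\<lambda>x. (u x)\<^sup>2)" using H by (simp add: H0_def sq_int_def)
    have "ennreal ((\<integral>x. (u x)\<^sup>2 \<partial>lborel) * m) = (\<integral>\<^sup>+x. ennreal ((u x)\<^sup>2) * ennreal m \<partial>lborel)"
      using m i by (simp add: nn_integral_multc nn_integral_eq_integral ennreal_mult)
    also have "\<dots> \<le> (\<integral>\<^sup>+x. \<integral>\<^sup>+y. ?F x y \<partial>lborel \<partial>lborel)"
      by (intro nn_integral_mono low)
    also have "\<dots> = (\<integral>\<^sup>+y. \<integral>\<^sup>+x. ?F x y \<partial>lborel \<partial>lborel)"
      by (rule lborel_pair.Fubini'[symmetric]) measurable
    also have "\<dots> \<le> (\<integral>\<^sup>+y. ennreal (r\<^sup>2 * D) * indicator (ball 0 r :: 'a set) y \<partial>lborel)"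
    proof (rule nn_integral_mono)
      fix y :: 'a
      have "(\<integral>\<^sup>+x. ?F x y \<partial>lborel) = (\<integral>\<^sup>+x. ennreal ((u (x + y) - u x)\<^sup>2) \<partial>lborel) * indicator (ball 0 r) y"
        by (rule nn_integral_multc) measurable
      also have "\<dots> \<le> ennreal ((norm y)\<^sup>2 * D) * indicator (ball 0 r) y"
        unfolding D_def by (intro mult_right_mono H0_translation[OF H]) simp
      also have "\<dots> \<le> ennreal (r\<^sup>2 * D) * indicator (ball 0 r) y"
        using D r by (auto simp: indicator_def intro!: ennreal_leI mult_right_mono power_mono)
      finally show "(\<integral>\<^sup>+x. ?F x y \<partial>lborel) \<le> \<dots>" .
    qed
    also have "\<dots> = ennreal (r\<^sup>2 * D) * ennreal (2 * m)"
      by (subst nn_integral_cmult_indicator) (auto simp: eB)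
    also have "\<dots> = ennreal (r\<^sup>2 * D * (2 * m))" using D m by (simp add: ennreal_mult)
    finally have "(\<integral>x. (u x)\<^sup>2 \<partial>lborel) * m \<le> r\<^sup>2 * D * (2 * m)"
      using D m by (subst (asm) ennreal_le_iff) auto
    then have "(\<integral>x. (u x)\<^sup>2 \<partial>lborel) \<le> 2 * r\<^sup>2 * D" using m by (simp add: field_simps)
    then show ?thesis by (simp add: r2 D_def)
  qed
  show ?thesis
    using main w by (intro exI[of _ "2 * (2 / w) powr (2 / d)"]) (auto simp: d_def)
qed

section \<open>Odd C1 truncations and Chebyshev's inequality\<close>

text \<open>Truncations are specified through their continuous even derivative, as
  \<open>H0_chain\<close> requires, and then integrated. Oddness holds because F s + F (- s) has
  derivative 0; it reduces all estimates to s \<ge> 0.\<close>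

lemma odd_antiderivative:
  fixes f :: "real \<Rightarrow> real"
  assumes c: "continuous_on UNIV f" and even: "\<And>s. f (- s) = f s"
  obtains F where "\<And>s. (F has_real_derivative f s) (at s)" "F 0 = 0" "\<And>s. F (- s) = - F s"
proof -
  have "\<exists>F. \<forall>x::real. -\<infinity> < ereal x \<longrightarrow> ereal x < \<infinity> \<longrightarrow> (F has_vector_derivative f x) (at x)"
    by (rule einterval_antiderivative) (use c in \<open>auto simp: continuous_on_eq_continuous_at\<close>)
  then obtain G where "\<And>s. (G has_vector_derivative f s) (at s)" by auto
  then have G: "(G has_real_derivative f s) (at s)" for s
    by (simp add: has_real_derivative_iff_has_vector_derivative)
  define F where "F = (\<lambda>s. G s - G 0)"
  have F: "(F has_real_derivative f s) (at s)" for s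
    unfolding F_def using DERIV_diff[OF G DERIV_const] by simp
  have "((\<lambda>s. F s + F (- s)) has_real_derivative 0) (at s)" for s
  proof -
    have "((\<lambda>s. F (- s)) has_real_derivative f (- s) * (- 1)) (at s)"
      by (rule DERIV_chain2[OF F]) (auto intro!: derivative_eq_intros)
    from DERIV_add[OF F this] show ?thesis by (simp add: even)
  qed
  then have sum: "F s + F (- s) = F 0 + F (- 0)" for s
    using DERIV_isconst_all[of "\<lambda>s. F s + F (- s)" s 0] by blast
  show ?thesis
  proof (rule that[OF F])
    show "F 0 = 0" by (simp add: F_def)
    show "F (- s) = - F s" for s using sum[of s] by (simp add: F_def)
  qed
qed

lemma increment_ge:
  fixes F f :: "real \<Rightarrow> real"
  assumes "\<And>s. (F has_real_derivative f s) (at s)" "a \<le> b" "\<And>s. a \<le> s \<Longrightarrow> s \<le> b \<Longrightarrow> c \<le> f s"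
  shows "c * (b - a) \<le> F b - F a"
proof (cases "a = b")
  case False
  then have "a < b" using assms by simp
  then obtain z where "z > a" "z < b" "F b - F a = (b - a) * f z" using MVT2[of a b F f] assms(1) by blast
  then show ?thesis using assms(3)[of z] assms(2) by (simp add: mult.commute mult_left_mono)
qed simp

lemma increment_le:
  fixes F f :: "real \<Rightarrow> real"
  assumes "\<And>s. (F has_real_derivative f s) (at s)" "a \<le> b" "\<And>s. a \<le> s \<Longrightarrow> s \<le> b \<Longrightarrow> f s \<le> c"
  shows "F b - F a \<le> c * (b - a)"
proof (cases "a = b")
  case False
  then have "a < b" using assms by simp
  then obtain z where "z > a" "z < b" "F b - F a = (b - a) * f z" using MVT2[of a b F f] assms(1) by blast
  then show ?thesis using assms(3)[of z] assms(2) by (simp add: mult.commute mult_left_mono)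
qed simp

text \<open>The first part says that the set has finite measure; since \<open>measure\<close> is 0
  on sets of infinite measure, the second part alone would carry no information.\<close>

lemma Chebyshev_sq:
  fixes v :: "'a::euclidean_space \<Rightarrow> real"
  assumes "sq_int lborel v" "c > 0"
  shows "emeasure lborel {x. c \<le> \<bar>v x\<bar>} = ennreal (measure lborel {x. c \<le> \<bar>v x\<bar>})"
    "measure lborel {x. c \<le> \<bar>v x\<bar>} \<le> (\<integral>x. (v x)\<^sup>2 \<partial>lborel) / c\<^sup>2"
proof -
  have [measurable]: "v \<in> borel_measurable borel" using assms by (simp add: sq_int_def)
  let ?S = "{x. c \<le> \<bar>v x\<bar>}"
  have S: "?S \<in> sets lborel" by measurable
  have i: "integrable lborel (\<lambda>x. (v x)\<^sup>2 / c\<^sup>2)" using assms by (simp add: sq_int_def)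
  have le: "indicator ?S x \<le> (v x)\<^sup>2 / c\<^sup>2" for x
    using assms(2) power_mono[of c "\<bar>v x\<bar>" 2] by (auto simp: indicator_def)
  have ii: "integrable lborel (indicator ?S :: 'a \<Rightarrow> real)"
    by (rule Bochner_Integration.integrable_bound[OF i]) (use S le in \<open>auto simp: indicator_def\<close>)
  then have "emeasure lborel ?S < \<infinity>" using S by (simp add: integrable_indicator_iff)
  then show "emeasure lborel ?S = ennreal (measure lborel ?S)"
    by (intro emeasure_eq_ennreal_measure) auto
  have "measure lborel ?S = (\<integral>x. indicator ?S x \<partial>lborel)" using S by simp
  also have "\<dots> \<le> (\<integral>x. (v x)\<^sup>2 / c\<^sup>2 \<partial>lborel)" by (intro integral_mono ii i le)
  finally show "measure lborel ?S \<le> (\<integral>x. (v x)\<^sup>2 \<partial>lborel) / c\<^sup>2" by simp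
qed

text \<open>A C1 substitute for cutting |s| between a and 2a: the derivative t is a tent over this
  shell with height 1/2, in place of its indicator function.\<close>

lemma dyadic_truncation:
  fixes a :: real
  assumes a: "a > 0"
  obtains T t where "\<And>s. (T has_real_derivative t s) (at s)" "continuous_on UNIV t" "T 0 = 0"
    "\<And>s. \<bar>t s\<bar> \<le> 1" "\<And>s. t s \<noteq> 0 \<Longrightarrow> a \<le> \<bar>s\<bar> \<and> \<bar>s\<bar> < 2 * a"
    "\<And>s. T s \<noteq> 0 \<Longrightarrow> a \<le> \<bar>s\<bar>" "\<And>s. 2 * a \<le> \<bar>s\<bar> \<Longrightarrow> a / 8 \<le> \<bar>T s\<bar>"
proof -
  define t where "t = (\<lambda>s::real. max 0 (min (\<bar>s\<bar> - a) (2 * a - \<bar>s\<bar>)) / a)"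
  have c: "continuous_on UNIV t" unfolding t_def using a by (intro continuous_intros) auto
  obtain T where T: "\<And>s. (T has_real_derivative t s) (at s)" "T 0 = 0" "\<And>s. T (- s) = - T s"
    by (rule odd_antiderivative[OF c]) (auto simp: t_def)
  have zero: "T s = 0" if "0 \<le> s" "s \<le> a" for s
  proof -
    have t0: "t z = 0" if "0 \<le> z" "z \<le> s" for z
      using that \<open>s \<le> a\<close> by (simp add: t_def max_def min_def)
    show ?thesis
      using increment_ge[OF T(1), of 0 s 0] increment_le[OF T(1), of 0 s 0] t0 that T(2) by auto
  qed
  have big: "a / 8 \<le> T s" if "2 * a \<le> s" for s
  proof -
    have t0: "0 \<le> t z" for z using a by (simp add: t_def)
    have "0 \<le> T (5 * a / 4) - T 0" using increment_ge[OF T(1), of 0 "5 * a / 4" 0] t0 a by simp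
    \<comment> \<open>Only the middle half of the shell is counted: length a/2 and t \<ge> 1/4 there
      give the increment a/8.\<close>
    moreover have "1 / 4 * (7 * a / 4 - 5 * a / 4) \<le> T (7 * a / 4) - T (5 * a / 4)"
    proof (rule increment_ge[OF T(1)])
      fix z assume "5 * a / 4 \<le> z" "z \<le> 7 * a / 4"
      then show "1 / 4 \<le> t z" using a by (simp add: t_def min_def max_def field_simps)
    qed (use a in simp)
    moreover have "0 \<le> T s - T (7 * a / 4)" using increment_ge[OF T(1), of "7 * a / 4" s 0] t0 a that by simp
    ultimately show ?thesis using T(2) by simp
  qed
  show ?thesis
  proof (rule that[of T t, OF T(1) c T(2)])
    show "\<bar>t s\<bar> \<le> 1" for s using a by (simp add: t_def min_def max_def field_simps)
    show "a \<le> \<bar>s\<bar> \<and> \<bar>s\<bar> < 2 * a" if "t s \<noteq> 0" for s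
      using that a by (auto simp: t_def max_def min_def split: if_splits)
    show "a \<le> \<bar>s\<bar>" if "T s \<noteq> 0" for s
      using that zero[of s] zero[of "- s"] T(3)[of s] by force
    show "a / 8 \<le> \<bar>T s\<bar>" if "2 * a \<le> \<bar>s\<bar>" for s
      using that big[of s] big[of "- s"] T(3)[of s] by linarith
  qed
qed


section \<open>Sobolev inequality\<close>

lemma dyadic_level:
  fixes s z :: real
  assumes "z \<le> s" "s < z * 2 ^ Suc n"
  shows "\<exists>i\<le>n. z * 2 ^ i \<le> s \<and> s < z * 2 ^ Suc i"
  using assms
proof (induction n)
  case (Suc n)
  show ?case
  proof (cases "s < z * 2 ^ Suc n")
    case True
    then show ?thesis using Suc.IH[OF Suc.prems(1)] le_SucI by blast
  next
    case False
    then show ?thesis using Suc.prems(2) by (intro exI[of _ "Suc n"]) auto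
  qed
qed auto

text \<open>The exponent \<open>2\<^sup>* = 2d/(d - 2)\<close> is the one for which the dyadic sum \<open>S\<close> of
  \<open>a\<^sup>p \<cdot> |{|u| \<ge> a}|\<close> over the levels \<open>a\<close> satisfies \<open>S \<le> small + K S\<^bsup>2/d\<^esup> \<integral>|\<nabla>u|\<^sup>2\<close>
  when Faber--Krahn is applied to the truncation of \<open>u\<close> between consecutive levels.\<close>
theorem Sobolev:
  assumes d3: "DIM('a::euclidean_space) \<ge> 3"
  defines "d \<equiv> real DIM('a)"
  defines "p \<equiv> 2 * d / (d - 2)"
  shows "\<exists>C>0. \<forall>\<Omega> (u :: 'a \<Rightarrow> real) g. H0 \<Omega> u g \<longrightarrow>
     integrable lborel (\<lambda>x. \<bar>u x\<bar> powr p) \<and>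
     (\<integral>x. \<bar>u x\<bar> powr p \<partial>lborel) \<le> C * (\<integral>x. (norm (g x))\<^sup>2 \<partial>lborel) powr (p / 2)"
proof -
  have d: "d \<ge> 3" using d3 by (simp add: d_def)
  have p: "p > 2" "p * (2 / d) = p - 2" "(1 - 2 / d) * (p / 2) = 1"
    using d by (auto simp: p_def field_simps)
  obtain C0 where C0: "C0 > 0" and FK: "\<And>\<Omega> (u :: 'a \<Rightarrow> real) g m. H0 \<Omega> u g \<Longrightarrow> 0 \<le> m \<Longrightarrow>
     emeasure lborel {x. u x \<noteq> 0} \<le> ennreal m \<Longrightarrow>
     (\<integral>x. (u x)\<^sup>2 \<partial>lborel) \<le> C0 * m powr (2 / d) * (\<integral>x. (norm (g x))\<^sup>2 \<partial>lborel)"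
    using Faber_Krahn[where 'a = 'a] unfolding d_def by blast
  \<comment> \<open>64 is the inverse square of the 1/8 in \<open>dyadic_truncation\<close>,
    entering through Chebyshev's inequality; \<open>2 powr p\<close> is the price of passing from
    level a to level 2a.\<close>
  define K where "K = 2 powr p * 64 * C0"
  have K: "K > 0" using C0 by (simp add: K_def)
  \<comment> \<open>2K arises when half of the dyadic sum is absorbed, and p/2 is the inverse of 1 -
    2/d; the outer \<open>2 powr p\<close> comes from rounding |u| up to the end of its dyadic
    shell.\<close>
  define C where "C = 2 powr p * (2 * K) powr (p / 2)"
  have C: "C > 0" using K by (simp add: C_def)
  have main: "integrable lborel (\<lambda>x. \<bar>u x\<bar> powr p) \<and>
     (\<integral>x. \<bar>u x\<bar> powr p \<partial>lborel) \<le> C * (\<integral>x. (norm (g x))\<^sup>2 \<partial>lborel) powr (p / 2)"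
    if H: "H0 \<Omega> u g" for \<Omega> and u :: "'a \<Rightarrow> real" and g
  proof -
    have [measurable]: "u \<in> borel_measurable borel" "g \<in> borel_measurable borel" using H by (auto simp: H0_def)
    have squ: "sq_int lborel u" using H by (simp add: H0_def)
    have ig: "integrable lborel (\<lambda>x. (norm (g x))\<^sup>2)" using H by (simp add: H0_def sq_int_def)
    define D where "D = (\<integral>x. (norm (g x))\<^sup>2 \<partial>lborel)"
    define I where "I = (\<integral>x. (u x)\<^sup>2 \<partial>lborel)"
    have D: "D \<ge> 0" and I: "I \<ge> 0" by (auto simp: D_def I_def)
    define \<mu> where "\<mu> a = measure lborel {x. a \<le> \<bar>u x\<bar>}" for a
    \<comment> \<open>The truncation at a has its gradient on a \<le> |u| < 2a, so its energy is at
      most B a - B (2a); over dyadic levels these differences telescope.\<close>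
    define B where "B a = (\<integral>x. indicator {x. a \<le> \<bar>u x\<bar>} x * (norm (g x))\<^sup>2 \<partial>lborel)" for a
    have iB: "integrable lborel (\<lambda>x. indicator {x. a \<le> \<bar>u x\<bar>} x * (norm (g x))\<^sup>2)" for a
      by (rule lborel_integrable_bounded_mult[OF ig, where B = 1]) (auto simp: indicator_def)
    have \<mu>0: "\<mu> a \<ge> 0" for a by (simp add: \<mu>_def)
    have step: "a\<^sup>2 / 64 * \<mu> (2 * a) \<le> C0 * \<mu> a powr (2 / d) * (B a - B (2 * a))" if a: "a > 0" for a
    proof -
      obtain T t where T: "\<And>s. (T has_real_derivative t s) (at s)" "continuous_on UNIV t" "T 0 = 0"
        "\<And>s. \<bar>t s\<bar> \<le> 1" "\<And>s. t s \<noteq> 0 \<Longrightarrow> a \<le> \<bar>s\<bar> \<and> \<bar>s\<bar> < 2 * a"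
        "\<And>s. T s \<noteq> 0 \<Longrightarrow> a \<le> \<bar>s\<bar>" "\<And>s. 2 * a \<le> \<bar>s\<bar> \<Longrightarrow> a / 8 \<le> \<bar>T s\<bar>"
        by (rule dyadic_truncation[OF a]) blast
      have HT: "H0 \<Omega> (\<lambda>x. T (u x)) (\<lambda>x. t (u x) *\<^sub>R g x)"
        by (rule H0_chain[OF H T(1,2,4,3)])
      have iT: "integrable lborel (\<lambda>x. (T (u x))\<^sup>2)" "integrable lborel (\<lambda>x. (norm (t (u x) *\<^sub>R g x))\<^sup>2)"
        using HT by (auto simp: H0_def sq_int_def)
      have "emeasure lborel {x. T (u x) \<noteq> 0} \<le> emeasure lborel {x. a \<le> \<bar>u x\<bar>}"
        using T(6) by (intro emeasure_mono) auto
      also have "\<dots> = ennreal (\<mu> a)" unfolding \<mu>_def by (rule Chebyshev_sq[OF squ a])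
      finally have "(\<integral>x. (T (u x))\<^sup>2 \<partial>lborel) \<le> C0 * \<mu> a powr (2 / d) * (\<integral>x. (norm (t (u x) *\<^sub>R g x))\<^sup>2 \<partial>lborel)"
        by (intro FK[OF HT \<mu>0])
      also have "\<dots> \<le> C0 * \<mu> a powr (2 / d) * (B a - B (2 * a))"
      proof (rule mult_left_mono)
        have "(norm (t (u x) *\<^sub>R g x))\<^sup>2 \<le> indicator {x. a \<le> \<bar>u x\<bar>} x * (norm (g x))\<^sup>2
            - indicator {x. 2 * a \<le> \<bar>u x\<bar>} x * (norm (g x))\<^sup>2" for x
        proof (cases "t (u x) = 0")
          case True
          then show ?thesis using a by (auto simp: indicator_def)
        next
          case False
          then have "a \<le> \<bar>u x\<bar>" "\<not> 2 * a \<le> \<bar>u x\<bar>" using T(5)[OF False] by auto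
          moreover have "(norm (t (u x) *\<^sub>R g x))\<^sup>2 \<le> 1\<^sup>2 * (norm (g x))\<^sup>2"
            unfolding norm_scaleR power_mult_distrib using T(4)[of "u x"]
            by (intro mult_right_mono power_mono) auto
          ultimately show ?thesis by (simp add: indicator_def)
        qed
        then have "(\<integral>x. (norm (t (u x) *\<^sub>R g x))\<^sup>2 \<partial>lborel) \<le> (\<integral>x. indicator {x. a \<le> \<bar>u x\<bar>} x * (norm (g x))\<^sup>2
            - indicator {x. 2 * a \<le> \<bar>u x\<bar>} x * (norm (g x))\<^sup>2 \<partial>lborel)"
          by (intro integral_mono iT iB Bochner_Integration.integrable_diff)
        then show "(\<integral>x. (norm (t (u x) *\<^sub>R g x))\<^sup>2 \<partial>lborel) \<le> B a - B (2 * a)"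
          unfolding B_def using iB by (subst (asm) Bochner_Integration.integral_diff) auto
      qed (use C0 in auto)
      finally have up: "(\<integral>x. (T (u x))\<^sup>2 \<partial>lborel) \<le> C0 * \<mu> a powr (2 / d) * (B a - B (2 * a))" .
      have "\<mu> (2 * a) \<le> measure lborel {x. a / 8 \<le> \<bar>T (u x)\<bar>}"
        unfolding \<mu>_def
      proof (rule measure_mono_fmeasurable)
        show "{x. 2 * a \<le> \<bar>u x\<bar>} \<subseteq> {x. a / 8 \<le> \<bar>T (u x)\<bar>}" using T(7) by auto
        have "emeasure lborel {x. a / 8 \<le> \<bar>T (u x)\<bar>} < \<infinity>"
          using a HT by (subst Chebyshev_sq(1)) (auto simp: H0_def)
        moreover have "(\<lambda>x. T (u x)) \<in> borel_measurable borel" using HT by (simp add: H0_def)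
        then have "{x. a / 8 \<le> \<bar>T (u x)\<bar>} \<in> sets lborel" by measurable
        ultimately show "{x. a / 8 \<le> \<bar>T (u x)\<bar>} \<in> fmeasurable lborel" by (simp add: fmeasurable_def)
      qed measurable
      also have "\<dots> \<le> (\<integral>x. (T (u x))\<^sup>2 \<partial>lborel) / (a / 8)\<^sup>2"
        using a HT by (intro Chebyshev_sq) (auto simp: H0_def)
      finally have "a\<^sup>2 / 64 * \<mu> (2 * a) \<le> (\<integral>x. (T (u x))\<^sup>2 \<partial>lborel)"
        using a by (simp add: field_simps power2_eq_square)
      then show ?thesis using up by simp
    qed
    \<comment> \<open>With finitely many levels the sum S is finite and can be absorbed. The term
      with I belongs to the lowest level z, which has no predecessor; it carries
      \<open>z powr (p - 2)\<close> and disappears as z tends to 0.\<close>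
    have fin: "(\<integral>\<^sup>+x. ennreal (\<bar>u x\<bar> powr p * indicator {x. z \<le> \<bar>u x\<bar> \<and> \<bar>u x\<bar> < z * 2 ^ Suc n} x) \<partial>lborel) \<le>
       ennreal (2 powr p * (2 * (z powr (p - 2) * I) + (2 * K * D) powr (p / 2)))" if z: "z > 0" for z and n :: nat
    proof -
      define l where "l i = z * 2 ^ i" for i :: nat
      have l: "l i > 0" "l (Suc i) = 2 * l i" for i using z by (auto simp: l_def)
      define S where "S = (\<Sum>i\<le>n. l i powr p * \<mu> (l i))"
      have S0: "S \<ge> 0" unfolding S_def by (intro sum_nonneg mult_nonneg_nonneg \<mu>0) auto
      have BS: "B (l (Suc i)) \<le> B (l i)" for i
        unfolding B_def using l(1)[of i] by (intro integral_mono iB) (auto simp: indicator_def l(2))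
      \<comment> \<open>As p * (2 / d) = p - 2, the leftover power of the level merges with the
        measure into a summand of S to the power 2/d, and one summand is at most S.\<close>
      have tm: "l (Suc i) powr p * \<mu> (l (Suc i)) \<le> K * S powr (2 / d) * (B (l i) - B (l (Suc i)))" if "i < n" for i
      proof -
        let ?a = "l i"
        have a: "?a > 0" by (rule l)
        have sp: "?a powr p = ?a powr (p - 2) * ?a\<^sup>2"
          using a by (simp add: powr_diff powr_numeral)
        have "l (Suc i) powr p * \<mu> (l (Suc i)) = 2 powr p * 64 * ?a powr (p - 2) * (?a\<^sup>2 / 64 * \<mu> (2 * ?a))"
          using a by (simp add: l(2) powr_mult sp)
        also have "\<dots> \<le> 2 powr p * 64 * ?a powr (p - 2) * (C0 * \<mu> ?a powr (2 / d) * (B ?a - B (2 * ?a)))"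
          by (intro mult_left_mono step a) auto
        also have "\<dots> = K * (?a powr p * \<mu> ?a) powr (2 / d) * (B ?a - B (2 * ?a))"
          using a \<mu>0[of ?a] p(2) by (simp add: K_def powr_mult powr_powr)
        also have "\<dots> \<le> K * S powr (2 / d) * (B ?a - B (2 * ?a))"
        proof (intro mult_right_mono mult_left_mono powr_mono2)
          show "?a powr p * \<mu> ?a \<le> S" unfolding S_def
            by (rule member_le_sum) (use that \<mu>0 in auto)
        qed (use d K \<mu>0 BS[of i] in \<open>auto simp: l(2)\<close>)
        finally show ?thesis by (simp add: l(2))
      qed
      define e where "e = z powr (p - 2) * I"
      have e0: "e \<ge> 0" using I by (simp add: e_def)
      have first: "l 0 powr p * \<mu> (l 0) \<le> e"
      proof -
        have "\<mu> z \<le> I / z\<^sup>2" unfolding \<mu>_def I_def by (rule Chebyshev_sq[OF squ z])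
        then have "z powr p * \<mu> z \<le> z powr p * (I / z\<^sup>2)" by (intro mult_left_mono) auto
        also have "\<dots> = e" using z by (simp add: e_def powr_diff powr_numeral)
        finally show ?thesis by (simp add: l_def)
      qed
      have "S = l 0 powr p * \<mu> (l 0) + (\<Sum>i<n. l (Suc i) powr p * \<mu> (l (Suc i)))"
        unfolding S_def lessThan_Suc_atMost[symmetric] by (rule sum.lessThan_Suc_shift)
      also have "\<dots> \<le> e + (\<Sum>i<n. K * S powr (2 / d) * (B (l i) - B (l (Suc i))))"
        by (intro add_mono first sum_mono tm) auto
      also have "\<dots> = e + K * S powr (2 / d) * (B (l 0) - B (l n))"
        unfolding sum_distrib_left[symmetric] by (subst sum_lessThan_telescope') (rule refl)
      also have "\<dots> \<le> e + K * S powr (2 / d) * D"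
      proof -
        have "B (l 0) \<le> D" unfolding B_def D_def
          by (intro integral_mono iB ig) (auto simp: indicator_def)
        moreover have "B (l n) \<ge> 0" unfolding B_def by (intro integral_nonneg_AE) auto
        ultimately show ?thesis using K by (intro add_left_mono mult_left_mono) auto
      qed
      finally have S1: "S \<le> e + K * S powr (2 / d) * D" .
      \<comment> \<open>If S > 2e, then e is below S/2, so \<open>S1\<close> bounds S by 2 K D
        S^(2/d); dividing leaves the exponent 1 - 2/d.\<close>
      have S2: "S \<le> 2 * e + (2 * K * D) powr (p / 2)"
      proof (cases "S \<le> 2 * e")
        case False
        then have Sp: "S > 0" using e0 by linarith
        have "S \<le> 2 * K * D * S powr (2 / d)" using S1 False by (simp add: mult_ac)
        then have "S * S powr (- (2 / d)) \<le> 2 * K * D * S powr (2 / d) * S powr (- (2 / d))"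
          by (rule mult_right_mono) simp
        then have "S powr (1 - 2 / d) \<le> 2 * K * D"
          using Sp by (simp add: powr_diff powr_minus field_simps)
        then have "(S powr (1 - 2 / d)) powr (p / 2) \<le> (2 * K * D) powr (p / 2)"
          using p by (intro powr_mono2) auto
        then show ?thesis using Sp p(3) e0 by (simp add: powr_powr)
      qed (simp add: add_increasing2)
      have pw: "\<bar>u x\<bar> powr p * indicator {x. z \<le> \<bar>u x\<bar> \<and> \<bar>u x\<bar> < z * 2 ^ Suc n} x \<le>
         (\<Sum>i\<le>n. l (Suc i) powr p * indicator {x. l i \<le> \<bar>u x\<bar>} x)" for x
      proof (cases "z \<le> \<bar>u x\<bar> \<and> \<bar>u x\<bar> < z * 2 ^ Suc n")
        case True
        then obtain i where i: "i \<le> n" "l i \<le> \<bar>u x\<bar>" "\<bar>u x\<bar> < l (Suc i)"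
          using dyadic_level[of z "\<bar>u x\<bar>" n] by (auto simp: l_def)
        have "\<bar>u x\<bar> powr p \<le> l (Suc i) powr p" using i p by (intro powr_mono2) auto
        also have "\<dots> = l (Suc i) powr p * indicator {x. l i \<le> \<bar>u x\<bar>} x" using i by simp
        also have "\<dots> \<le> (\<Sum>i\<le>n. l (Suc i) powr p * indicator {x. l i \<le> \<bar>u x\<bar>} x)"
          by (rule member_le_sum[where f = "\<lambda>i. l (Suc i) powr p * indicator {x. l i \<le> \<bar>u x\<bar>} x"]) (use i in auto)
        finally show ?thesis using True by simp
      qed (auto intro!: sum_nonneg)
      have ii: "integrable lborel (\<lambda>x. indicator {x. l i \<le> \<bar>u x\<bar>} x :: real)" for i
        using Chebyshev_sq(1)[OF squ l(1)[of i]] by (intro integrable_real_indicator) auto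
      have "(\<integral>\<^sup>+x. ennreal (\<bar>u x\<bar> powr p * indicator {x. z \<le> \<bar>u x\<bar> \<and> \<bar>u x\<bar> < z * 2 ^ Suc n} x) \<partial>lborel) \<le>
        (\<integral>\<^sup>+x. ennreal (\<Sum>i\<le>n. l (Suc i) powr p * indicator {x. l i \<le> \<bar>u x\<bar>} x) \<partial>lborel)"
        by (intro nn_integral_mono ennreal_leI pw)
      also have "\<dots> = ennreal (\<integral>x. (\<Sum>i\<le>n. l (Suc i) powr p * indicator {x. l i \<le> \<bar>u x\<bar>} x) \<partial>lborel)"
        by (intro nn_integral_eq_integral Bochner_Integration.integrable_sum integrable_mult_right ii AE_I2 sum_nonneg) auto
      also have "(\<integral>x. (\<Sum>i\<le>n. l (Suc i) powr p * indicator {x. l i \<le> \<bar>u x\<bar>} x) \<partial>lborel) = 2 powr p * S"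
      proof -
        have "(\<integral>x. (\<Sum>i\<le>n. l (Suc i) powr p * indicator {x. l i \<le> \<bar>u x\<bar>} x) \<partial>lborel) =
            (\<Sum>i\<le>n. \<integral>x. l (Suc i) powr p * indicator {x. l i \<le> \<bar>u x\<bar>} x \<partial>lborel)"
          by (rule Bochner_Integration.integral_sum) (intro integrable_mult_right ii)
        also have "\<dots> = (\<Sum>i\<le>n. 2 powr p * (l i powr p * \<mu> (l i)))"
          by (intro sum.cong refl) (simp add: \<mu>_def l(2) powr_mult)
        finally show ?thesis by (simp add: S_def sum_distrib_left)
      qed
      also have "ennreal \<dots> \<le> ennreal (2 powr p * (2 * e + (2 * K * D) powr (p / 2)))"
        using S2 by (intro ennreal_leI mult_left_mono) auto
      finally show ?thesis by (simp add: e_def)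
    qed
    \<comment> \<open>With \<open>Suc (2 * n)\<close> doublings the shells starting at
      \<open>z n\<close> reach up to 2^(n + 1), so every nonzero value of |u| is eventually
      covered.\<close>
    define z where "z n = (1 / 2 :: real) ^ n" for n :: nat
    have z: "z n > 0" for n by (simp add: z_def)
    have zn: "z n * 2 ^ Suc (2 * n) = 2 ^ Suc n" for n
    proof -
      have "(2::real) ^ Suc (2 * n) = 2 ^ n * 2 ^ Suc n" by (simp only: power_add[symmetric] mult_2 add_Suc_right)
      moreover have "z n * 2 ^ n = 1" by (simp add: z_def flip: power_mult_distrib)
      ultimately show ?thesis by (metis mult.assoc mult_1)
    qed
    define F where "F n x = \<bar>u x\<bar> powr p * indicator {x. z n \<le> \<bar>u x\<bar> \<and> \<bar>u x\<bar> < z n * 2 ^ Suc (2 * n)} x" for n x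
    have lim: "(\<lambda>n. F n x) \<longlonglongrightarrow> \<bar>u x\<bar> powr p" for x
    proof (cases "u x = 0")
      case False
      have "z \<longlonglongrightarrow> 0" unfolding z_def by (intro LIMSEQ_realpow_zero) auto
      then have "\<forall>\<^sub>F n in sequentially. z n < \<bar>u x\<bar>" using False by (intro order_tendstoD) auto
      moreover have "\<forall>\<^sub>F n in sequentially. \<bar>u x\<bar> < 2 ^ Suc n"
      proof -
        obtain N where N: "\<bar>u x\<bar> < 2 ^ N" using real_arch_pow[of 2 "\<bar>u x\<bar>"] by auto
        have "\<bar>u x\<bar> < 2 ^ Suc n" if "n \<ge> N" for n
          using N power_increasing[of N "Suc n" "2::real"] that by simp
        then show ?thesis using eventually_sequentially by blast
      qed
      ultimately have "\<forall>\<^sub>F n in sequentially. F n x = \<bar>u x\<bar> powr p"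
        by eventually_elim (simp add: F_def zn indicator_def del: power_Suc)
      then show ?thesis by (rule tendsto_eventually)
    qed (simp add: F_def)
    have "(\<integral>\<^sup>+x. ennreal (\<bar>u x\<bar> powr p) \<partial>lborel) = (\<integral>\<^sup>+x. liminf (\<lambda>n. ennreal (F n x)) \<partial>lborel)"
      by (intro nn_integral_cong lim_imp_Liminf[symmetric] tendsto_ennrealI lim) simp
    also have "\<dots> \<le> liminf (\<lambda>n. \<integral>\<^sup>+x. ennreal (F n x) \<partial>lborel)"
      by (rule nn_integral_liminf) (simp add: F_def)
    also have "\<dots> \<le> liminf (\<lambda>n. ennreal (2 powr p * (2 * (z n powr (p - 2) * I) + (2 * K * D) powr (p / 2))))"
      unfolding F_def by (intro Liminf_mono always_eventually allI fin z)
    also have "\<dots> = ennreal (2 powr p * (2 * (0 * I) + (2 * K * D) powr (p / 2)))"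
    proof (rule lim_imp_Liminf)
      have "(\<lambda>n. ((1/2) powr (p - 2)) ^ n) \<longlonglongrightarrow> 0" using p
        by (intro LIMSEQ_realpow_zero) (use powr_less_mono2[of "p - 2" "1 / 2" 1] in auto)
      moreover have "((1/2) powr (p - 2)) ^ n = z n powr (p - 2)" for n
        by (simp add: z_def powr_powr powr_realpow[symmetric] mult.commute)
      ultimately have "(\<lambda>n. z n powr (p - 2)) \<longlonglongrightarrow> 0" by simp
      then show "(\<lambda>n. ennreal (2 powr p * (2 * (z n powr (p - 2) * I) + (2 * K * D) powr (p / 2)))) \<longlonglongrightarrow>
        ennreal (2 powr p * (2 * (0 * I) + (2 * K * D) powr (p / 2)))"
        by (intro tendsto_ennrealI tendsto_intros)
    qed simp
    also have "2 powr p * (2 * (0 * I) + (2 * K * D) powr (p / 2)) = C * D powr (p / 2)"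
      using K D by (simp add: C_def powr_mult)
    finally have le: "(\<integral>\<^sup>+x. ennreal (\<bar>u x\<bar> powr p) \<partial>lborel) \<le> ennreal (C * D powr (p / 2))" .
    have i: "integrable lborel (\<lambda>x. \<bar>u x\<bar> powr p)"
      by (rule integrableI_nonneg) (use le in \<open>auto simp: less_top[symmetric] top_unique\<close>)
    have "ennreal (\<integral>x. \<bar>u x\<bar> powr p \<partial>lborel) \<le> ennreal (C * D powr (p / 2))"
      using le by (subst (asm) nn_integral_eq_integral[OF i]) auto
    then have "(\<integral>x. \<bar>u x\<bar> powr p \<partial>lborel) \<le> C * D powr (p / 2)"
      using C by (subst (asm) ennreal_le_iff) auto
    with i show ?thesis by (simp add: D_def)
  qed
  show ?thesis using main C by blast
qed


section \<open>Energy inequality\<close>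

text \<open>All that both regularity arguments retain of the equation. X majorises |\<Phi>|/\<phi>:
  it is the excess of |s| over a level in the De Giorgi step and |s| itself in the Moser step. The
  factors 2 and the square of L come from absorbing half of the left side.\<close>

definition energy_class :: "'a::euclidean_space set \<Rightarrow> real \<Rightarrow> real \<Rightarrow> ('a \<Rightarrow> real) \<Rightarrow> ('a \<Rightarrow> 'a) \<Rightarrow> ('a \<Rightarrow> real) \<Rightarrow> bool" where
  "energy_class \<Omega> \<delta> L u g h \<longleftrightarrow> H0 \<Omega> u g \<and> h \<in> borel_measurable borel \<and> sq_int lborel h \<and> (\<forall>x. 0 \<le> h x) \<and>
    (\<forall>\<Phi> \<phi> X B. (\<forall>s. (\<Phi> has_real_derivative \<phi> s) (at s)) \<longrightarrow> continuous_on UNIV \<phi> \<longrightarrow>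
       (\<forall>s. 0 \<le> \<phi> s \<and> \<phi> s \<le> B) \<longrightarrow> \<Phi> 0 = 0 \<longrightarrow> continuous_on UNIV X \<longrightarrow>
       (\<forall>s. 0 \<le> X s \<and> X s \<le> \<bar>s\<bar> \<and> \<bar>\<Phi> s\<bar> \<le> \<phi> s * X s) \<longrightarrow>
       (\<integral>x. \<phi> (u x) * (norm (g x))\<^sup>2 \<partial>lborel) \<le>
       (\<integral>x. \<phi> (u x) * X (u x) * (2 * \<delta> * \<bar>u x\<bar> + L\<^sup>2 * X (u x) + 2 * h x) \<partial>lborel))"

lemma sq_int_mult_integrable:
  fixes v w :: "'c \<Rightarrow> real"
  assumes "sq_int M v" "sq_int M w"
  shows "integrable M (\<lambda>x. v x * w x)"
  using sq_int_inner_integrable[OF assms] by simp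

lemma sq_int_le:
  fixes v w :: "'c \<Rightarrow> real"
  assumes "sq_int M v" "w \<in> borel_measurable M" "\<And>x. \<bar>w x\<bar> \<le> c * \<bar>v x\<bar>"
  shows "sq_int M w"
proof (rule sq_int_bound[OF assms(2)])
  show "integrable M (\<lambda>x. c\<^sup>2 * (norm (v x))\<^sup>2)" using assms(1) by (simp add: sq_int_def)
  show "(norm (w x))\<^sup>2 \<le> c\<^sup>2 * (norm (v x))\<^sup>2" for x
    using power_mono[OF assms(3)[of x], of 2] by (simp add: power_mult_distrib)
qed

text \<open>By density \<Phi>(u) is admissible in the weak formulation. It has the sign of u, so the
  one-sided bound on t b sgn(u) can be multiplied by |\<Phi>(u)|.\<close>

theorem weak_solution_energy_class:
  fixes u :: "'a::euclidean_space \<Rightarrow> real"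
  assumes H: "H0 \<Omega> u g" and b: "sq_int lborel b" and h: "h \<in> borel_measurable borel" "sq_int lborel h" "\<And>x. 0 \<le> h x"
    and weak: "\<And>\<psi>. test_fun \<Omega> \<psi> \<Longrightarrow>
      (\<integral>x. g x \<bullet> cgrad \<psi> x \<partial>lborel) + \<mu> * (\<integral>x. u x * \<psi> x \<partial>lborel) = t * (\<integral>x. b x * \<psi> x \<partial>lborel)"
    and bound: "AE x in lborel. t * b x * sgn (u x) \<le> (\<delta> + \<mu>) * \<bar>u x\<bar> + L * norm (g x) + h x"
    and nonneg: "\<delta> \<ge> 0" "L \<ge> 0"
  shows "energy_class \<Omega> \<delta> L u g h"
  unfolding energy_class_def
proof (intro conjI allI impI H h)
  fix \<Phi> \<phi> X :: "real \<Rightarrow> real" and B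
  assume d': "\<forall>s. (\<Phi> has_real_derivative \<phi> s) (at s)" and c: "continuous_on UNIV \<phi>"
    and \<phi>: "\<forall>s. 0 \<le> \<phi> s \<and> \<phi> s \<le> B" and z: "\<Phi> 0 = 0" and cX: "continuous_on UNIV X"
    and X: "\<forall>s. 0 \<le> X s \<and> X s \<le> \<bar>s\<bar> \<and> \<bar>\<Phi> s\<bar> \<le> \<phi> s * X s"
  note d = d'[rule_format]
  have sgn: "\<Phi> s = sgn s * \<bar>\<Phi> s\<bar>" for s
    using increment_ge[of \<Phi> \<phi> 0 s 0, OF d] increment_ge[of \<Phi> \<phi> s 0 0, OF d] \<phi> z
    by (cases s "0 :: real" rule: linorder_cases) auto
  have [measurable]: "u \<in> borel_measurable borel" "g \<in> borel_measurable borel" "h \<in> borel_measurable borel"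
    using H h by (auto simp: H0_def)
  have [measurable]: "b \<in> borel_measurable borel" using b by (simp add: sq_int_def)
  have [measurable]: "\<phi> \<in> borel_measurable borel" "X \<in> borel_measurable borel" "\<Phi> \<in> borel_measurable borel"
    using c cX DERIV_isCont[OF d] by (auto intro!: borel_measurable_continuous_onI continuous_at_imp_continuous_on)
  have B: "B \<ge> 0" using \<phi> order_trans by blast
  have absB: "\<bar>\<phi> s\<bar> \<le> B" for s using \<phi> by simp
  have HT: "H0 \<Omega> (\<lambda>x. \<Phi> (u x)) (\<lambda>x. \<phi> (u x) *\<^sub>R g x)" by (rule H0_chain[OF H d c absB z])
  obtain \<psi> where \<psi>': "\<forall>n::nat. test_fun \<Omega> (\<psi> n)"
    "(\<lambda>n. \<integral>x. (norm (\<Phi> (u x) - \<psi> n x))\<^sup>2 \<partial>lborel) \<longlonglongrightarrow> 0"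
    "(\<lambda>n. \<integral>x. (norm (\<phi> (u x) *\<^sub>R g x - cgrad (\<psi> n) x))\<^sup>2 \<partial>lborel) \<longlonglongrightarrow> 0"
    "AE x in lborel. (\<lambda>n. \<psi> n x) \<longlonglongrightarrow> \<Phi> (u x)"
    using H0_approx[OF HT] .
  note \<psi> = \<psi>'(1)[THEN spec] \<psi>'(2-4)
  have su: "sq_int lborel u" and sg: "sq_int lborel g" and s\<Phi>: "sq_int lborel (\<lambda>x. \<Phi> (u x))"
    and s\<phi>: "sq_int lborel (\<lambda>x. \<phi> (u x) *\<^sub>R g x)"
    using H HT by (auto simp: H0_def)
  have "(\<lambda>n. (\<integral>x. g x \<bullet> cgrad (\<psi> n) x \<partial>lborel) + \<mu> * (\<integral>x. u x \<bullet> \<psi> n x \<partial>lborel))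
    \<longlonglongrightarrow> (\<integral>x. g x \<bullet> (\<phi> (u x) *\<^sub>R g x) \<partial>lborel) + \<mu> * (\<integral>x. u x \<bullet> \<Phi> (u x) \<partial>lborel)"
    by (intro tendsto_intros sq_int_inner_tendsto[OF sg s\<phi> test_fun_sq_int(2)[OF \<psi>(1)] \<psi>(3)]
        sq_int_inner_tendsto[OF su s\<Phi> test_fun_sq_int(1)[OF \<psi>(1)] \<psi>(2)])
  moreover have "(\<lambda>n. t * (\<integral>x. b x \<bullet> \<psi> n x \<partial>lborel)) \<longlonglongrightarrow> t * (\<integral>x. b x \<bullet> \<Phi> (u x) \<partial>lborel)"
    by (intro tendsto_intros sq_int_inner_tendsto[OF b s\<Phi> test_fun_sq_int(1)[OF \<psi>(1)] \<psi>(2)])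
  ultimately have eq: "(\<integral>x. g x \<bullet> (\<phi> (u x) *\<^sub>R g x) \<partial>lborel) + \<mu> * (\<integral>x. u x * \<Phi> (u x) \<partial>lborel) = t * (\<integral>x. b x * \<Phi> (u x) \<partial>lborel)"
    using weak[OF \<psi>(1)] LIMSEQ_unique by simp
  have i1: "integrable lborel (\<lambda>x. g x \<bullet> (\<phi> (u x) *\<^sub>R g x))" by (rule sq_int_inner_integrable[OF sg s\<phi>])
  then have iE: "integrable lborel (\<lambda>x. \<phi> (u x) * (norm (g x))\<^sup>2)" by (simp add: power2_norm_eq_inner)
  have i2: "integrable lborel (\<lambda>x. u x * \<Phi> (u x))" "integrable lborel (\<lambda>x. b x * \<Phi> (u x))"
    by (intro sq_int_mult_integrable su s\<Phi> b)+
  have sX: "sq_int lborel (\<lambda>x. X (u x))" by (rule sq_int_le[OF su, where c = 1]) (use X in auto)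
  have "sq_int lborel (\<lambda>x. \<phi> (u x) *\<^sub>R X (u x))" by (rule sq_int_scaleR_bounded[OF sX _ absB]) simp
  then have s\<phi>X: "sq_int lborel (\<lambda>x. \<phi> (u x) * X (u x))" by simp
  have sabs: "sq_int lborel (\<lambda>x. \<bar>u x\<bar>)" by (rule sq_int_le[OF su, where c = 1]) auto
  have iR: "integrable lborel (\<lambda>x. \<phi> (u x) * X (u x) * (2 * \<delta> * \<bar>u x\<bar> + L\<^sup>2 * X (u x) + 2 * h x))"
    by (intro sq_int_mult_integrable s\<phi>X sq_int_add sq_int_scaleR[where 'b = real, simplified] sabs sX h)
  have "(\<integral>x. \<phi> (u x) * (norm (g x))\<^sup>2 \<partial>lborel) = (\<integral>x. t * (b x * \<Phi> (u x)) - \<mu> * (u x * \<Phi> (u x)) \<partial>lborel)"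
    using eq i2 by (simp add: power2_norm_eq_inner)
  also have "\<dots> \<le> (\<integral>x. (1 / 2) * (\<phi> (u x) * (norm (g x))\<^sup>2) +
      (1 / 2) * (\<phi> (u x) * X (u x) * (2 * \<delta> * \<bar>u x\<bar> + L\<^sup>2 * X (u x) + 2 * h x)) \<partial>lborel)"
  proof (rule integral_mono_AE)
    show "AE x in lborel. t * (b x * \<Phi> (u x)) - \<mu> * (u x * \<Phi> (u x)) \<le> (1 / 2) * (\<phi> (u x) * (norm (g x))\<^sup>2) +
      (1 / 2) * (\<phi> (u x) * X (u x) * (2 * \<delta> * \<bar>u x\<bar> + L\<^sup>2 * X (u x) + 2 * h x))"
      using bound
    proof eventually_elim
      case (elim x)
      let ?s = "u x" and ?G = "norm (g x)"
      have "t * b x * sgn ?s * \<bar>\<Phi> ?s\<bar> \<le> ((\<delta> + \<mu>) * \<bar>?s\<bar> + L * ?G + h x) * \<bar>\<Phi> ?s\<bar>"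
        by (rule mult_right_mono[OF elim]) simp
      moreover have e2: "t * (b x * \<Phi> ?s) = t * b x * sgn ?s * \<bar>\<Phi> ?s\<bar>"
        by (metis sgn mult.assoc)
      moreover have e3: "?s * \<Phi> ?s = \<bar>?s\<bar> * \<bar>\<Phi> ?s\<bar>"
        by (metis sgn abs_sgn mult.assoc)
      ultimately have "t * (b x * \<Phi> ?s) - \<mu> * (?s * \<Phi> ?s) \<le>
          ((\<delta> + \<mu>) * \<bar>?s\<bar> + L * ?G + h x) * \<bar>\<Phi> ?s\<bar> - \<mu> * (\<bar>?s\<bar> * \<bar>\<Phi> ?s\<bar>)"
        unfolding e2 e3 by linarith
      also have "\<dots> = (\<delta> * \<bar>?s\<bar> + L * ?G + h x) * \<bar>\<Phi> ?s\<bar>"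
        by (simp add: algebra_simps)
      also have "\<dots> \<le> (\<delta> * \<bar>?s\<bar> + L * ?G + h x) * (\<phi> ?s * X ?s)"
        using X nonneg h(3) by (intro mult_left_mono) auto
      also have "\<dots> \<le> (1 / 2) * (\<phi> ?s * ?G\<^sup>2) +
        (1 / 2) * (\<phi> ?s * X ?s * (2 * \<delta> * \<bar>?s\<bar> + L\<^sup>2 * X ?s + 2 * h x))"
      proof -
        \<comment> \<open>Young's inequality for L |grad u| X with weight \<phi>; the gradient part
          equals half of the left side of the claim.\<close>
        have "0 \<le> \<phi> ?s * (?G - L * X ?s)\<^sup>2" using \<phi> by simp
        then show ?thesis by (simp add: power2_eq_square algebra_simps)
      qed
      finally show ?case .
    qed
  qed (use iE iR i2 in auto)
  also have "\<dots> = (1 / 2) * (\<integral>x. \<phi> (u x) * (norm (g x))\<^sup>2 \<partial>lborel) +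
      (1 / 2) * (\<integral>x. \<phi> (u x) * X (u x) * (2 * \<delta> * \<bar>u x\<bar> + L\<^sup>2 * X (u x) + 2 * h x) \<partial>lborel)"
    using iE iR by (subst Bochner_Integration.integral_add) (simp_all only: integrable_mult_right integral_mult_right_zero)
  finally show "(\<integral>x. \<phi> (u x) * (norm (g x))\<^sup>2 \<partial>lborel) \<le>
       (\<integral>x. \<phi> (u x) * X (u x) * (2 * \<delta> * \<bar>u x\<bar> + L\<^sup>2 * X (u x) + 2 * h x) \<partial>lborel)"
    by simp
qed

section \<open>Truncation above a level\<close>

lemma antiderivative_le:
  fixes F f :: "real \<Rightarrow> real"
  assumes "\<And>s. (F has_real_derivative f s) (at s)" "F 0 = 0" "\<And>s. F (- s) = - F s"
    and "\<And>s. 0 \<le> f s" "\<And>r s. \<bar>r\<bar> \<le> \<bar>s\<bar> \<Longrightarrow> f r \<le> f s"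
  shows "\<bar>F s\<bar> \<le> f s * \<bar>s\<bar>"
proof -
  have pos: "0 \<le> F r \<and> F r \<le> f r * r" if "0 \<le> r" for r
    using increment_ge[of F f 0 r 0, OF assms(1)] increment_le[of F f 0 r "f r", OF assms(1)] assms(2,4,5) that
    by auto
  have "f (- s) = f s" using assms(5)[of s "- s"] assms(5)[of "- s" s] by simp
  then show ?thesis using pos[of s] pos[of "- s"] assms(3)[of s] by (cases "0 \<le> s") auto
qed

text \<open>A ramp from 0 at |s| = m to 1 at |s| = m + \<eta> replaces the indicator of |s| > m as
  derivative, since that has to be continuous. In return F is only known to dominate the excess over
  m + \<eta>.\<close>

lemma level_truncation:
  fixes m \<eta> :: real
  assumes "m \<ge> 0" "\<eta> > 0"
  obtains F f where "\<And>s. (F has_real_derivative f s) (at s)" "continuous_on UNIV f" "F 0 = 0"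
    "\<And>s. 0 \<le> f s \<and> f s \<le> 1" "\<And>s. \<bar>F s\<bar> \<le> f s * max 0 (\<bar>s\<bar> - m)" "\<And>s. \<bar>s\<bar> - (m + \<eta>) \<le> \<bar>F s\<bar>"
proof -
  define f where "f = (\<lambda>s::real. max 0 (min 1 ((\<bar>s\<bar> - m) / \<eta>)))"
  have c: "continuous_on UNIV f" unfolding f_def using assms by (intro continuous_intros) auto
  obtain F where F: "\<And>s. (F has_real_derivative f s) (at s)" "F 0 = 0" "\<And>s. F (- s) = - F s"
    by (rule odd_antiderivative[OF c]) (auto simp: f_def)
  have f0: "0 \<le> f s" and f1: "f s \<le> 1" for s by (auto simp: f_def)
  have fmono: "f r \<le> f s" if "\<bar>r\<bar> \<le> \<bar>s\<bar>" for r s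
    unfolding f_def using that assms by (intro max.mono min.mono divide_right_mono) auto
  have fm: "f s = 0" if "\<bar>s\<bar> \<le> m" for s
    using that assms by (simp add: f_def max_def min_def divide_nonpos_pos field_simps)
  have le: "\<bar>F s\<bar> \<le> f s * \<bar>s\<bar>" for s by (rule antiderivative_le[OF F f0 fmono])
  have pos: "F s \<le> f s * (s - m) \<and> s - (m + \<eta>) \<le> F s" if "m \<le> s" for s
  proof
    have Fm: "F m = 0" using le[of m] fm[of m] assms by simp
    show "F s \<le> f s * (s - m)"
      using increment_le[of F f m s "f s", OF F(1) that] fmono assms Fm by auto
    show "s - (m + \<eta>) \<le> F s"
    proof (cases "m + \<eta> \<le> s")
      case True
      have "f z = 1" if "m + \<eta> \<le> z" for z using that assms by (simp add: f_def max_def min_def field_simps)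
      then have "1 * (s - (m + \<eta>)) \<le> F s - F (m + \<eta>)"
        by (intro increment_ge[OF F(1) True]) auto
      moreover have "0 * (m + \<eta> - m) \<le> F (m + \<eta>) - F m"
        using assms by (intro increment_ge[OF F(1)] f0) auto
      ultimately show ?thesis using Fm by simp
    next
      case False
      have "0 * (s - m) \<le> F s - F m" by (intro increment_ge[OF F(1) that] f0)
      then show ?thesis using False Fm by simp
    qed
  qed
  have even: "f (- s) = f s" for s by (simp add: f_def)
  show ?thesis
  proof (rule that[OF F(1) c F(2)])
    show "0 \<le> f s \<and> f s \<le> 1" for s using f0 f1 by simp
    show "\<bar>F s\<bar> \<le> f s * max 0 (\<bar>s\<bar> - m)" for s
    proof (cases "\<bar>s\<bar> \<le> m")
      case True
      then show ?thesis using le[of s] fm by simp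
    next
      case False
      have nn: "0 \<le> F r" if "0 \<le> r" for r
        using increment_ge[of F f 0 r 0, OF F(1) that] f0 F(2) by simp
      show ?thesis
        using False pos[of s] pos[of "- s"] nn[of s] nn[of "- s"] F(3)[of s] even[of s] assms
        by (cases "0 \<le> s") (auto simp: max_def)
    qed
    show "\<bar>s\<bar> - (m + \<eta>) \<le> \<bar>F s\<bar>" for s
      using pos[of s] pos[of "- s"] F(3)[of s] assms by (cases "m \<le> \<bar>s\<bar>") linarith+
  qed
qed


section \<open>The case $q > d/2$\<close>

lemma sq_le_threshold:
  fixes a \<tau> q :: real
  assumes "a \<ge> 0" "\<tau> > 0" "q \<ge> 2"
  shows "a\<^sup>2 \<le> \<tau>\<^sup>2 + \<tau> powr (2 - q) * a powr q"
proof (cases "a \<le> \<tau>")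
  case True
  then have "a\<^sup>2 \<le> \<tau>\<^sup>2" using assms by (intro power_mono)
  then show ?thesis by (simp add: add_increasing2)
next
  case False
  then have a: "a > 0" using assms by linarith
  then have "a\<^sup>2 = a powr (2 - q) * a powr q" by (simp add: powr_add[symmetric] powr_numeral)
  also have "\<dots> \<le> \<tau> powr (2 - q) * a powr q"
    using False assms by (intro mult_right_mono powr_mono2') auto
  finally show ?thesis by (simp add: add_increasing)
qed

text \<open>The right side minus the left side is \<delta> (M - X)^2 + (X - c a)^2 / c. Here M + X
  bounds |u|, a stands for h, and the weight c is left free to balance the terms with h.\<close>

lemma absorb_cross_terms:
  fixes X M a l c \<delta> :: real
  assumes "c > 0" "\<delta> \<ge> 0"
  shows "X * (2 * \<delta> * (M + X) + l * X + 2 * a) \<le> \<delta> * M\<^sup>2 + (3 * \<delta> + l + 1 / c) * X\<^sup>2 + c * a\<^sup>2"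
proof -
  have "\<delta> * M\<^sup>2 + (3 * \<delta> + l + 1 / c) * X\<^sup>2 + c * a\<^sup>2 =
      X * (2 * \<delta> * (M + X) + l * X + 2 * a) + \<delta> * (M - X)\<^sup>2 + (X - c * a)\<^sup>2 / c"
    using assms by (simp add: power2_eq_square field_simps)
  then show ?thesis using assms by simp
qed

text \<open>The exponent gain \<open>2/d - 1/q > 0\<close> is what makes the De Giorgi iteration converge; \<open>b\<close> is
  a normalised bound both for the energy above level \<open>k\<close> and for the measure of the
  set where \<open>|u|\<close> exceeds the midpoint of \<open>k\<close> and \<open>k'\<close>.\<close>
lemma De_Giorgi_step:
  fixes q \<delta> L :: real
  assumes q: "q \<ge> 2" and \<delta>: "\<delta> > 0"
  shows "\<exists>C>0. \<forall>\<Omega> (u :: 'a::euclidean_space \<Rightarrow> real) g h k k' b M.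
     energy_class \<Omega> \<delta> L u g h \<longrightarrow> integrable lborel (\<lambda>x. h x powr q) \<longrightarrow>
     (\<integral>x. h x powr q \<partial>lborel) \<le> M powr q \<longrightarrow> 0 \<le> k \<longrightarrow> k < k' \<longrightarrow> k' \<le> M \<longrightarrow> 0 < b \<longrightarrow> b \<le> 1 \<longrightarrow>
     (\<integral>x. (max 0 (\<bar>u x\<bar> - k))\<^sup>2 \<partial>lborel) \<le> M\<^sup>2 * b \<longrightarrow>
     (\<integral>x. (max 0 (\<bar>u x\<bar> - k))\<^sup>2 \<partial>lborel) \<le> ((k' - k) / 2)\<^sup>2 * b \<longrightarrow>
     (\<integral>x. (max 0 (\<bar>u x\<bar> - k'))\<^sup>2 \<partial>lborel) \<le> C * M\<^sup>2 * b powr (1 + (2 / real DIM('a) - 1 / q))"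
proof -
  obtain C0 where C0: "C0 > 0" and FK: "\<And>\<Omega> (u :: 'a \<Rightarrow> real) g m. H0 \<Omega> u g \<Longrightarrow> 0 \<le> m \<Longrightarrow>
     emeasure lborel {x. u x \<noteq> 0} \<le> ennreal m \<Longrightarrow>
     (\<integral>x. (u x)\<^sup>2 \<partial>lborel) \<le> C0 * m powr (2 / real DIM('a)) * (\<integral>x. (norm (g x))\<^sup>2 \<partial>lborel)"
    using Faber_Krahn[where 'a = 'a] by blast
  define C1 where "C1 = C0 * (4 * \<delta> + L\<^sup>2 + 3)"
  have C1: "C1 > 0" using C0 \<delta> by (auto simp: C1_def intro!: mult_pos_pos add_pos_nonneg add_nonneg_pos)
  have main: "(\<integral>x. (max 0 (\<bar>u x\<bar> - k'))\<^sup>2 \<partial>lborel) \<le> C1 * M\<^sup>2 * b powr (1 + (2 / real DIM('a) - 1 / q))"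
    if EC: "energy_class \<Omega> \<delta> L u g h" and ih: "integrable lborel (\<lambda>x. h x powr q)"
      and hM: "(\<integral>x. h x powr q \<partial>lborel) \<le> M powr q" and k: "0 \<le> k" "k < k'" "k' \<le> M" and b: "0 < b" "b \<le> 1"
      and y1: "(\<integral>x. (max 0 (\<bar>u x\<bar> - k))\<^sup>2 \<partial>lborel) \<le> M\<^sup>2 * b"
      and y2: "(\<integral>x. (max 0 (\<bar>u x\<bar> - k))\<^sup>2 \<partial>lborel) \<le> ((k' - k) / 2)\<^sup>2 * b"
    for \<Omega> and u :: "'a \<Rightarrow> real" and g h k k' b M
  proof -
    \<comment> \<open>The gap is used twice: its lower half makes the set above the midpoint m small
      by Chebyshev's inequality, its upper half is the ramp of the truncation, so that F still
      dominates the excess over k'.\<close>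
    define \<eta> where "\<eta> = (k' - k) / 2"
    define m where "m = k + \<eta>"
    have \<eta>: "\<eta> > 0" and m: "0 \<le> m" "m \<le> M" "m + \<eta> = k'" "M > 0"
      using k by (auto simp: \<eta>_def m_def field_simps)
    obtain F f where F: "\<And>s. (F has_real_derivative f s) (at s)" "continuous_on UNIV f" "F 0 = 0"
      "\<And>s. 0 \<le> f s \<and> f s \<le> 1" "\<And>s. \<bar>F s\<bar> \<le> f s * max 0 (\<bar>s\<bar> - m)" "\<And>s. \<bar>s\<bar> - k' \<le> \<bar>F s\<bar>"
      by (rule level_truncation[OF m(1) \<eta>, unfolded m(3)]) blast
    have H: "H0 \<Omega> u g" and sh: "sq_int lborel h" and h0: "h x \<ge> 0" for x
      using EC by (auto simp: energy_class_def)
    have su: "sq_int lborel u" and [measurable]: "u \<in> borel_measurable borel" "g \<in> borel_measurable borel"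
      using H by (auto simp: H0_def)
    have [measurable]: "f \<in> borel_measurable borel" using F(2) by (rule borel_measurable_continuous_onI)
    define v where "v k x = max 0 (\<bar>u x\<bar> - k)" for k x
    have [measurable]: "v k \<in> borel_measurable borel" for k
      unfolding v_def[abs_def] by measurable
    have sv: "sq_int lborel (v k)" if "k \<ge> 0" for k
      by (rule sq_int_le[OF su, where c = 1]) (use that in \<open>auto simp: v_def\<close>)
    have iv: "integrable lborel (\<lambda>x. (v k x)\<^sup>2)" if "k \<ge> 0" for k
      using sv[OF that] by (simp add: sq_int_def)
    define A where "A = {x. \<eta> \<le> \<bar>v k x\<bar>}"
    have [measurable]: "A \<in> sets borel" unfolding A_def v_def by measurable
    have eA: "emeasure lborel A = ennreal (measure lborel A)"
      unfolding A_def by (rule Chebyshev_sq(1)[OF sv[OF k(1)] \<eta>])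
    have "measure lborel A \<le> (\<integral>x. (v k x)\<^sup>2 \<partial>lborel) / \<eta>\<^sup>2"
      unfolding A_def by (rule Chebyshev_sq(2)[OF sv[OF k(1)] \<eta>])
    also have "\<dots> \<le> b" using y2 \<eta> by (simp add: v_def \<eta>_def[symmetric] field_simps)
    finally have mA: "measure lborel A \<le> b" .
    have iA: "integrable lborel (indicator A :: 'a \<Rightarrow> real)" using eA by (intro integrable_real_indicator) auto
    have XA: "x \<in> A" if "v m x \<noteq> 0" for x
      using that \<eta> by (auto simp: A_def v_def m_def max_def split: if_splits)
    have HT: "H0 \<Omega> (\<lambda>x. F (u x)) (\<lambda>x. f (u x) *\<^sub>R g x)"
      by (rule H0_chain[OF H F(1,2) _ F(3), of 1]) (use F(4) in auto)
    have iF: "integrable lborel (\<lambda>x. (F (u x))\<^sup>2)" "integrable lborel (\<lambda>x. (norm (f (u x) *\<^sub>R g x))\<^sup>2)"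
      using HT by (auto simp: H0_def sq_int_def)
    have ifg: "integrable lborel (\<lambda>x. f (u x) * (norm (g x))\<^sup>2)"
      by (rule lborel_integrable_bounded_mult[where B = 1]) (use H F(4) in \<open>auto simp: H0_def sq_int_def\<close>)
    have "(\<integral>x. (v k' x)\<^sup>2 \<partial>lborel) \<le> (\<integral>x. (F (u x))\<^sup>2 \<partial>lborel)"
    proof (intro integral_mono iv iF)
      show "(v k' x)\<^sup>2 \<le> (F (u x))\<^sup>2" for x
        using power_mono[of "v k' x" "\<bar>F (u x)\<bar>" 2] F(6)[of "u x"] by (simp add: v_def)
    qed (use k in auto)
    also have "\<dots> \<le> C0 * b powr (2 / real DIM('a)) * (\<integral>x. (norm (f (u x) *\<^sub>R g x))\<^sup>2 \<partial>lborel)"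
    proof (rule FK[OF HT])
      have "x \<in> A" if "F (u x) \<noteq> 0" for x
      proof (rule XA)
        show "v m x \<noteq> 0" using that F(5)[of "u x"] by (auto simp: v_def)
      qed
      then have "emeasure lborel {x. F (u x) \<noteq> 0} \<le> emeasure lborel A"
        by (intro emeasure_mono) auto
      also have "\<dots> \<le> ennreal b" using mA by (simp add: eA ennreal_leI)
      finally show "emeasure lborel {x. F (u x) \<noteq> 0} \<le> ennreal b" .
    qed (use b in simp)
    also have "\<dots> \<le> C0 * b powr (2 / real DIM('a)) * (\<integral>x. f (u x) * (norm (g x))\<^sup>2 \<partial>lborel)"
    proof (intro mult_left_mono integral_mono iF ifg)
      show "(norm (f (u x) *\<^sub>R g x))\<^sup>2 \<le> f (u x) * (norm (g x))\<^sup>2" for x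
      proof -
        have "f (u x) * f (u x) \<le> f (u x) * 1" using F(4) by (intro mult_left_mono) auto
        then have "(f (u x))\<^sup>2 \<le> f (u x)" by (simp add: power2_eq_square)
        then show ?thesis by (simp add: power_mult_distrib mult_right_mono)
      qed
    qed (use C0 in auto)
    also have "\<dots> \<le> C0 * b powr (2 / real DIM('a)) * ((4 * \<delta> + L\<^sup>2 + 3) * M\<^sup>2 * b powr (1 - 1 / q))"
    proof (rule mult_left_mono)
      \<comment> \<open>With this weight and \<tau> = M/c the term X^2/c and both parts of c h^2
        integrate to at most M^2 b/c each, which is the 3 in \<open>C1\<close>; the remaining terms
        are of order M^2 b and c \<le> 1. Hence the energy has exponent 1 - 1/q in b, and
        Faber-Krahn adds 2/d.\<close>
      define c where "c = b powr (1 / q)"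
      have c: "c > 0" "c \<le> 1" "c powr q = b" "b / c = b powr (1 - 1 / q)"
        using b q by (auto simp: c_def powr_powr powr_diff intro: powr_le1)
      define \<tau> where "\<tau> = M / c"
      have \<tau>: "\<tau> > 0" using m c by (simp add: \<tau>_def)
      let ?R = "\<lambda>x. \<delta> * M\<^sup>2 * indicator A x + (3 * \<delta> + L\<^sup>2 + 1 / c) * (v k x)\<^sup>2
            + c * (\<tau>\<^sup>2 * indicator A x + \<tau> powr (2 - q) * h x powr q)"
      have iR: "integrable lborel ?R" using iA iv[OF k(1)] ih by (intro Bochner_Integration.integrable_add integrable_mult_right)
      have "(\<integral>x. f (u x) * (norm (g x))\<^sup>2 \<partial>lborel) \<le>
         (\<integral>x. f (u x) * max 0 (\<bar>u x\<bar> - m) * (2 * \<delta> * \<bar>u x\<bar> + L\<^sup>2 * max 0 (\<bar>u x\<bar> - m) + 2 * h x) \<partial>lborel)"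
      proof -
        have "\<forall>s. 0 \<le> max 0 (\<bar>s\<bar> - m) \<and> max 0 (\<bar>s\<bar> - m) \<le> \<bar>s\<bar> \<and> \<bar>F s\<bar> \<le> f s * max 0 (\<bar>s\<bar> - m)"
          using F(5) m by auto
        moreover have "continuous_on UNIV (\<lambda>s::real. max 0 (\<bar>s\<bar> - m))" by (intro continuous_intros)
        ultimately show ?thesis
          using EC[unfolded energy_class_def, THEN conjunct2, THEN conjunct2, THEN conjunct2, THEN conjunct2,
              rule_format, of F f 1 "\<lambda>s. max 0 (\<bar>s\<bar> - m)"] F(1-4) by simp
      qed
      also have "\<dots> \<le> (\<integral>x. ?R x \<partial>lborel)"
      proof (rule Bochner_Integration.integral_mono'[OF iR])
        fix x
        let ?X = "max 0 (\<bar>u x\<bar> - m)"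
        show "0 \<le> ?R x" using \<delta> c by simp
        show "f (u x) * ?X * (2 * \<delta> * \<bar>u x\<bar> + L\<^sup>2 * ?X + 2 * h x) \<le> ?R x"
        proof (cases "?X = 0")
          case True
          then show ?thesis using \<open>0 \<le> ?R x\<close> by simp
        next
          case False
          have xA: "x \<in> A" using XA False by (simp add: v_def)
          have X: "?X > 0" "\<bar>u x\<bar> \<le> M + ?X" "?X \<le> v k x" using False m \<eta> by (auto simp: v_def m_def)
          have "f (u x) * (?X * (2 * \<delta> * \<bar>u x\<bar> + L\<^sup>2 * ?X + 2 * h x)) \<le>
              1 * (?X * (2 * \<delta> * \<bar>u x\<bar> + L\<^sup>2 * ?X + 2 * h x))"
            using F(4) \<delta> h0 X by (intro mult_right_mono mult_nonneg_nonneg add_nonneg_nonneg) auto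
          also have "\<dots> \<le> ?X * (2 * \<delta> * (M + ?X) + L\<^sup>2 * ?X + 2 * h x)"
            unfolding mult_1 using X \<delta> by (intro mult_left_mono add_right_mono) auto
          also have "\<dots> \<le> \<delta> * M\<^sup>2 + (3 * \<delta> + L\<^sup>2 + 1 / c) * ?X\<^sup>2 + c * (h x)\<^sup>2"
            using \<delta> c(1) by (intro absorb_cross_terms) auto
          also have "\<dots> \<le> \<delta> * M\<^sup>2 + (3 * \<delta> + L\<^sup>2 + 1 / c) * (v k x)\<^sup>2 + c * (\<tau>\<^sup>2 + \<tau> powr (2 - q) * h x powr q)"
          proof -
            have "(3 * \<delta> + L\<^sup>2 + 1 / c) * ?X\<^sup>2 \<le> (3 * \<delta> + L\<^sup>2 + 1 / c) * (v k x)\<^sup>2"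
              using X(1,3) \<delta> c(1) by (intro mult_left_mono power_mono) simp_all
            moreover have "c * (h x)\<^sup>2 \<le> c * (\<tau>\<^sup>2 + \<tau> powr (2 - q) * h x powr q)"
              using c(1) by (intro mult_left_mono sq_le_threshold[OF h0 \<tau> q]) simp
            ultimately show ?thesis by linarith
          qed
          also have "\<dots> = ?R x" using xA by simp
          finally show ?thesis by (simp only: mult.assoc)
        qed
      qed
      also have "\<dots> = \<delta> * M\<^sup>2 * measure lborel A + (3 * \<delta> + L\<^sup>2 + 1 / c) * (\<integral>x. (v k x)\<^sup>2 \<partial>lborel)
         + c * (\<tau>\<^sup>2 * measure lborel A + \<tau> powr (2 - q) * (\<integral>x. h x powr q \<partial>lborel))"
        using iA iv[OF k(1)] ih by simp
      also have "\<dots> \<le> \<delta> * M\<^sup>2 * b + (3 * \<delta> + L\<^sup>2 + 1 / c) * (M\<^sup>2 * b) + c * (\<tau>\<^sup>2 * b + \<tau> powr (2 - q) * M powr q)"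
        using \<delta> c mA hM y1 by (intro add_mono mult_left_mono) (auto simp: v_def)
      also have "\<tau> powr (2 - q) * M powr q = M\<^sup>2 * b / c\<^sup>2"
      proof -
        have "\<tau> powr (2 - q) * M powr q = M powr (2 - q) / c powr (2 - q) * M powr q"
          using m c by (simp add: \<tau>_def powr_divide)
        also have "\<dots> = (M powr (2 - q) * M powr q) * c powr q / c powr 2"
          using c by (simp add: powr_diff)
        finally show ?thesis using m c by (simp add: powr_add[symmetric] powr_numeral)
      qed
      also have "\<delta> * M\<^sup>2 * b + (3 * \<delta> + L\<^sup>2 + 1 / c) * (M\<^sup>2 * b) + c * (\<tau>\<^sup>2 * b + M\<^sup>2 * b / c\<^sup>2)
          = M\<^sup>2 * ((4 * \<delta> + L\<^sup>2) * b + 3 * (b / c))"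
        using c by (simp add: \<tau>_def power2_eq_square field_simps)
      also have "\<dots> \<le> M\<^sup>2 * ((4 * \<delta> + L\<^sup>2) * (b / c) + 3 * (b / c))"
        using \<delta> b c by (intro mult_left_mono add_right_mono) (auto simp: field_simps)
      also have "\<dots> = (4 * \<delta> + L\<^sup>2 + 3) * M\<^sup>2 * b powr (1 - 1 / q)"
        by (simp add: c(4) algebra_simps)
      finally show "(\<integral>x. f (u x) * (norm (g x))\<^sup>2 \<partial>lborel) \<le> (4 * \<delta> + L\<^sup>2 + 3) * M\<^sup>2 * b powr (1 - 1 / q)" .
    qed (use C0 in auto)
    also have "\<dots> = C1 * M\<^sup>2 * (b powr (2 / real DIM('a)) * b powr (1 - 1 / q))"
      by (simp add: C1_def)
    also have "b powr (2 / real DIM('a)) * b powr (1 - 1 / q) = b powr (1 + (2 / real DIM('a) - 1 / q))"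
      by (simp only: powr_add[symmetric]) (simp add: algebra_simps)
    finally show ?thesis by (simp add: v_def)
  qed
  show ?thesis using main C1 by blast
qed

text \<open>If M is at least K times the L2 norm of u and at least the L_q norm of h, the squared L2
  norms of the excess of |u| over the levels M (1 - 2^(-j)) decay like \<rho>^j, so no excess over M
  remains.\<close>

theorem De_Giorgi_bound:
  fixes q \<delta> L :: real
  assumes q: "q \<ge> 2" "q > real DIM('a::euclidean_space) / 2" and \<delta>: "\<delta> > 0"
  shows "\<exists>C>0. \<forall>\<Omega> (u :: 'a \<Rightarrow> real) g h.
     energy_class \<Omega> \<delta> L u g h \<longrightarrow> integrable lborel (\<lambda>x. h x powr q) \<longrightarrow>
     (AE x in lborel. \<bar>u x\<bar> \<le> C * (sqrt (\<integral>x. (u x)\<^sup>2 \<partial>lborel) + (\<integral>x. h x powr q \<partial>lborel) powr (1 / q)))"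
proof -
  define \<gamma> where "\<gamma> = 2 / real DIM('a) - 1 / q"
  have \<gamma>: "\<gamma> > 0" using q by (simp add: \<gamma>_def field_simps)
  obtain C where C: "C > 0" and step: "\<And>\<Omega> (u :: 'a \<Rightarrow> real) g h k k' b M.
     energy_class \<Omega> \<delta> L u g h \<Longrightarrow> integrable lborel (\<lambda>x. h x powr q) \<Longrightarrow>
     (\<integral>x. h x powr q \<partial>lborel) \<le> M powr q \<Longrightarrow> 0 \<le> k \<Longrightarrow> k < k' \<Longrightarrow> k' \<le> M \<Longrightarrow> 0 < b \<Longrightarrow> b \<le> 1 \<Longrightarrow>
     (\<integral>x. (max 0 (\<bar>u x\<bar> - k))\<^sup>2 \<partial>lborel) \<le> M\<^sup>2 * b \<Longrightarrow>
     (\<integral>x. (max 0 (\<bar>u x\<bar> - k))\<^sup>2 \<partial>lborel) \<le> ((k' - k) / 2)\<^sup>2 * b \<Longrightarrow>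
     (\<integral>x. (max 0 (\<bar>u x\<bar> - k'))\<^sup>2 \<partial>lborel) \<le> C * M\<^sup>2 * b powr (1 + \<gamma>)"
    using De_Giorgi_step[OF q(1) \<delta>, where 'a = 'a] unfolding \<gamma>_def by blast
  \<comment> \<open>The solution of (4 \<rho>)^(1 + \<gamma>) = \<rho>, the decay rate that
    reproduces itself; the 4 is lost by squaring the halved gaps between levels.\<close>
  define \<rho> where "\<rho> = (4::real) powr (- ((1 + \<gamma>) / \<gamma>))"
  have \<rho>: "\<rho> > 0" "4 * \<rho> \<le> 1" "(4 * \<rho>) powr (1 + \<gamma>) = \<rho>"
  proof -
    have e: "4 * \<rho> = 4 powr (- 1 / \<gamma>)"
    proof -
      have "4 * \<rho> = 4 powr (1 + (- ((1 + \<gamma>) / \<gamma>)))" unfolding \<rho>_def powr_add by simp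
      also have "1 + (- ((1 + \<gamma>) / \<gamma>)) = - 1 / \<gamma>" using \<gamma> by (simp add: field_simps)
      finally show ?thesis .
    qed
    show "\<rho> > 0" by (simp add: \<rho>_def)
    show "4 * \<rho> \<le> 1" unfolding e using \<gamma> powr_mono[of "- 1 / \<gamma>" 0 4] by simp
    show "(4 * \<rho>) powr (1 + \<gamma>) = \<rho>" unfolding e powr_powr by (simp add: \<rho>_def)
  qed
  \<comment> \<open>The first entry ensures b \<le> 1 in \<open>step\<close>, the second makes C (16
    z)^(1 + \<gamma>) \<le> z \<rho>, which closes the induction.\<close>
  define z where "z = min (1 / 16) ((\<rho> / (C * 16 powr (1 + \<gamma>))) powr (1 / \<gamma>))"
  have z: "z > 0" "z \<le> 1 / 16" using \<rho> C by (auto simp: z_def)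
  have zC: "C * (16 * z) powr (1 + \<gamma>) \<le> z * \<rho>"
  proof -
    have "z powr \<gamma> \<le> ((\<rho> / (C * 16 powr (1 + \<gamma>))) powr (1 / \<gamma>)) powr \<gamma>"
      using z \<gamma> by (intro powr_mono2) (auto simp: z_def)
    also have "\<dots> = \<rho> / (C * 16 powr (1 + \<gamma>))" using \<gamma> \<rho> C by (simp add: powr_powr)
    finally have "C * 16 powr (1 + \<gamma>) * z powr \<gamma> \<le> \<rho>" using C by (simp add: field_simps)
    then have "z * (C * 16 powr (1 + \<gamma>) * z powr \<gamma>) \<le> z * \<rho>" using z by (intro mult_left_mono) auto
    moreover have "(16 * z) powr (1 + \<gamma>) = 16 powr (1 + \<gamma>) * (z * z powr \<gamma>)"
      using z by (simp add: powr_mult powr_add)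
    ultimately show ?thesis by (simp add: mult_ac)
  qed
  \<comment> \<open>Chosen so that M \<ge> K times the L2 norm of u is the initial bound z M^2 for
    the integral of u^2.\<close>
  define K where "K = 1 / sqrt z"
  have K: "K \<ge> 1" "K\<^sup>2 * z = 1" "K > 0"
  proof -
    have "sqrt z \<le> sqrt 1" using z by (intro real_sqrt_le_mono) auto
    then show "K \<ge> 1" using z by (simp add: K_def field_simps)
    show "K\<^sup>2 * z = 1" using z by (simp add: K_def power_divide)
    show "K > 0" using z by (simp add: K_def)
  qed
  have main: "AE x in lborel. \<bar>u x\<bar> \<le> M"
    if EC: "energy_class \<Omega> \<delta> L u g h" and ih: "integrable lborel (\<lambda>x. h x powr q)"
      and M: "M > 0" "K * sqrt (\<integral>x. (u x)\<^sup>2 \<partial>lborel) \<le> M" "(\<integral>x. h x powr q \<partial>lborel) powr (1 / q) \<le> M"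
    for \<Omega> and u :: "'a \<Rightarrow> real" and g h M
  proof -
    define k where "k j = M * (1 - (1 / 2) ^ j)" for j :: nat
    define y where "y k = (\<integral>x. (max 0 (\<bar>u x\<bar> - k))\<^sup>2 \<partial>lborel)" for k
    have su: "sq_int lborel u" and [measurable]: "u \<in> borel_measurable borel"
      using EC by (auto simp: energy_class_def H0_def)
    have hM: "(\<integral>x. h x powr q \<partial>lborel) \<le> M powr q"
    proof -
      have "((\<integral>x. h x powr q \<partial>lborel) powr (1 / q)) powr q \<le> M powr q"
        using M q by (intro powr_mono2) auto
      then show ?thesis using q by (simp add: powr_powr)
    qed
    have yj: "y (k j) \<le> M\<^sup>2 * (z * \<rho> ^ j)" for j
    proof (induction j)
      case 0
      have "y (k 0) = (\<integral>x. (u x)\<^sup>2 \<partial>lborel)" by (simp add: y_def k_def)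
      also have "\<dots> = z * (K * sqrt (\<integral>x. (u x)\<^sup>2 \<partial>lborel))\<^sup>2"
        using K by (simp add: power_mult_distrib mult_ac)
      also have "\<dots> \<le> z * M\<^sup>2" using z K M by (intro mult_left_mono power_mono) auto
      finally show ?case by (simp add: mult_ac)
    next
      case (Suc j)
      \<comment> \<open>Half the gap is M 2^(-j) / 4; this b makes its square times b equal to the
        inductive bound M^2 z \<rho>^j.\<close>
      define b where "b = 16 * z * (4 * \<rho>) ^ j"
      have b: "b > 0" using z \<rho> by (simp add: b_def)
      have b1: "b \<le> 1 * 1" unfolding b_def using z \<rho> by (intro mult_mono power_le_one) auto
      have eta: "((k (Suc j) - k j) / 2)\<^sup>2 * b = M\<^sup>2 * (z * \<rho> ^ j)"
      proof -
        have "(k (Suc j) - k j) / 2 = M / 4 * (1 / 2) ^ j" by (simp add: k_def field_simps)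
        then have "((k (Suc j) - k j) / 2)\<^sup>2 * b = M\<^sup>2 * z * (((1 / 2) ^ j)\<^sup>2 * (4 * \<rho>) ^ j)"
          by (simp add: b_def power_mult_distrib power_divide)
        also have "((1 / 2 :: real) ^ j)\<^sup>2 * (4 * \<rho>) ^ j = ((1 / 2)\<^sup>2 * (4 * \<rho>)) ^ j"
          by (simp add: power_mult_distrib power_mult[symmetric] mult.commute)
        finally show ?thesis by (simp add: power2_eq_square)
      qed
      have zb: "z * \<rho> ^ j \<le> b"
      proof -
        have "1 * \<rho> ^ j \<le> 16 * (4 * \<rho>) ^ j"
          using \<rho> by (intro mult_mono power_mono) auto
        then show ?thesis using z by (simp add: b_def)
      qed
      have "y (k (Suc j)) \<le> C * M\<^sup>2 * b powr (1 + \<gamma>)"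
        unfolding y_def
      proof (rule step[OF EC ih hM _ _ _ b])
        show "0 \<le> k j" "k j < k (Suc j)" "k (Suc j) \<le> M" "b \<le> 1" using M b1
          by (auto simp: k_def power_le_one field_simps)
        show "(\<integral>x. (max 0 (\<bar>u x\<bar> - k j))\<^sup>2 \<partial>lborel) \<le> M\<^sup>2 * b"
          using order_trans[OF Suc.IH mult_left_mono[OF zb]] by (simp add: y_def)
        show "(\<integral>x. (max 0 (\<bar>u x\<bar> - k j))\<^sup>2 \<partial>lborel) \<le> ((k (Suc j) - k j) / 2)\<^sup>2 * b"
          using Suc.IH unfolding eta by (simp add: y_def)
      qed
      also have "\<dots> = M\<^sup>2 * (C * (16 * z) powr (1 + \<gamma>)) * ((4 * \<rho>) ^ j) powr (1 + \<gamma>)"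
        using z \<rho> by (simp add: b_def powr_mult)
      also have "((4 * \<rho>) ^ j) powr (1 + \<gamma>) = \<rho> ^ j"
      proof -
        have "(r ^ j) powr (1 + \<gamma>) = (r powr (1 + \<gamma>)) ^ j" if "r > 0" for r :: real
          using that by (simp add: powr_realpow[symmetric] powr_powr mult.commute)
        from this[of "4 * \<rho>"] show ?thesis using \<rho>(1,3) by simp
      qed
      also have "M\<^sup>2 * (C * (16 * z) powr (1 + \<gamma>)) * \<rho> ^ j \<le> M\<^sup>2 * (z * \<rho>) * \<rho> ^ j"
        using zC \<rho> by (intro mult_right_mono mult_left_mono) auto
      finally show ?case by (simp add: mult_ac)
    qed
    have i: "integrable lborel (\<lambda>x. (max 0 (\<bar>u x\<bar> - k))\<^sup>2)" if "k \<ge> 0" for k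
    proof -
      have "sq_int lborel (\<lambda>x. max 0 (\<bar>u x\<bar> - k))"
        by (rule sq_int_le[OF su, where c = 1]) (use that in auto)
      then show ?thesis by (simp add: sq_int_def)
    qed
    have "y M \<le> M\<^sup>2 * (z * \<rho> ^ j)" for j
    proof -
      have kj: "0 \<le> k j" "k j \<le> M" using M by (auto simp: k_def power_le_one)
      have "y M \<le> y (k j)" unfolding y_def
        using M kj by (intro integral_mono i power_mono) auto
      then show ?thesis using yj[of j] by simp
    qed
    moreover have "(\<lambda>j. M\<^sup>2 * (z * \<rho> ^ j)) \<longlonglongrightarrow> M\<^sup>2 * (z * 0)"
      by (intro tendsto_intros LIMSEQ_realpow_zero) (use \<rho> in auto)
    ultimately have "y M \<le> 0" by (intro LIMSEQ_le_const) auto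
    then have "y M = 0" by (intro antisym) (simp_all add: y_def)
    then have "AE x in lborel. (max 0 (\<bar>u x\<bar> - M))\<^sup>2 = 0"
      using i M unfolding y_def by (subst (asm) integral_nonneg_eq_0_iff_AE) auto
    then show ?thesis by eventually_elim (simp add: max_def split: if_splits)
  qed
  have "AE x in lborel. \<bar>u x\<bar> \<le> K * (sqrt (\<integral>x. (u x)\<^sup>2 \<partial>lborel) + (\<integral>x. h x powr q \<partial>lborel) powr (1 / q))"
    if EC: "energy_class \<Omega> \<delta> L u g h" and ih: "integrable lborel (\<lambda>x. h x powr q)"
    for \<Omega> and u :: "'a \<Rightarrow> real" and g h
  proof -
    let ?a = "sqrt (\<integral>x. (u x)\<^sup>2 \<partial>lborel)" and ?b = "(\<integral>x. h x powr q \<partial>lborel) powr (1 / q)"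
    \<comment> \<open>\<open>main\<close> needs M > 0, while both norms may vanish; a positive
      summand tending to 0 covers this case.\<close>
    have "AE x in lborel. \<forall>n::nat. \<bar>u x\<bar> \<le> K * (?a + ?b) + inverse (real (Suc n))"
      unfolding AE_all_countable
    proof
      fix n
      have ab: "?a \<ge> 0" "?b \<ge> 0" by auto
      have "1 * ?b \<le> K * ?b" using K by (intro mult_right_mono) auto
      then show "AE x in lborel. \<bar>u x\<bar> \<le> K * (?a + ?b) + inverse (real (Suc n))"
        using K ab
        by (intro main[OF EC ih] add_nonneg_pos mult_nonneg_nonneg add_nonneg_nonneg)
           (auto simp: distrib_left add_increasing add_increasing2)
    qed
    then show ?thesis
    proof eventually_elim
      case (elim x)
      have "(\<lambda>n. K * (?a + ?b) + inverse (real (Suc n))) \<longlonglongrightarrow> K * (?a + ?b) + 0"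
        by (intro tendsto_intros LIMSEQ_inverse_real_of_nat)
      with elim show ?case by (intro LIMSEQ_le_const) auto
    qed
  qed
  then show ?thesis using K(3) by blast
qed


section \<open>The case $q < d/2$\<close>

text \<open>Comparing b with a^(q - 1) gives constants 1, which suffices: small coefficients are
  produced later by scaling a with l and b with 1/l.\<close>

lemma Young_crude:
  fixes a b q :: real
  assumes "a \<ge> 0" "b \<ge> 0" "q > 1"
  shows "a * b \<le> a powr q + b powr (q / (q - 1))"
proof (cases "b \<le> a powr (q - 1)")
  case True
  then have "a * b \<le> a * a powr (q - 1)" using assms by (intro mult_left_mono)
  also have "\<dots> = a powr q" using assms by (cases "a = 0") (auto simp: powr_diff)
  finally show ?thesis by (simp add: add_increasing2)
next
  case False
  then have b: "b > 0" by (smt (verit) powr_ge_zero)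
  have "a = (a powr (q - 1)) powr (1 / (q - 1))" using assms by (simp add: powr_powr)
  also have "\<dots> \<le> b powr (1 / (q - 1))" using False assms by (intro powr_mono2) auto
  finally have "a * b \<le> b powr (1 / (q - 1)) * b powr 1" using b by simp
  also have "\<dots> = b powr (q / (q - 1))"
    unfolding powr_add[symmetric] using assms by (intro arg_cong[where f = "\<lambda>e. b powr e"]) (simp add: field_simps)
  finally show ?thesis by (simp add: add_increasing)
qed

text \<open>W is s^\<beta> with the factor s^(\<beta> - 1) cut off at N. Where W is below
  \<kappa>^\<beta>, that factor is at most \<kappa>^(\<beta> - 1) and the L2 norm of s controls W;
  elsewhere W^p dominates, with a negative power of \<kappa> that makes it absorbable.\<close>

lemma truncated_power_sq_le:
  fixes s N \<beta> p \<kappa> :: real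
  assumes "s \<ge> 0" "N > 0" "\<beta> > 1" "p > 2" "\<kappa> > 0"
  defines "W \<equiv> s * min s N powr (\<beta> - 1)"
  shows "W\<^sup>2 \<le> \<kappa> powr (2 * \<beta> - 2) * s\<^sup>2 + \<kappa> powr (- (\<beta> * (p - 2))) * W powr p"
proof (cases "W \<le> \<kappa> powr \<beta>")
  case True
  have "min s N powr \<beta> = min s N * min s N powr (\<beta> - 1)"
    using assms by (cases "s = 0") (auto simp: powr_diff)
  also have "\<dots> \<le> W" unfolding W_def by (intro mult_right_mono) auto
  finally have "min s N powr \<beta> \<le> \<kappa> powr \<beta>" using True by simp
  moreover have "\<kappa> powr \<beta> < min s N powr \<beta>" if "\<kappa> < min s N"
    using that assms by (intro powr_less_mono2) auto
  ultimately have "min s N \<le> \<kappa>" by (meson not_less)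
  then have "min s N powr (\<beta> - 1) \<le> \<kappa> powr (\<beta> - 1)" using assms by (intro powr_mono2) auto
  then have "(min s N powr (\<beta> - 1))\<^sup>2 \<le> (\<kappa> powr (\<beta> - 1))\<^sup>2" by (intro power_mono) auto
  also have "\<dots> = \<kappa> powr (2 * \<beta> - 2)" by (simp add: power2_eq_square powr_add[symmetric])
  finally have "W\<^sup>2 \<le> \<kappa> powr (2 * \<beta> - 2) * s\<^sup>2"
    unfolding W_def power_mult_distrib by (simp add: mult.commute mult_left_mono)
  then show ?thesis by (simp add: add_increasing2)
next
  case False
  then have W: "W > 0" by (smt (verit) powr_ge_zero)
  have "W\<^sup>2 = W powr (2 - p) * W powr p" using W by (simp add: powr_add[symmetric] powr_numeral)
  also have "\<dots> \<le> (\<kappa> powr \<beta>) powr (2 - p) * W powr p"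
    using False assms by (intro mult_right_mono powr_mono2') auto
  also have "(\<kappa> powr \<beta>) powr (2 - p) = \<kappa> powr (- (\<beta> * (p - 2)))"
    unfolding powr_powr by (intro arg_cong[where f = "\<lambda>e. \<kappa> powr e"]) (simp add: algebra_simps)
  finally show ?thesis by (simp add: add_increasing)
qed

text \<open>Without truncation both sides are s^(2 \<beta> - 1). With it, the share (\<beta> -
  1)/\<beta> of the exponent of min s N is traded for the larger s.\<close>

lemma truncated_power_le:
  fixes s N \<beta> :: real
  assumes "s \<ge> 0" "N > 0" "\<beta> > 1"
  shows "s * (min s N powr (\<beta> - 1))\<^sup>2 \<le> (s * min s N powr (\<beta> - 1)) powr ((2 * \<beta> - 1) / \<beta>)"
proof (cases "s = 0")
  case False
  define t where "t = min s N"
  have t: "0 < t" "t \<le> s" and s: "s > 0" using False assms by (auto simp: t_def)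
  have e1: "1 + (\<beta> - 1) / \<beta> = (2 * \<beta> - 1) / \<beta>" using assms by (simp add: field_simps)
  have e2: "2 * (\<beta> - 1) = (\<beta> - 1) / \<beta> + (\<beta> - 1) * ((2 * \<beta> - 1) / \<beta>)" using assms by (simp add: field_simps)
  have "s * (t powr (\<beta> - 1))\<^sup>2 = s * t powr (2 * (\<beta> - 1))"
    by (simp add: power2_eq_square powr_add[symmetric])
  also have "\<dots> = s * (t powr ((\<beta> - 1) / \<beta>) * t powr ((\<beta> - 1) * ((2 * \<beta> - 1) / \<beta>)))"
    unfolding e2 powr_add ..
  also have "\<dots> \<le> s * (s powr ((\<beta> - 1) / \<beta>) * t powr ((\<beta> - 1) * ((2 * \<beta> - 1) / \<beta>)))"
    using t s assms by (intro mult_left_mono mult_right_mono powr_mono2) auto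
  also have "\<dots> = s powr (1 + (\<beta> - 1) / \<beta>) * t powr ((\<beta> - 1) * ((2 * \<beta> - 1) / \<beta>))"
    using s by (simp add: powr_add)
  also have "\<dots> = (s * t powr (\<beta> - 1)) powr ((2 * \<beta> - 1) / \<beta>)"
    unfolding e1 using s t by (simp add: powr_mult powr_powr)
  finally show ?thesis by (simp add: t_def)
qed simp

text \<open>R stands for the L_r norm of u, I for the integral of u^2 and H for that of h^q. The
  parameters \<kappa> and l may depend on R: as powers of R they give every term the scaling of R^(2
  \<beta>), with coefficients at most 1/4 on the two terms to be absorbed. If R exceeded the claimed
  bound, the other terms would be too small for the inequality.\<close>

lemma Moser_absorb:
  fixes c1 c2 \<beta> p q r :: real
  assumes "c1 \<ge> 0" "c2 \<ge> 0" "\<beta> > 1" "p > 2" "q \<ge> 2" and r: "r = \<beta> * p" "r * (q - 1) = (2 * \<beta> - 1) * q"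
  shows "\<exists>K>0. \<forall>R I H. R > 0 \<longrightarrow> I \<ge> 0 \<longrightarrow> H \<ge> 0 \<longrightarrow>
     (\<forall>\<kappa>>0. \<forall>l>0. R powr (2 * \<beta>) \<le>
        c1 * (\<kappa> powr (2 * \<beta> - 2) * I + \<kappa> powr (- (\<beta> * (p - 2))) * R powr r) +
        c2 * (l powr q * H + l powr (- (q / (q - 1))) * R powr r)) \<longrightarrow>
     R \<le> K * (sqrt I + H powr (1 / q))"
proof -
  define A where "A = (4 * c1 + 1) powr (1 / (\<beta> * (p - 2)))"
  define B where "B = (4 * c2 + 1) powr ((q - 1) / q)"
  have A: "A > 0" and B: "B > 0" using assms by (auto simp: A_def B_def)
  have A2: "A powr (- (\<beta> * (p - 2))) = 1 / (4 * c1 + 1)"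
  proof -
    have e: "1 / (\<beta> * (p - 2)) * (- (\<beta> * (p - 2))) = - 1" using assms(3,4) by simp
    show ?thesis unfolding A_def powr_powr e using assms(1) by (simp add: powr_minus divide_inverse)
  qed
  have B2: "B powr (- (q / (q - 1))) = 1 / (4 * c2 + 1)"
  proof -
    have e: "(q - 1) / q * (- (q / (q - 1))) = - 1" using assms(5) by simp
    show ?thesis unfolding B_def powr_powr e using assms(2) by (simp add: powr_minus divide_inverse)
  qed
  define D where "D = c1 * A powr (2 * \<beta> - 2) + c2 * B powr q"
  have D: "D \<ge> 0" using assms by (simp add: D_def)
  \<comment> \<open>The contradiction below will read 1/2 \<le> D/K.\<close>
  define K where "K = 2 * D + 1"
  have K: "K \<ge> 1" "K > 0" using D by (auto simp: K_def)
  have main: "R \<le> K * (sqrt I + H powr (1 / q))"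
    if R: "R > 0" and I: "I \<ge> 0" and H: "H \<ge> 0"
      and *: "\<And>\<kappa> l. \<kappa> > 0 \<Longrightarrow> l > 0 \<Longrightarrow> R powr (2 * \<beta>) \<le>
        c1 * (\<kappa> powr (2 * \<beta> - 2) * I + \<kappa> powr (- (\<beta> * (p - 2))) * R powr r) +
        c2 * (l powr q * H + l powr (- (q / (q - 1))) * R powr r)" for R I H
  proof (rule ccontr)
    assume "\<not> ?thesis"
    then have lt: "K * (sqrt I + H powr (1 / q)) < R" by simp
    define X where "X = R powr (2 * \<beta>)"
    have X: "X > 0" using R by (simp add: X_def)
    \<comment> \<open>The exponent turning \<open>l powr (- (q / (q - 1))) * R powr r\<close> into a
      multiple of R^(2 \<beta>). The relation between r and \<beta> gives e q = 2 \<beta> - q, so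
      the term with H scales as R^(2 \<beta>) H / R^q.\<close>
    define e where "e = (r - 2 * \<beta>) * (q - 1) / q"
    have t1: "(A * R) powr (2 * \<beta> - 2) * I = A powr (2 * \<beta> - 2) * X * (I / R\<^sup>2)"
      using A R by (simp add: powr_mult powr_diff powr_numeral X_def)
    have t2: "(A * R) powr (- (\<beta> * (p - 2))) * R powr r = X / (4 * c1 + 1)"
    proof -
      have "R powr (- (\<beta> * (p - 2))) * R powr r = X"
        unfolding X_def powr_add[symmetric] r(1)
        by (intro arg_cong[where f = "\<lambda>e. R powr e"]) (simp add: algebra_simps)
      then show ?thesis using A R by (simp add: powr_mult A2)
    qed
    have t3: "(B * R powr e) powr q * H = B powr q * X * (H / R powr q)"
    proof -
      have "e * q = (r - 2 * \<beta>) * (q - 1)" using assms(5) by (simp add: e_def)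
      also have "\<dots> = r * (q - 1) - 2 * \<beta> * (q - 1)" by (simp add: algebra_simps)
      also have "\<dots> = 2 * \<beta> - q" unfolding r(2) by (simp add: algebra_simps)
      finally show ?thesis using B R by (simp add: powr_mult powr_powr powr_diff X_def)
    qed
    have t4: "(B * R powr e) powr (- (q / (q - 1))) * R powr r = X / (4 * c2 + 1)"
    proof -
      have "e * (- (q / (q - 1))) + r = 2 * \<beta>" using assms(5) by (simp add: e_def)
      then have "(R powr e) powr (- (q / (q - 1))) * R powr r = X"
        unfolding X_def powr_powr powr_add[symmetric] by simp
      then show ?thesis using B R by (simp add: powr_mult B2)
    qed
    have "X \<le> c1 * (A powr (2 * \<beta> - 2) * X * (I / R\<^sup>2) + X / (4 * c1 + 1)) +
        c2 * (B powr q * X * (H / R powr q) + X / (4 * c2 + 1))"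
      using *[of "A * R" "B * R powr e"] A B R unfolding t1 t2 t3 t4 X_def[symmetric] by simp
    also have "\<dots> = X * (c1 * A powr (2 * \<beta> - 2) * (I / R\<^sup>2) + c2 * B powr q * (H / R powr q)
        + c1 / (4 * c1 + 1) + c2 / (4 * c2 + 1))"
      by (simp add: algebra_simps)
    finally have "1 \<le> c1 * A powr (2 * \<beta> - 2) * (I / R\<^sup>2) + c2 * B powr q * (H / R powr q)
        + c1 / (4 * c1 + 1) + c2 / (4 * c2 + 1)" using X by simp
    moreover have "c1 / (4 * c1 + 1) \<le> 1 / 4" "c2 / (4 * c2 + 1) \<le> 1 / 4" using assms by (auto simp: field_simps)
    moreover have "I / R\<^sup>2 \<le> 1 / K"
    proof -
      have "K * sqrt I \<le> R" using lt K by (simp add: distrib_left) (smt (verit) mult_nonneg_nonneg powr_ge_zero)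
      then have "(K * sqrt I)\<^sup>2 \<le> R\<^sup>2" using K I by (intro power_mono) auto
      moreover have "(K * sqrt I)\<^sup>2 = K * (K * I)" using I by (simp add: power_mult_distrib power2_eq_square[of K])
      ultimately have "K * (K * I) \<le> R\<^sup>2" by simp
      moreover have "1 * (K * I) \<le> K * (K * I)" using K I by (intro mult_right_mono) auto
      ultimately show ?thesis using R K by (simp add: field_simps)
    qed
    moreover have HR: "H / R powr q \<le> 1 / K"
    proof -
      have "K * H powr (1 / q) \<le> R" using lt K I by (simp add: distrib_left) (smt (verit) mult_nonneg_nonneg real_sqrt_ge_zero)
      then have "(K * H powr (1 / q)) powr q \<le> R powr q" using K assms by (intro powr_mono2) auto
      then have "K powr q * H \<le> R powr q" using K H assms by (simp add: powr_mult powr_powr)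
      moreover have "K powr 1 * H \<le> K powr q * H" using K H assms by (intro mult_right_mono powr_mono) auto
      ultimately show ?thesis using R K by (simp add: field_simps)
    qed
    moreover have "c2 * B powr q * (H / R powr q) \<le> c2 * B powr q * (1 / K)"
      using assms(2) HR by (intro mult_left_mono) auto
    moreover have "c1 * A powr (2 * \<beta> - 2) * (I / R\<^sup>2) \<le> c1 * A powr (2 * \<beta> - 2) * (1 / K)"
      using assms(1) \<open>I / R\<^sup>2 \<le> 1 / K\<close> by (intro mult_left_mono) auto
    ultimately have "1 / 2 \<le> c1 * A powr (2 * \<beta> - 2) * (1 / K) + c2 * B powr q * (1 / K)"
      by linarith
    also have "\<dots> = D / K" by (simp add: D_def add_divide_distrib)
    finally have "K \<le> 2 * D" using K by (simp add: field_simps)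
    then show False by (simp add: K_def)
  qed
  show ?thesis using main K by (intro exI[of _ K]) blast
qed


text \<open>G has the square of the derivative of F as derivative, so testing with G produces
  exactly the Dirichlet integral of F(u). As w loses at most a factor 2^(\<beta> - 1) when s is
  halved, the growth of F on [s/2, s] alone makes F comparable to s w(s).\<close>

lemma truncated_power_functions:
  fixes N \<beta> :: real
  assumes N: "N > 0" and \<beta>: "\<beta> > 1"
  defines "w \<equiv> \<lambda>s::real. min \<bar>s\<bar> N powr (\<beta> - 1)"
  obtains F G where "\<And>s. (F has_real_derivative w s) (at s)" "\<And>s. (G has_real_derivative (w s)\<^sup>2) (at s)"
    "F 0 = 0" "G 0 = 0" "continuous_on UNIV w" "\<And>s. 0 \<le> w s" "\<And>s. w s \<le> N powr (\<beta> - 1)"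
    "\<And>s. \<bar>G s\<bar> \<le> (w s)\<^sup>2 * \<bar>s\<bar>" "\<And>s. \<bar>s\<bar> * w s \<le> 2 powr \<beta> * \<bar>F s\<bar>"
proof -
  have c: "continuous_on UNIV w" unfolding w_def using N \<beta>
    by (intro continuous_on_powr' continuous_intros) auto
  have w0: "0 \<le> w s" for s by (simp add: w_def)
  have wmono: "w r \<le> w s" if "\<bar>r\<bar> \<le> \<bar>s\<bar>" for r s
    unfolding w_def using that N \<beta> by (intro powr_mono2) auto
  have even: "w (- s) = w s" for s by (simp add: w_def)
  obtain F where F: "\<And>s. (F has_real_derivative w s) (at s)" "F 0 = 0" "\<And>s. F (- s) = - F s"
    by (rule odd_antiderivative[OF c even]) blast
  have c2: "continuous_on UNIV (\<lambda>s. (w s)\<^sup>2)" by (intro continuous_intros c)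
  obtain G where G: "\<And>s. (G has_real_derivative (w s)\<^sup>2) (at s)" "G 0 = 0" "\<And>s. G (- s) = - G s"
    by (rule odd_antiderivative[OF c2]) (auto simp: even)
  have half: "w s \<le> 2 powr (\<beta> - 1) * w (s / 2)" for s
  proof -
    have "min \<bar>s\<bar> N \<le> 2 * min \<bar>s / 2\<bar> N" using N by (simp add: min_def)
    then have "w s \<le> (2 * min \<bar>s / 2\<bar> N) powr (\<beta> - 1)"
      unfolding w_def using N \<beta> by (intro powr_mono2) auto
    also have "\<dots> = 2 powr (\<beta> - 1) * w (s / 2)" using N by (simp add: w_def powr_mult)
    finally show ?thesis .
  qed
  have pos: "s * w s \<le> 2 powr \<beta> * F s" if "0 \<le> s" for s
  proof -
    have "w (s / 2) * (s - s / 2) \<le> F s - F (s / 2)"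
      using that by (intro increment_ge[OF F(1)] wmono) auto
    moreover have "0 * (s / 2 - 0) \<le> F (s / 2) - F 0"
      using that by (intro increment_ge[OF F(1)] w0) auto
    moreover have "s * w (s / 2) = 2 * (w (s / 2) * (s - s / 2))" by (simp add: field_simps)
    ultimately have "s * w (s / 2) \<le> 2 * F s" using F(2) by linarith
    then have "2 powr (\<beta> - 1) * (s * w (s / 2)) \<le> 2 powr (\<beta> - 1) * (2 * F s)" by (intro mult_left_mono) auto
    moreover have "s * w s \<le> s * (2 powr (\<beta> - 1) * w (s / 2))" using half that by (intro mult_left_mono)
    moreover have "s * (2 powr (\<beta> - 1) * w (s / 2)) = 2 powr (\<beta> - 1) * (s * w (s / 2))" by simp
    moreover have "2 powr (\<beta> - 1) * (2 * F s) = 2 powr \<beta> * F s" by (simp add: powr_diff)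
    ultimately show ?thesis by linarith
  qed
  show ?thesis
  proof (rule that[OF F(1) G(1) F(2) G(2) c w0])
    show "w s \<le> N powr (\<beta> - 1)" for s unfolding w_def using N \<beta> by (intro powr_mono2) auto
    show "\<bar>G s\<bar> \<le> (w s)\<^sup>2 * \<bar>s\<bar>" for s
      by (rule antiderivative_le[OF G]) (auto intro!: power_mono wmono w0)
    show "\<bar>s\<bar> * w s \<le> 2 powr \<beta> * \<bar>F s\<bar>" for s
    proof (cases "0 \<le> s")
      case True
      have "2 powr \<beta> * F s \<le> 2 powr \<beta> * \<bar>F s\<bar>" by (intro mult_left_mono) auto
      with pos[OF True] have "s * w s \<le> 2 powr \<beta> * \<bar>F s\<bar>" by linarith
      then show ?thesis by (simp only: abs_of_nonneg[OF True])
    next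
      case False
      have "2 powr \<beta> * F (- s) \<le> 2 powr \<beta> * \<bar>F s\<bar>" using F(3) by (intro mult_left_mono) auto
      moreover have "- s * w s \<le> 2 powr \<beta> * F (- s)" using pos[of "- s"] False even[of s] by simp
      ultimately have "- s * w s \<le> 2 powr \<beta> * \<bar>F s\<bar>" by linarith
      then show ?thesis using False by (simp only: abs_of_neg not_le)
    qed
  qed
qed

text \<open>Sobolev's inequality for F(u) bounds the integral of W^p by the energy, and the energy
  inequality with X = |s| bounds the energy by the integrals of u^2, h^q and again W^p, with free
  parameters that allow absorption.\<close>

theorem Moser_bound:
  fixes q \<delta> L :: real
  assumes q: "q \<ge> 2" "q < real DIM('a::euclidean_space) / 2" and \<delta>: "\<delta> > 0"
  defines "r \<equiv> q * real DIM('a) / (real DIM('a) - 2 * q)"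
  shows "\<exists>C>0. \<forall>\<Omega> (u :: 'a \<Rightarrow> real) g h.
     energy_class \<Omega> \<delta> L u g h \<longrightarrow> integrable lborel (\<lambda>x. h x powr q) \<longrightarrow>
     integrable lborel (\<lambda>x. \<bar>u x\<bar> powr r) \<and>
     (\<integral>x. \<bar>u x\<bar> powr r \<partial>lborel) powr (1 / r) \<le>
       C * (sqrt (\<integral>x. (u x)\<^sup>2 \<partial>lborel) + (\<integral>x. h x powr q \<partial>lborel) powr (1 / q))"
proof -
  define d where "d = real DIM('a)"
  \<comment> \<open>From 2 \<le> q < d/2; in particular Sobolev's inequality is available.\<close>
  have d: "d > 4" "2 * q < d" using q by (auto simp: d_def)
  have "real DIM('a) > real 4" using d(1) unfolding d_def by simp
  then have d3: "DIM('a) \<ge> 3" by linarith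
  define p where "p = 2 * d / (d - 2)"
  define \<beta> where "\<beta> = q * (d - 2) / (2 * (d - 2 * q))"
  have p: "p > 2" using d by (simp add: p_def field_simps)
  have "2 * (d - 2) \<le> q * (d - 2)" using q d by (intro mult_right_mono) auto
  then have \<beta>: "\<beta> > 1" using q d by (simp add: \<beta>_def field_simps)
  have r: "r = \<beta> * p"
  proof -
    have "\<beta> * p = (q * (d - 2) * (2 * d)) / (2 * (d - 2 * q) * (d - 2))"
      unfolding \<beta>_def p_def by (rule times_divide_times_eq)
    also have "\<dots> = q * d / (d - 2 * q)"
    proof (subst frac_eq_eq)
      show "2 * (d - 2 * q) * (d - 2) \<noteq> 0" "d - 2 * q \<noteq> 0" using d by simp_all
    qed (simp add: algebra_simps)
    finally show ?thesis by (simp add: r_def d_def)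
  qed
  have r': "r * (q - 1) = (2 * \<beta> - 1) * q"
  proof -
    have "2 * \<beta> - 1 = (q * (d - 2) - (d - 2 * q)) / (d - 2 * q)"
    proof -
      have "2 * (a / (2 * D)) = a / D" for a D :: real by simp
      then have "2 * \<beta> = q * (d - 2) / (d - 2 * q)" unfolding \<beta>_def .
      then show ?thesis using d by (simp add: diff_divide_distrib)
    qed
    also have "q * (d - 2) - (d - 2 * q) = d * (q - 1)" by (simp add: algebra_simps)
    finally show ?thesis by (simp add: r_def d_def[symmetric])
  qed
  have r0: "r > 0" using \<beta> p by (simp add: r)
  obtain CS where CS: "CS > 0" and Sob: "\<And>\<Omega> (u :: 'a \<Rightarrow> real) g. H0 \<Omega> u g \<Longrightarrow>
     integrable lborel (\<lambda>x. \<bar>u x\<bar> powr p) \<and>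
     (\<integral>x. \<bar>u x\<bar> powr p \<partial>lborel) \<le> CS * (\<integral>x. (norm (g x))\<^sup>2 \<partial>lborel) powr (p / 2)"
    using Sobolev[OF d3] unfolding p_def d_def by blast
  define C2 where "C2 = (2 powr (\<beta> * p) * CS) powr (2 / p)"
  have C2: "C2 > 0" using CS by (simp add: C2_def)
  define c1 where "c1 = C2 * (2 * \<delta> + L\<^sup>2)"
  define c2 where "c2 = C2 * 2"
  have c: "c1 \<ge> 0" "c2 \<ge> 0" using C2 \<delta> by (auto simp: c1_def c2_def)
  obtain K where KA: "K > 0 \<and> (\<forall>R I H. R > 0 \<longrightarrow> I \<ge> 0 \<longrightarrow> H \<ge> 0 \<longrightarrow>
     (\<forall>\<kappa>>0. \<forall>l>0. R powr (2 * \<beta>) \<le>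
        c1 * (\<kappa> powr (2 * \<beta> - 2) * I + \<kappa> powr (- (\<beta> * (p - 2))) * R powr r) +
        c2 * (l powr q * H + l powr (- (q / (q - 1))) * R powr r)) \<longrightarrow>
     R \<le> K * (sqrt I + H powr (1 / q)))"
    using Moser_absorb[OF c \<beta> p q(1) r r'] ..
  note K = KA[THEN conjunct1] and absorb = KA[THEN conjunct2, rule_format]
  have main: "integrable lborel (\<lambda>x. \<bar>u x\<bar> powr r) \<and>
     (\<integral>x. \<bar>u x\<bar> powr r \<partial>lborel) powr (1 / r) \<le>
       K * (sqrt (\<integral>x. (u x)\<^sup>2 \<partial>lborel) + (\<integral>x. h x powr q \<partial>lborel) powr (1 / q))"
    if EC: "energy_class \<Omega> \<delta> L u g h" and ih: "integrable lborel (\<lambda>x. h x powr q)"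
    for \<Omega> and u :: "'a \<Rightarrow> real" and g h
  proof -
    have H: "H0 \<Omega> u g" and sh: "sq_int lborel h" and h0: "h x \<ge> 0" for x
      using EC by (auto simp: energy_class_def)
    have su: "sq_int lborel u" and [measurable]: "u \<in> borel_measurable borel" "g \<in> borel_measurable borel"
      using H by (auto simp: H0_def)
    define I where "I = (\<integral>x. (u x)\<^sup>2 \<partial>lborel)"
    define Hq where "Hq = (\<integral>x. h x powr q \<partial>lborel)"
    have IH: "I \<ge> 0" "Hq \<ge> 0" by (auto simp: I_def Hq_def)
    have iu: "integrable lborel (\<lambda>x. (u x)\<^sup>2)" using su by (simp add: sq_int_def)
    define m where "m = K * (sqrt I + Hq powr (1 / q))"
    have m0: "m \<ge> 0" using K IH by (simp add: m_def)
    define W where "W N x = \<bar>u x\<bar> * min \<bar>u x\<bar> N powr (\<beta> - 1)" for N x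
    \<comment> \<open>For fixed N the derivative w is bounded, so F(u) is in \<open>H0\<close> and
      the integral is finite, as absorption requires; m does not depend on N.\<close>
    have bound: "(\<integral>\<^sup>+x. ennreal (W N x powr p) \<partial>lborel) \<le> ennreal (m powr r)" if N: "N > 0" for N
    proof -
      define w where "w = (\<lambda>s::real. min \<bar>s\<bar> N powr (\<beta> - 1))"
      obtain F G where FG: "\<And>s. (F has_real_derivative w s) (at s)" "\<And>s. (G has_real_derivative (w s)\<^sup>2) (at s)"
        "F 0 = 0" "G 0 = 0" "continuous_on UNIV w" "\<And>s. 0 \<le> w s" "\<And>s. w s \<le> N powr (\<beta> - 1)"
        "\<And>s. \<bar>G s\<bar> \<le> (w s)\<^sup>2 * \<bar>s\<bar>" "\<And>s. \<bar>s\<bar> * w s \<le> 2 powr \<beta> * \<bar>F s\<bar>"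
        unfolding w_def by (rule truncated_power_functions[OF N \<beta>]) blast
      have Ww: "W N x = \<bar>u x\<bar> * w (u x)" for x by (simp add: W_def w_def)
      have W0: "W N x \<ge> 0" for x by (simp add: W_def)
      have [measurable]: "w \<in> borel_measurable borel" using FG(5) by (rule borel_measurable_continuous_onI)
      have [measurable]: "W N \<in> borel_measurable borel" unfolding W_def[abs_def] by measurable
      have HF: "H0 \<Omega> (\<lambda>x. F (u x)) (\<lambda>x. w (u x) *\<^sub>R g x)"
        by (rule H0_chain[OF H FG(1,5) _ FG(3), of "N powr (\<beta> - 1)"]) (use FG(6,7) in auto)
      define E where "E = (\<integral>x. (w (u x))\<^sup>2 * (norm (g x))\<^sup>2 \<partial>lborel)"
      have E_eq: "E = (\<integral>x. (norm (w (u x) *\<^sub>R g x))\<^sup>2 \<partial>lborel)" by (simp add: E_def power_mult_distrib)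
      have E0: "E \<ge> 0" by (simp add: E_def)
      have SF: "integrable lborel (\<lambda>x. \<bar>F (u x)\<bar> powr p)" "(\<integral>x. \<bar>F (u x)\<bar> powr p \<partial>lborel) \<le> CS * E powr (p / 2)"
        using Sob[OF HF] unfolding E_eq by auto
      have WF: "W N x powr p \<le> 2 powr (\<beta> * p) * \<bar>F (u x)\<bar> powr p" for x
      proof -
        have "W N x powr p \<le> (2 powr \<beta> * \<bar>F (u x)\<bar>) powr p"
          using FG(9)[of "u x"] p W0 by (intro powr_mono2) (auto simp: Ww)
        then show ?thesis by (simp add: powr_mult powr_powr)
      qed
      have iW: "integrable lborel (\<lambda>x. W N x powr p)"
      proof (rule Bochner_Integration.integrable_bound)
        show "integrable lborel (\<lambda>x. 2 powr (\<beta> * p) * \<bar>F (u x)\<bar> powr p)" using SF(1) by simp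
        show "AE x in lborel. norm (W N x powr p) \<le> norm (2 powr (\<beta> * p) * \<bar>F (u x)\<bar> powr p)"
          using WF by (intro AE_I2) (simp add: abs_mult)
      qed measurable
      define Y where "Y = (\<integral>x. W N x powr p \<partial>lborel)"
      have Y0: "Y \<ge> 0" by (simp add: Y_def)
      have "Y \<le> (\<integral>x. 2 powr (\<beta> * p) * \<bar>F (u x)\<bar> powr p \<partial>lborel)"
        unfolding Y_def using SF(1) by (intro integral_mono iW WF) simp
      also have "\<dots> \<le> 2 powr (\<beta> * p) * (CS * E powr (p / 2))"
        using SF(2) by (simp add: mult_left_mono)
      finally have "Y powr (2 / p) \<le> (2 powr (\<beta> * p) * (CS * E powr (p / 2))) powr (2 / p)"
        using Y0 p by (intro powr_mono2) auto
      also have "\<dots> = C2 * E" using p E0 CS by (simp add: C2_def powr_mult powr_powr mult.assoc)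
      finally have YE: "Y powr (2 / p) \<le> C2 * E" .
      have Ele: "E \<le> (2 * \<delta> + L\<^sup>2) * (\<kappa> powr (2 * \<beta> - 2) * I + \<kappa> powr (- (\<beta> * (p - 2))) * Y) +
          2 * (l powr q * Hq + l powr (- (q / (q - 1))) * Y)" if \<kappa>: "\<kappa> > 0" and l: "l > 0" for \<kappa> l
      proof -
        let ?R = "\<lambda>x. (2 * \<delta> + L\<^sup>2) * (\<kappa> powr (2 * \<beta> - 2) * (u x)\<^sup>2 + \<kappa> powr (- (\<beta> * (p - 2))) * W N x powr p) +
          2 * (l powr q * h x powr q + l powr (- (q / (q - 1))) * W N x powr p)"
        have iR: "integrable lborel ?R" using iu iW ih
          by (intro Bochner_Integration.integrable_add integrable_mult_right)
        have "E \<le> (\<integral>x. (w (u x))\<^sup>2 * \<bar>u x\<bar> * (2 * \<delta> * \<bar>u x\<bar> + L\<^sup>2 * \<bar>u x\<bar> + 2 * h x) \<partial>lborel)"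
        proof -
          have "continuous_on UNIV (\<lambda>s. (w s)\<^sup>2)" by (intro continuous_intros FG(5))
          moreover have "(w s)\<^sup>2 \<le> (N powr (\<beta> - 1))\<^sup>2" for s using FG(6,7) by (intro power_mono)
          moreover have "continuous_on UNIV (\<lambda>s::real. \<bar>s\<bar>)" by (intro continuous_intros)
          ultimately show ?thesis unfolding E_def
            using EC[unfolded energy_class_def, THEN conjunct2, THEN conjunct2, THEN conjunct2, THEN conjunct2,
              rule_format, of G "\<lambda>s. (w s)\<^sup>2" "(N powr (\<beta> - 1))\<^sup>2" abs] FG(2,4,8) by simp
        qed
        also have "\<dots> \<le> (\<integral>x. ?R x \<partial>lborel)"
        proof (rule Bochner_Integration.integral_mono'[OF iR])
          fix x
          show "0 \<le> ?R x" using \<delta> by simp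
          have "(w (u x))\<^sup>2 * \<bar>u x\<bar> * (2 * \<delta> * \<bar>u x\<bar> + L\<^sup>2 * \<bar>u x\<bar> + 2 * h x) =
             (2 * \<delta> + L\<^sup>2) * (W N x)\<^sup>2 + 2 * (h x * (\<bar>u x\<bar> * (w (u x))\<^sup>2))"
            by (simp add: Ww power2_eq_square algebra_simps)
          also have "\<dots> \<le> ?R x"
          proof (intro add_mono mult_left_mono)
            show "(W N x)\<^sup>2 \<le> \<kappa> powr (2 * \<beta> - 2) * (u x)\<^sup>2 + \<kappa> powr (- (\<beta> * (p - 2))) * W N x powr p"
              using truncated_power_sq_le[OF _ N \<beta> p \<kappa>, of "\<bar>u x\<bar>"] by (simp add: W_def)
            let ?V = "W N x powr ((2 * \<beta> - 1) / \<beta>)"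
            have "h x * (\<bar>u x\<bar> * (w (u x))\<^sup>2) \<le> h x * ?V"
              using truncated_power_le[OF _ N \<beta>, of "\<bar>u x\<bar>"] h0 by (intro mult_left_mono) (simp_all add: W_def w_def)
            also have "\<dots> = (l * h x) * (?V / l)" using l by simp
            also have "\<dots> \<le> (l * h x) powr q + (?V / l) powr (q / (q - 1))"
              using l h0 q by (intro Young_crude) auto
            also have "(?V / l) powr (q / (q - 1)) = l powr (- (q / (q - 1))) * W N x powr p"
            proof -
              \<comment> \<open>Here the choice of \<beta> enters: the conjugate power of
                \<open>?V\<close> is exactly W^p, the quantity to be absorbed.\<close>
              have "(2 * \<beta> - 1) / \<beta> * (q / (q - 1)) = ((2 * \<beta> - 1) * q) / (\<beta> * (q - 1))" by simp
              also have "\<dots> = p" unfolding r'[symmetric] r using \<beta> q by simp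
              finally have "?V powr (q / (q - 1)) = W N x powr p" unfolding powr_powr by simp
              moreover have "(?V / l) powr (q / (q - 1)) = ?V powr (q / (q - 1)) / l powr (q / (q - 1))"
                by (rule powr_divide)
              ultimately show ?thesis by (simp only: powr_minus divide_inverse mult.commute)
            qed
            also have "(l * h x) powr q = l powr q * h x powr q" using l h0 by (simp add: powr_mult)
            finally show "h x * (\<bar>u x\<bar> * (w (u x))\<^sup>2) \<le> l powr q * h x powr q + l powr (- (q / (q - 1))) * W N x powr p" .
          qed (use \<delta> in auto)
          finally show "(w (u x))\<^sup>2 * \<bar>u x\<bar> * (2 * \<delta> * \<bar>u x\<bar> + L\<^sup>2 * \<bar>u x\<bar> + 2 * h x) \<le> ?R x" .
        qed
        also have "\<dots> = (2 * \<delta> + L\<^sup>2) * (\<kappa> powr (2 * \<beta> - 2) * I + \<kappa> powr (- (\<beta> * (p - 2))) * Y) +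
          2 * (l powr q * Hq + l powr (- (q / (q - 1))) * Y)"
          using iu iW ih by (simp add: I_def Hq_def Y_def)
        finally show ?thesis .
      qed
      have "Y \<le> m powr r"
      proof (cases "Y = 0")
        case False
        \<comment> \<open>Y plays the role of the integral of |u|^r, so R is the corresponding norm;
          Y = 0 is treated apart because \<open>absorb\<close> needs R > 0.\<close>
        define R where "R = Y powr (1 / r)"
        have R: "R > 0" using False Y0 by (simp add: R_def)
        have RY: "R powr r = Y" using Y0 r0 by (simp add: R_def powr_powr)
        have "R \<le> K * (sqrt I + Hq powr (1 / q))"
        proof (rule absorb[OF R IH])
          fix \<kappa> l :: real assume "\<kappa> > 0" "l > 0"
          have "R powr (2 * \<beta>) = Y powr (2 / p)"
          proof -
            have "1 / r * (2 * \<beta>) = 2 / p" using \<beta> by (simp add: r)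
            then show ?thesis unfolding R_def powr_powr by simp
          qed
          also have "\<dots> \<le> C2 * E" by (rule YE)
          also have "\<dots> \<le> C2 * ((2 * \<delta> + L\<^sup>2) * (\<kappa> powr (2 * \<beta> - 2) * I + \<kappa> powr (- (\<beta> * (p - 2))) * Y) +
             2 * (l powr q * Hq + l powr (- (q / (q - 1))) * Y))"
            using C2 by (intro mult_left_mono Ele \<open>\<kappa> > 0\<close> \<open>l > 0\<close>) auto
          also have "\<dots> = c1 * (\<kappa> powr (2 * \<beta> - 2) * I + \<kappa> powr (- (\<beta> * (p - 2))) * R powr r) +
            c2 * (l powr q * Hq + l powr (- (q / (q - 1))) * R powr r)"
          proof -
            have "C2 * (a * P + 2 * Q) = C2 * a * P + C2 * 2 * Q" for a P Q :: real
              by (simp add: algebra_simps)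
            then show ?thesis unfolding RY c1_def c2_def .
          qed
          finally show "R powr (2 * \<beta>) \<le> \<dots>" .
        qed
        then have "R powr r \<le> m powr r" using R r0 unfolding m_def by (intro powr_mono2) auto
        then show ?thesis by (simp add: RY)
      qed simp
      then show ?thesis
        unfolding Y_def using iW by (subst nn_integral_eq_integral) (auto intro: ennreal_leI)
    qed
    \<comment> \<open>At a fixed x the truncation is inactive as soon as N \<ge> |u x|, and there W
      = |u x|^\<beta>.\<close>
    have lim: "(\<lambda>n. W (real (Suc n)) x powr p) \<longlonglongrightarrow> \<bar>u x\<bar> powr r" for x
    proof (rule tendsto_eventually)
      obtain n0 :: nat where n0: "\<bar>u x\<bar> \<le> real n0" using real_arch_simple by blast
      have "W (real (Suc n)) x powr p = \<bar>u x\<bar> powr r" if "n \<ge> n0" for n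
      proof -
        have "min \<bar>u x\<bar> (real (Suc n)) = \<bar>u x\<bar>" using n0 that by simp
        then have "W (real (Suc n)) x = \<bar>u x\<bar> * \<bar>u x\<bar> powr (\<beta> - 1)" by (simp only: W_def)
        also have "\<dots> = \<bar>u x\<bar> powr \<beta>" by (cases "u x = 0") (auto simp: powr_diff)
        finally show ?thesis by (simp add: powr_powr r)
      qed
      then show "\<forall>\<^sub>F n in sequentially. W (real (Suc n)) x powr p = \<bar>u x\<bar> powr r"
        using eventually_sequentially by blast
    qed
    have [measurable]: "W N \<in> borel_measurable borel" for N unfolding W_def[abs_def] by measurable
    have "(\<integral>\<^sup>+x. ennreal (\<bar>u x\<bar> powr r) \<partial>lborel) = (\<integral>\<^sup>+x. liminf (\<lambda>n. ennreal (W (real (Suc n)) x powr p)) \<partial>lborel)"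
      by (intro nn_integral_cong lim_imp_Liminf[symmetric] tendsto_ennrealI lim) simp
    also have "\<dots> \<le> liminf (\<lambda>n. \<integral>\<^sup>+x. ennreal (W (real (Suc n)) x powr p) \<partial>lborel)"
      by (rule nn_integral_liminf) measurable
    also have "\<dots> \<le> liminf (\<lambda>n::nat. ennreal (m powr r))"
      by (intro Liminf_mono always_eventually allI bound) simp
    also have "\<dots> = ennreal (m powr r)" by (intro lim_imp_Liminf) auto
    finally have le: "(\<integral>\<^sup>+x. ennreal (\<bar>u x\<bar> powr r) \<partial>lborel) \<le> ennreal (m powr r)" .
    have i: "integrable lborel (\<lambda>x. \<bar>u x\<bar> powr r)"
      by (rule integrableI_nonneg) (use le in \<open>auto simp: less_top[symmetric] top_unique\<close>)
    have "ennreal (\<integral>x. \<bar>u x\<bar> powr r \<partial>lborel) \<le> ennreal (m powr r)"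
      using le by (subst (asm) nn_integral_eq_integral[OF i]) auto
    then have "(\<integral>x. \<bar>u x\<bar> powr r \<partial>lborel) \<le> m powr r" by (subst (asm) ennreal_le_iff) auto
    then have "(\<integral>x. \<bar>u x\<bar> powr r \<partial>lborel) powr (1 / r) \<le> (m powr r) powr (1 / r)"
      using r0 by (intro powr_mono2) auto
    also have "\<dots> = m" using m0 r0 by (simp add: powr_powr)
    finally show ?thesis using i by (simp add: m_def I_def Hq_def)
  qed
  show ?thesis using main K by blast
qed


section \<open>Reduction to Borel functions on the whole space\<close>

text \<open>Each coordinate of the extension by zero is Lebesgue measurable, hence almost everywhere
  equal to a Borel function. Borel representatives are wanted since translations and Tonelli's
  theorem are applied in \<open>lborel\<close>.\<close>

lemma borel_representative:
  fixes v :: "'a::euclidean_space \<Rightarrow> 'b::euclidean_space"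
  assumes v: "v \<in> borel_measurable (lebesgue_on \<Omega>)" and \<Omega>: "\<Omega> \<in> sets lebesgue"
  obtains V where "V \<in> borel_measurable borel" "AE x in lborel. V x = (if x \<in> \<Omega> then v x else 0)"
proof -
  have m: "(\<lambda>x. (if x \<in> \<Omega> then v x else 0) \<bullet> b) \<in> borel_measurable (completion lborel)" for b
    using borel_measurable_if_I[OF v \<Omega>] by (intro borel_measurable_inner) auto
  have "\<forall>b. \<exists>V. V \<in> borel_measurable lborel \<and> (AE x in lborel. (if x \<in> \<Omega> then v x else 0) \<bullet> b = V x)"
    using completion_ex_borel_measurable_real[OF m] by (simp only: Bex_def) simp
  from choice[OF this] obtain V where V': "\<forall>b. V b \<in> borel_measurable lborel \<and>
      (AE x in lborel. (if x \<in> \<Omega> then v x else 0) \<bullet> b = V b x)" ..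
  then have V: "\<And>b. V b \<in> borel_measurable lborel"
      "\<And>b. AE x in lborel. (if x \<in> \<Omega> then v x else 0) \<bullet> b = V b x"
    by simp_all
  show ?thesis
  proof (rule that)
    show "(\<lambda>x. \<Sum>b\<in>Basis. V b x *\<^sub>R b) \<in> borel_measurable borel"
      using V(1) by (intro borel_measurable_sum borel_measurable_scaleR) auto
    have "AE x in lborel. \<forall>b\<in>Basis. (if x \<in> \<Omega> then v x else 0) \<bullet> b = V b x"
      using V(2) by (intro AE_finite_allI) auto
    then show "AE x in lborel. (\<Sum>b\<in>Basis. V b x *\<^sub>R b) = (if x \<in> \<Omega> then v x else 0)"
    proof eventually_elim
      case (elim x)
      then have "(\<Sum>b\<in>Basis. V b x *\<^sub>R b) = (\<Sum>b\<in>Basis. ((if x \<in> \<Omega> then v x else 0) \<bullet> b) *\<^sub>R b)"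
        by (intro sum.cong) auto
      then show ?case by (simp only: euclidean_representation)
    qed
  qed
qed

lemma integral_representative:
  fixes V :: "'a::euclidean_space \<Rightarrow> real"
  assumes V: "V \<in> borel_measurable borel" and q: "q \<in> borel_measurable (lebesgue_on \<Omega>)" and \<Omega>: "\<Omega> \<in> sets lebesgue"
    and ae: "AE x in lborel. V x = (if x \<in> \<Omega> then q x else 0)"
  shows "integrable lborel V \<longleftrightarrow> integrable (lebesgue_on \<Omega>) q"
    "(\<integral>x. V x \<partial>lborel) = (\<integral>x. q x \<partial>lebesgue_on \<Omega>)"
proof -
  let ?q = "\<lambda>x. if x \<in> \<Omega> then q x else 0"
  have V': "V \<in> borel_measurable lborel" using V by simp
  have m: "?q \<in> borel_measurable lebesgue" "V \<in> borel_measurable lebesgue"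
    using borel_measurable_if_I[OF q \<Omega>] measurable_completion[OF V'] by auto
  have ae': "AE x in lebesgue. V x = ?q x" using ae by (rule AE_completion)
  have "integrable lborel V \<longleftrightarrow> integrable lebesgue V" by (rule integrable_completion[OF V', symmetric])
  also have "\<dots> \<longleftrightarrow> integrable lebesgue ?q" by (rule integrable_cong_AE[OF m(2,1) ae'])
  also have "\<dots> \<longleftrightarrow> integrable (lebesgue_on \<Omega>) q" by (rule Lebesgue_Measure.integrable_restrict_UNIV[OF \<Omega>])
  finally show "integrable lborel V \<longleftrightarrow> integrable (lebesgue_on \<Omega>) q" .
  have "(\<integral>x. V x \<partial>lborel) = (\<integral>x. V x \<partial>lebesgue)" by (rule integral_completion[OF V', symmetric])
  also have "\<dots> = (\<integral>x. ?q x \<partial>lebesgue)" by (rule integral_cong_AE[OF m(2,1) ae'])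
  also have "\<dots> = (\<integral>x. q x \<partial>lebesgue_on \<Omega>)" by (rule Lebesgue_Measure.integral_restrict_UNIV[OF \<Omega>])
  finally show "(\<integral>x. V x \<partial>lborel) = (\<integral>x. q x \<partial>lebesgue_on \<Omega>)" .
qed

lemma AE_lebesgue_on_iff:
  assumes "\<Omega> \<in> sets lebesgue"
  shows "(AE x in lebesgue_on \<Omega>. P x) \<longleftrightarrow> (AE x in lborel. x \<in> \<Omega> \<longrightarrow> P x)"
  using assms by (subst AE_restrict_space_iff) (auto simp: AE_completion_iff)

text \<open>When the truncated value \<open>\<sigma>\<close> vanishes, the growth condition carries no information and
  the bound is recovered from small values of the same sign by continuity.\<close>
lemma growth_signed:
  fixes F :: "real \<Rightarrow> 'a::euclidean_space \<Rightarrow> real"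
  assumes c: "continuous_on UNIV (\<lambda>(s, \<xi>). F s \<xi>)"
    and growth: "\<And>s \<xi>. F s \<xi> * s \<le> \<delta> * s\<^sup>2 + L * norm \<xi> * \<bar>s\<bar> + h * \<bar>s\<bar>"
    and e: "\<bar>e\<bar> = 1" "\<sigma> = e * \<bar>\<sigma>\<bar>"
  shows "F \<sigma> \<xi> * e \<le> \<delta> * \<bar>\<sigma>\<bar> + L * norm \<xi> + h"
proof -
  have pos: "F (e * r) \<xi> * e \<le> \<delta> * r + L * norm \<xi> + h" if r: "r > 0" for r
  proof -
    have a: "\<bar>e * r\<bar> = r" using e(1) r by (simp add: abs_mult)
    have "(e * r)\<^sup>2 = r\<^sup>2" using a by (metis power2_abs)
    then have "F (e * r) \<xi> * (e * r) \<le> \<delta> * r\<^sup>2 + L * norm \<xi> * r + h * r"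
      using growth[of "e * r" \<xi>] by (simp only: a)
    then have "(F (e * r) \<xi> * e) * r \<le> (\<delta> * r + L * norm \<xi> + h) * r"
      by (simp add: algebra_simps power2_eq_square)
    then show ?thesis using r by (simp only: mult_le_cancel_right_pos)
  qed
  show ?thesis
  proof (cases "\<sigma> = 0")
    case False
    then show ?thesis using pos[of "\<bar>\<sigma>\<bar>"] e(2) by simp
  next
    case True
    define s where "s n = inverse (real (Suc n))" for n
    have s: "s \<longlonglongrightarrow> 0" unfolding s_def by (rule LIMSEQ_inverse_real_of_nat)
    have "(\<lambda>n. (\<lambda>(s, \<xi>). F s \<xi>) (e * s n, \<xi>)) \<longlonglongrightarrow> (\<lambda>(s, \<xi>). F s \<xi>) (e * 0, \<xi>)"
    proof (rule continuous_on_tendsto_compose[OF c])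
      show "(\<lambda>n. (e * s n, \<xi>)) \<longlonglongrightarrow> (e * 0, \<xi>)"
        by (intro tendsto_Pair tendsto_mult s tendsto_const)
    qed auto
    then have "(\<lambda>n. F (e * s n) \<xi> * e) \<longlonglongrightarrow> F 0 \<xi> * e" by (intro tendsto_intros) simp
    moreover have "(\<lambda>n. \<delta> * s n + L * norm \<xi> + h) \<longlonglongrightarrow> \<delta> * 0 + L * norm \<xi> + h"
      by (intro tendsto_intros s)
    moreover have "F (e * s n) \<xi> * e \<le> \<delta> * s n + L * norm \<xi> + h" for n
      by (rule pos) (simp add: s_def)
    ultimately have "F 0 \<xi> * e \<le> \<delta> * 0 + L * norm \<xi> + h" by (intro LIMSEQ_le) auto
    then show ?thesis using True by simp
  qed
qed

text \<open>As v0 \<le> 0 \<le> v1, the truncated value \<sigma> has the sign of s or is 0, and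
  |\<sigma>| \<le> |s|. It can be 0 with s nonzero, which is why \<open>growth_signed\<close> takes
  the sign e separately instead of the sign of \<sigma>.\<close>

lemma b_sigma_signed:
  fixes f :: "'a::euclidean_space \<Rightarrow> real \<Rightarrow> 'a \<Rightarrow> real"
  assumes c: "continuous_on UNIV (\<lambda>(s, \<xi>). f x s \<xi>)"
    and growth: "\<And>s \<xi>. f x s \<xi> * s \<le> \<delta> * s\<^sup>2 + L * norm \<xi> * \<bar>s\<bar> + h * \<bar>s\<bar>"
    and v: "v0 x \<le> 0" "0 \<le> v1 x" and nn: "\<mu> \<ge> 0" "\<delta> \<ge> 0" "L \<ge> 0" "h \<ge> 0"
  shows "b_sigma f \<mu> v0 v1 x s \<xi> * sgn s \<le> (\<delta> + \<mu>) * \<bar>s\<bar> + L * norm \<xi> + h"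
proof (cases "s = 0")
  case False
  define \<sigma> where "\<sigma> = trunc v0 v1 x s"
  have e: "\<bar>sgn s\<bar> = 1" using False by (simp add: sgn_if)
  have \<sigma>: "\<sigma> = sgn s * \<bar>\<sigma>\<bar>" "\<bar>\<sigma>\<bar> \<le> \<bar>s\<bar>" using v False by (auto simp: \<sigma>_def trunc_def sgn_if max_def min_def)
  have "f x \<sigma> \<xi> * sgn s \<le> \<delta> * \<bar>\<sigma>\<bar> + L * norm \<xi> + h"
    by (rule growth_signed[OF c growth e \<sigma>(1)])
  moreover have "\<sigma> * sgn s = \<bar>\<sigma>\<bar>"
  proof -
    have "\<sigma> * sgn s = (sgn s * \<bar>\<sigma>\<bar>) * sgn s" by (rule arg_cong[OF \<sigma>(1), of "\<lambda>z. z * sgn s"])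
    also have "\<dots> = (sgn s * sgn s) * \<bar>\<sigma>\<bar>" by (simp only: mult_ac)
    also have "sgn s * sgn s = 1" using False by (simp add: sgn_if)
    finally show ?thesis by simp
  qed
  then have "\<mu> * \<sigma> * sgn s = \<mu> * \<bar>\<sigma>\<bar>" by simp
  ultimately have "b_sigma f \<mu> v0 v1 x s \<xi> * sgn s \<le> (\<delta> + \<mu>) * \<bar>\<sigma>\<bar> + L * norm \<xi> + h"
    unfolding b_sigma_def \<sigma>_def[symmetric] distrib_right by linarith
  also have "\<dots> \<le> (\<delta> + \<mu>) * \<bar>s\<bar> + L * norm \<xi> + h"
    using \<sigma>(2) nn by (intro add_right_mono mult_left_mono) auto
  finally show ?thesis .
qed (use nn in auto)

text \<open>Test functions and their gradients vanish outside \<Omega>, so each integral of the weak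
  formulation equals the integral over the whole space of the representatives.\<close>

lemma weak_sol_energy_class:
  fixes u :: "'a::euclidean_space \<Rightarrow> real"
  assumes \<Omega>: "open \<Omega>" and car: "carath \<Omega> f" and h0: "\<forall>x\<in>\<Omega>. h x \<ge> 0" and h2: "Lp_space 2 \<Omega> h"
    and growth: "\<forall>x\<in>\<Omega>. \<forall>s \<xi>. f x s \<xi> * s \<le> \<delta> * s\<^sup>2 + L * norm \<xi> * \<bar>s\<bar> + h x * \<bar>s\<bar>"
    and \<mu>: "\<mu> \<ge> 0" and t: "0 < t" "t \<le> 1" and \<omega>: "open \<omega>" "\<omega> \<subseteq> \<Omega>"
    and v: "\<forall>x\<in>\<Omega>. v0 x \<le> 0 \<and> 0 \<le> v1 x" and nn: "\<delta> \<ge> 0" "L \<ge> 0"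
    and sol: "weak_sol \<Omega> f \<mu> t \<omega> v0 v1 u"
  obtains U G H where "energy_class \<Omega> \<delta> L U G H"
    "AE x in lborel. U x = (if x \<in> \<Omega> then u x else 0)" "AE x in lborel. H x = (if x \<in> \<Omega> then h x else 0)"
    "u \<in> borel_measurable (lebesgue_on \<Omega>)"
proof -
  define b where "b g x = b_sigma f \<mu> v0 v1 x (u x) (g x)" for g x
  obtain g where H10: "H10 \<Omega> u g" and b2: "L2 \<Omega> (\<lambda>x. b g x * indicator \<omega> x)" and
    weak: "\<And>\<phi>. test_fun \<Omega> \<phi> \<Longrightarrow>
        (\<integral>x. g x \<bullet> cgrad \<phi> x \<partial>lebesgue_on \<Omega>) + \<mu> * (\<integral>x. u x * \<phi> x \<partial>lebesgue_on \<Omega>)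
        = t * (\<integral>x. b g x * \<phi> x \<partial>lebesgue_on \<omega>)"
    using sol unfolding weak_sol_def b_def by blast
  have S: "\<Omega> \<in> sets lebesgue" "\<omega> \<in> sets lebesgue" using \<Omega> \<omega> by auto
  have um: "u \<in> borel_measurable (lebesgue_on \<Omega>)" "integrable (lebesgue_on \<Omega>) (\<lambda>x. (u x)\<^sup>2)"
    and gm: "g \<in> borel_measurable (lebesgue_on \<Omega>)" "integrable (lebesgue_on \<Omega>) (\<lambda>x. (norm (g x))\<^sup>2)"
    using H10 by (auto simp: H10_def L2_def)
  have bm: "(\<lambda>x. b g x * indicator \<omega> x) \<in> borel_measurable (lebesgue_on \<Omega>)"
    "integrable (lebesgue_on \<Omega>) (\<lambda>x. (b g x * indicator \<omega> x)\<^sup>2)"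
    using b2 by (auto simp: L2_def)
  have hm: "h \<in> borel_measurable (lebesgue_on \<Omega>)" using h2 by (simp add: Lp_space_def)
  have "integrable (lebesgue_on \<Omega>) (\<lambda>x. \<bar>h x\<bar> powr 2)"
    using h2 by (simp add: Lp_space_def)
  moreover have "\<bar>r\<bar> powr 2 = r\<^sup>2" for r :: real by (cases "r = 0") (auto simp: powr_numeral)
  ultimately have hi: "integrable (lebesgue_on \<Omega>) (\<lambda>x. (h x)\<^sup>2)" by simp
  obtain U where U: "U \<in> borel_measurable borel" "AE x in lborel. U x = (if x \<in> \<Omega> then u x else 0)"
    by (rule borel_representative[OF um(1) S(1)])
  obtain G where G: "G \<in> borel_measurable borel" "AE x in lborel. G x = (if x \<in> \<Omega> then g x else 0)"
    by (rule borel_representative[OF gm(1) S(1)])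
  obtain B where B: "B \<in> borel_measurable borel" "AE x in lborel. B x = (if x \<in> \<Omega> then b g x * indicator \<omega> x else 0)"
    by (rule borel_representative[OF bm(1) S(1)])
  obtain H' where H': "H' \<in> borel_measurable borel" "AE x in lborel. H' x = (if x \<in> \<Omega> then h x else 0)"
    by (rule borel_representative[OF hm S(1)])
  \<comment> \<open>\<open>energy_class\<close> asks for h \<ge> 0 at every point, while the
    representative is nonnegative only almost everywhere.\<close>
  define H where "H x = max 0 (H' x)" for x
  have H: "H \<in> borel_measurable borel" "AE x in lborel. H x = (if x \<in> \<Omega> then h x else 0)"
  proof -
    show "H \<in> borel_measurable borel" unfolding H_def[abs_def] using H'(1) by measurable
    show "AE x in lborel. H x = (if x \<in> \<Omega> then h x else 0)"
      using H'(2) by eventually_elim (use h0 in \<open>auto simp: H_def\<close>)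
  qed
  have sqU: "sq_int lborel U"
    unfolding sq_int_def using U um
    by (subst integral_representative(1)[where \<Omega> = \<Omega> and q = "\<lambda>x. (u x)\<^sup>2"]) (auto simp: S)
  have sqG: "sq_int lborel G"
    unfolding sq_int_def using G gm
    by (subst integral_representative(1)[where \<Omega> = \<Omega> and q = "\<lambda>x. (norm (g x))\<^sup>2"]) (auto simp: S)
  have sqB: "sq_int lborel B"
    unfolding sq_int_def using B bm
    by (subst integral_representative(1)[where \<Omega> = \<Omega> and q = "\<lambda>x. (b g x * indicator \<omega> x)\<^sup>2"]) (auto simp: S)
  have sqH: "sq_int lborel H"
    unfolding sq_int_def using H hm hi
    by (subst integral_representative(1)[where \<Omega> = \<Omega> and q = "\<lambda>x. (h x)\<^sup>2"]) (auto simp: S)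
  have tf: "\<phi> \<in> borel_measurable (lebesgue_on \<Omega>)" "cgrad \<phi> \<in> borel_measurable (lebesgue_on \<Omega>)"
    "\<phi> \<in> borel_measurable borel" "cgrad \<phi> \<in> borel_measurable borel"
    "\<And>x. x \<notin> \<Omega> \<Longrightarrow> \<phi> x = 0 \<and> cgrad \<phi> x = 0" if "test_fun \<Omega> \<phi>" for \<phi>
  proof -
    show m: "\<phi> \<in> borel_measurable borel" "cgrad \<phi> \<in> borel_measurable borel" by (rule test_fun_borel[OF that])+
    show "\<phi> \<in> borel_measurable (lebesgue_on \<Omega>)" "cgrad \<phi> \<in> borel_measurable (lebesgue_on \<Omega>)"
      using m by (auto intro!: measurable_restrict_space1 measurable_completion)
    show "\<phi> x = 0 \<and> cgrad \<phi> x = 0" if "x \<notin> \<Omega>" for x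
      using test_fun_outside[OF \<open>test_fun \<Omega> \<phi>\<close>, of x] that \<open>test_fun \<Omega> \<phi>\<close> by (auto simp: test_fun_def)
  qed
  obtain \<phi> where \<phi>: "\<And>n::nat. test_fun \<Omega> (\<phi> n)"
    "(\<lambda>n. \<integral>x. (u x - \<phi> n x)\<^sup>2 \<partial>lebesgue_on \<Omega>) \<longlonglongrightarrow> 0"
    "(\<lambda>n. \<integral>x. (norm (g x - cgrad (\<phi> n) x))\<^sup>2 \<partial>lebesgue_on \<Omega>) \<longlonglongrightarrow> 0"
    using H10 unfolding H10_def by blast
  have H0: "H0 \<Omega> U G"
    unfolding H0_def
  proof (intro conjI U G sqU sqG exI[of _ \<phi>] allI \<phi>(1))
    have "(\<integral>x. (norm (U x - \<phi> n x))\<^sup>2 \<partial>lborel) = (\<integral>x. (u x - \<phi> n x)\<^sup>2 \<partial>lebesgue_on \<Omega>)" for n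
    proof (rule integral_representative(2)[OF _ _ S(1)])
      show "AE x in lborel. (norm (U x - \<phi> n x))\<^sup>2 = (if x \<in> \<Omega> then (u x - \<phi> n x)\<^sup>2 else 0)"
        using U(2) by eventually_elim (use tf(5)[OF \<phi>(1)] in auto)
    qed (use U um tf[OF \<phi>(1)] in measurable)
    then show "(\<lambda>n. \<integral>x. (norm (U x - \<phi> n x))\<^sup>2 \<partial>lborel) \<longlonglongrightarrow> 0" using \<phi>(2) by simp
    have "(\<integral>x. (norm (G x - cgrad (\<phi> n) x))\<^sup>2 \<partial>lborel) = (\<integral>x. (norm (g x - cgrad (\<phi> n) x))\<^sup>2 \<partial>lebesgue_on \<Omega>)" for n
    proof (rule integral_representative(2)[OF _ _ S(1)])
      show "AE x in lborel. (norm (G x - cgrad (\<phi> n) x))\<^sup>2 = (if x \<in> \<Omega> then (norm (g x - cgrad (\<phi> n) x))\<^sup>2 else 0)"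
        using G(2) by eventually_elim (use tf(5)[OF \<phi>(1)] in auto)
    qed (use G gm tf[OF \<phi>(1)] in measurable)
    then show "(\<lambda>n. \<integral>x. (norm (G x - cgrad (\<phi> n) x))\<^sup>2 \<partial>lborel) \<longlonglongrightarrow> 0" using \<phi>(3) by simp
  qed
  have "energy_class \<Omega> \<delta> L U G H"
  proof (rule weak_solution_energy_class[OF H0 sqB H(1) sqH _ _ _ nn])
    show "0 \<le> H x" for x by (simp add: H_def)
    show "(\<integral>x. G x \<bullet> cgrad \<psi> x \<partial>lborel) + \<mu> * (\<integral>x. U x * \<psi> x \<partial>lborel) = t * (\<integral>x. B x * \<psi> x \<partial>lborel)"
      if \<psi>: "test_fun \<Omega> \<psi>" for \<psi>
    proof -
      note [measurable] = tf(1-4)[OF \<psi>] U(1) G(1) B(1) um(1) gm(1) bm(1)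
      have "(\<integral>x. G x \<bullet> cgrad \<psi> x \<partial>lborel) = (\<integral>x. g x \<bullet> cgrad \<psi> x \<partial>lebesgue_on \<Omega>)"
      proof (rule integral_representative(2)[OF _ _ S(1)])
        show "AE x in lborel. G x \<bullet> cgrad \<psi> x = (if x \<in> \<Omega> then g x \<bullet> cgrad \<psi> x else 0)"
          using G(2) by eventually_elim auto
      qed measurable
      moreover have "(\<integral>x. U x * \<psi> x \<partial>lborel) = (\<integral>x. u x * \<psi> x \<partial>lebesgue_on \<Omega>)"
      proof (rule integral_representative(2)[OF _ _ S(1)])
        show "AE x in lborel. U x * \<psi> x = (if x \<in> \<Omega> then u x * \<psi> x else 0)"
          using U(2) by eventually_elim auto
      qed measurable
      moreover have "(\<integral>x. B x * \<psi> x \<partial>lborel) = (\<integral>x. (b g x * indicator \<omega> x) * \<psi> x \<partial>lebesgue_on \<Omega>)"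
      proof (rule integral_representative(2)[OF _ _ S(1)])
        show "AE x in lborel. B x * \<psi> x = (if x \<in> \<Omega> then b g x * indicator \<omega> x * \<psi> x else 0)"
          using B(2) by eventually_elim auto
      qed measurable
      moreover have "(\<integral>x. (b g x * indicator \<omega> x) * \<psi> x \<partial>lebesgue_on \<Omega>) =
          (\<integral>x. (if x \<in> \<omega> then b g x * \<psi> x else 0) \<partial>lebesgue_on \<Omega>)"
        by (intro Bochner_Integration.integral_cong) auto
      moreover have "\<dots> = (\<integral>x. b g x * \<psi> x \<partial>lebesgue_on \<omega>)"
        by (rule integral_restrict[OF \<omega>(2) S(2,1)])
      ultimately show ?thesis using weak[OF \<psi>] by simp
    qed
    have "AE x in lborel. x \<in> \<Omega> \<longrightarrow> continuous_on UNIV (\<lambda>(s, \<xi>). f x s \<xi>)"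
      using car S by (simp add: carath_def AE_lebesgue_on_iff)
    with U(2) G(2) H(2) B(2) show "AE x in lborel. t * B x * sgn (U x) \<le> (\<delta> + \<mu>) * \<bar>U x\<bar> + L * norm (G x) + H x"
    proof eventually_elim
      case (elim x)
      show ?case
      proof (cases "x \<in> \<Omega>")
        case False
        then show ?thesis using elim by simp
      next
        case True
        let ?R = "(\<delta> + \<mu>) * \<bar>u x\<bar> + L * norm (g x) + h x"
        \<comment> \<open>The factor t and the indicator of \<omega> multiply the left side by
          numbers in [0, 1]; this preserves an upper bound because the bound is nonnegative.\<close>
        have R: "0 \<le> ?R" using True h0 nn \<mu> by simp
        have le: "b g x * sgn (u x) \<le> ?R"
          unfolding b_def using elim True growth v h0 nn \<mu> by (intro b_sigma_signed) auto
        have "t * (b g x * sgn (u x)) \<le> ?R"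
        proof (cases "b g x * sgn (u x) \<le> 0")
          case True
          then have "t * (b g x * sgn (u x)) \<le> 0" using t by (simp add: mult_nonneg_nonpos)
          then show ?thesis using R by simp
        next
          case False
          then have "t * (b g x * sgn (u x)) \<le> 1 * (b g x * sgn (u x))" using t by (intro mult_right_mono) auto
          then show ?thesis using le by simp
        qed
        then have "t * (b g x * indicator \<omega> x) * sgn (u x) \<le> ?R"
          using R by (cases "x \<in> \<omega>") (auto simp: mult.assoc)
        then show ?thesis using elim True by simp
      qed
    qed
  qed
  with U H um that show ?thesis by blast
qed

lemma Lp_norm_representative:
  fixes V :: "'a::euclidean_space \<Rightarrow> real"
  assumes "V \<in> borel_measurable borel" "q \<in> borel_measurable (lebesgue_on \<Omega>)" "\<Omega> \<in> sets lebesgue"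
    and "AE x in lborel. V x = (if x \<in> \<Omega> then q x else 0)"
  shows "Lp_norm (ereal p) \<Omega> q = (\<integral>x. \<bar>V x\<bar> powr p \<partial>lborel) powr (1 / p)"
    "Lp_space (ereal p) \<Omega> q \<longleftrightarrow> integrable lborel (\<lambda>x. \<bar>V x\<bar> powr p)"
proof -
  note [measurable] = assms(1,2)
  have ae: "AE x in lborel. \<bar>V x\<bar> powr p = (if x \<in> \<Omega> then \<bar>q x\<bar> powr p else 0)"
    using assms(4) by eventually_elim auto
  have m: "(\<lambda>x. \<bar>V x\<bar> powr p) \<in> borel_measurable borel"
    "(\<lambda>x. \<bar>q x\<bar> powr p) \<in> borel_measurable (lebesgue_on \<Omega>)" by measurable
  show "Lp_norm (ereal p) \<Omega> q = (\<integral>x. \<bar>V x\<bar> powr p \<partial>lborel) powr (1 / p)"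
    "Lp_space (ereal p) \<Omega> q \<longleftrightarrow> integrable lborel (\<lambda>x. \<bar>V x\<bar> powr p)"
    using integral_representative[OF m assms(3) ae] assms(2) by (simp_all add: Lp_norm_def Lp_space_def)
qed


section \<open>The main theorem\<close>

lemma Lp_norm_2_representative:
  fixes V :: "'a::euclidean_space \<Rightarrow> real"
  assumes "V \<in> borel_measurable borel" "q \<in> borel_measurable (lebesgue_on \<Omega>)" "\<Omega> \<in> sets lebesgue"
    and "AE x in lborel. V x = (if x \<in> \<Omega> then q x else 0)"
  shows "Lp_norm 2 \<Omega> q = sqrt (\<integral>x. (V x)\<^sup>2 \<partial>lborel)"
proof -
  have "\<bar>s\<bar> powr 2 = s\<^sup>2" for s :: real by (cases "s = 0") (auto simp: powr_numeral)
  moreover have "(2 :: ereal) = ereal 2" by simp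
  ultimately show ?thesis using Lp_norm_representative(1)[OF assms, of 2] by (simp add: powr_half_sqrt)
qed

lemma energy_class_bound:
  fixes q \<delta> L :: real
  assumes q: "q \<ge> 2" "q \<noteq> real DIM('a::euclidean_space) / 2" and \<delta>: "\<delta> > 0"
  shows "\<exists>C>0. \<forall>\<Omega> (U :: 'a \<Rightarrow> real) G H u. energy_class \<Omega> \<delta> L U G H \<longrightarrow> integrable lborel (\<lambda>x. H x powr q) \<longrightarrow>
     \<Omega> \<in> sets lebesgue \<longrightarrow> u \<in> borel_measurable (lebesgue_on \<Omega>) \<longrightarrow>
     (AE x in lborel. U x = (if x \<in> \<Omega> then u x else 0)) \<longrightarrow>
     Lp_space (qss DIM('a) q) \<Omega> u \<and>
     Lp_norm (qss DIM('a) q) \<Omega> u \<le> C * (sqrt (\<integral>x. (U x)\<^sup>2 \<partial>lborel) + (\<integral>x. H x powr q \<partial>lborel) powr (1 / q))"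
proof (cases "q < real DIM('a) / 2")
  case True
  define r where "r = q * real DIM('a) / (real DIM('a) - 2 * q)"
  have qss: "qss DIM('a) q = ereal r" using True by (simp add: qss_def r_def)
  obtain C where "C > 0" and C: "\<And>\<Omega> (u :: 'a \<Rightarrow> real) g h.
     energy_class \<Omega> \<delta> L u g h \<Longrightarrow> integrable lborel (\<lambda>x. h x powr q) \<Longrightarrow>
     integrable lborel (\<lambda>x. \<bar>u x\<bar> powr r) \<and>
     (\<integral>x. \<bar>u x\<bar> powr r \<partial>lborel) powr (1 / r) \<le>
       C * (sqrt (\<integral>x. (u x)\<^sup>2 \<partial>lborel) + (\<integral>x. h x powr q \<partial>lborel) powr (1 / q))"
    using Moser_bound[OF q(1) True \<delta>] unfolding r_def by blast
  show ?thesis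
  proof (intro exI[of _ C] conjI[OF \<open>C > 0\<close>] allI impI)
    fix \<Omega> and U :: "'a \<Rightarrow> real" and G H u
    assume EC: "energy_class \<Omega> \<delta> L U G H" and iH: "integrable lborel (\<lambda>x. H x powr q)"
      and S: "\<Omega> \<in> sets lebesgue" and um: "u \<in> borel_measurable (lebesgue_on \<Omega>)"
      and U: "AE x in lborel. U x = (if x \<in> \<Omega> then u x else 0)"
    have "U \<in> borel_measurable borel" using EC by (simp add: energy_class_def H0_def)
    note repr = Lp_norm_representative[OF this um S U, of r]
    show "Lp_space (qss DIM('a) q) \<Omega> u \<and>
     Lp_norm (qss DIM('a) q) \<Omega> u \<le> C * (sqrt (\<integral>x. (U x)\<^sup>2 \<partial>lborel) + (\<integral>x. H x powr q \<partial>lborel) powr (1 / q))"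
      unfolding qss repr by (rule C[OF EC iH])
  qed
next
  case False
  then have q': "q > real DIM('a) / 2" using q(2) by linarith
  have qss: "qss DIM('a) q = \<infinity>" using False by (simp add: qss_def)
  obtain C where "C > 0" and C: "\<And>\<Omega> (u :: 'a \<Rightarrow> real) g h.
     energy_class \<Omega> \<delta> L u g h \<Longrightarrow> integrable lborel (\<lambda>x. h x powr q) \<Longrightarrow>
     (AE x in lborel. \<bar>u x\<bar> \<le> C * (sqrt (\<integral>x. (u x)\<^sup>2 \<partial>lborel) + (\<integral>x. h x powr q \<partial>lborel) powr (1 / q)))"
    using De_Giorgi_bound[OF q(1) q' \<delta>] by blast
  show ?thesis
  proof (intro exI[of _ C] conjI[OF \<open>C > 0\<close>] allI impI)
    fix \<Omega> and U :: "'a \<Rightarrow> real" and G H u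
    assume EC: "energy_class \<Omega> \<delta> L U G H" and iH: "integrable lborel (\<lambda>x. H x powr q)"
      and S: "\<Omega> \<in> sets lebesgue" and um: "u \<in> borel_measurable (lebesgue_on \<Omega>)"
      and U: "AE x in lborel. U x = (if x \<in> \<Omega> then u x else 0)"
    define M where "M = C * (sqrt (\<integral>x. (U x)\<^sup>2 \<partial>lborel) + (\<integral>x. H x powr q \<partial>lborel) powr (1 / q))"
    have "M \<ge> 0" using \<open>C > 0\<close> by (simp add: M_def)
    have "AE x in lborel. x \<in> \<Omega> \<longrightarrow> ereal \<bar>u x\<bar> \<le> ereal M"
      using C[OF EC iH] U by eventually_elim (auto simp: M_def)
    then have "AE x in lebesgue_on \<Omega>. ereal \<bar>u x\<bar> \<le> ereal M" by (simp only: AE_lebesgue_on_iff[OF S])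
    then have le: "esssup (lebesgue_on \<Omega>) (\<lambda>x. ereal \<bar>u x\<bar>) \<le> ereal M"
      using um by (intro esssup_I) auto
    \<comment> \<open>The essential supremum over a null space is \<open>-\<infinity>\<close>, whose real part is 0.\<close>
    have "real_of_ereal (esssup (lebesgue_on \<Omega>) (\<lambda>x. ereal \<bar>u x\<bar>)) \<le> M"
      using le \<open>M \<ge> 0\<close> by (cases "esssup (lebesgue_on \<Omega>) (\<lambda>x. ereal \<bar>u x\<bar>)") auto
    moreover have "esssup (lebesgue_on \<Omega>) (\<lambda>x. ereal \<bar>u x\<bar>) < \<infinity>" using le by (rule le_less_trans) simp
    ultimately show "Lp_space (qss DIM('a) q) \<Omega> u \<and>
     Lp_norm (qss DIM('a) q) \<Omega> u \<le> C * (sqrt (\<integral>x. (U x)\<^sup>2 \<partial>lborel) + (\<integral>x. H x powr q \<partial>lborel) powr (1 / q))"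
      using um unfolding qss Lp_space_def Lp_norm_def M_def by simp
  qed
qed


theorem theorem2p2:
  fixes q \<delta> L :: real
  assumes "q \<ge> 2" and "q \<noteq> real DIM('a::euclidean_space) / 2" and "\<delta> > 0" and "L \<ge> 0"
  shows "\<exists>C>0. \<forall>(\<Omega>::'a set) (f :: 'a \<Rightarrow> real \<Rightarrow> 'a \<Rightarrow> real) (h :: 'a \<Rightarrow> real)
           (\<epsilon>::real) (\<mu>::real) (t::real) (\<omega>::'a set) (v0::'a \<Rightarrow> real) (v1::'a \<Rightarrow> real) (u::'a \<Rightarrow> real).
     open \<Omega> \<and> \<epsilon> > 0 \<and> carath \<Omega> f \<and>
     (\<forall>x\<in>\<Omega>. h x \<ge> 0) \<and> Lp_space 2 \<Omega> h \<and> Lp_space (ereal q) \<Omega> h \<and>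
     (\<forall>x\<in>\<Omega>. \<forall>s \<xi>. f x s \<xi> * s \<le> \<delta> * s\<^sup>2 + L * norm \<xi> * \<bar>s\<bar> + h x * \<bar>s\<bar>) \<and>
     \<mu> \<ge> max 0 (\<epsilon> - lambda1 \<Omega>) \<and> 0 < t \<and> t \<le> 1 \<and>
     open \<omega> \<and> \<omega> \<subseteq> \<Omega> \<and>
     v0 \<in> borel_measurable (lebesgue_on \<Omega>) \<and> v1 \<in> borel_measurable (lebesgue_on \<Omega>) \<and>
     (\<forall>x\<in>\<Omega>. v0 x \<le> 0 \<and> 0 \<le> v1 x) \<and>
     weak_sol \<Omega> f \<mu> t \<omega> v0 v1 u
     \<longrightarrow> Lp_space (qss DIM('a) q) \<Omega> u \<and>
         Lp_norm (qss DIM('a) q) \<Omega> u \<le> C * (Lp_norm 2 \<Omega> u + Lp_norm (ereal q) \<Omega> h)"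
proof -
  obtain C where "C > 0" and C: "\<And>\<Omega> (U :: 'a \<Rightarrow> real) G H u. energy_class \<Omega> \<delta> L U G H \<Longrightarrow>
     integrable lborel (\<lambda>x. H x powr q) \<Longrightarrow> \<Omega> \<in> sets lebesgue \<Longrightarrow> u \<in> borel_measurable (lebesgue_on \<Omega>) \<Longrightarrow>
     (AE x in lborel. U x = (if x \<in> \<Omega> then u x else 0)) \<Longrightarrow>
     Lp_space (qss DIM('a) q) \<Omega> u \<and>
     Lp_norm (qss DIM('a) q) \<Omega> u \<le> C * (sqrt (\<integral>x. (U x)\<^sup>2 \<partial>lborel) + (\<integral>x. H x powr q \<partial>lborel) powr (1 / q))"
    using energy_class_bound[OF assms(1-3)] by blast
  show ?thesis
  proof (intro exI[of _ C] conjI[OF \<open>C > 0\<close>] allI impI, elim conjE)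
    fix \<Omega> :: "'a set" and f :: "'a \<Rightarrow> real \<Rightarrow> 'a \<Rightarrow> real" and h :: "'a \<Rightarrow> real"
      and \<epsilon> \<mu> t :: real and \<omega> :: "'a set" and v0 v1 u :: "'a \<Rightarrow> real"
    assume a: "open \<Omega>" "carath \<Omega> f" "\<forall>x\<in>\<Omega>. h x \<ge> 0" "Lp_space 2 \<Omega> h"
      "\<forall>x\<in>\<Omega>. \<forall>s \<xi>. f x s \<xi> * s \<le> \<delta> * s\<^sup>2 + L * norm \<xi> * \<bar>s\<bar> + h x * \<bar>s\<bar>"
      and \<mu>: "\<mu> \<ge> max 0 (\<epsilon> - lambda1 \<Omega>)" and b: "0 < t" "t \<le> 1" "open \<omega>" "\<omega> \<subseteq> \<Omega>"
      "\<forall>x\<in>\<Omega>. v0 x \<le> 0 \<and> 0 \<le> v1 x"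
      and sol: "weak_sol \<Omega> f \<mu> t \<omega> v0 v1 u" and hq: "Lp_space (ereal q) \<Omega> h"
    have \<mu>0: "\<mu> \<ge> 0" and \<delta>0: "\<delta> \<ge> 0" using \<mu> assms(3) by auto
    obtain U G H where EC: "energy_class \<Omega> \<delta> L U G H"
      and U: "AE x in lborel. U x = (if x \<in> \<Omega> then u x else 0)"
      and H: "AE x in lborel. H x = (if x \<in> \<Omega> then h x else 0)"
      and um: "u \<in> borel_measurable (lebesgue_on \<Omega>)"
      using weak_sol_energy_class[OF a \<mu>0 b \<delta>0 assms(4) sol] .
    have S: "\<Omega> \<in> sets lebesgue" using a by auto
    have m: "U \<in> borel_measurable borel" "H \<in> borel_measurable borel" "h \<in> borel_measurable (lebesgue_on \<Omega>)"
      "\<And>x. \<bar>H x\<bar> = H x"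
      using EC hq by (auto simp: energy_class_def H0_def Lp_space_def)
    \<comment> \<open>H is nonnegative, so the absolute value in the norm drops out and the form of
      \<open>energy_class_bound\<close> is reached.\<close>
    note repr_h = Lp_norm_representative[OF m(2,3) S H, of q, unfolded m(4)]
    have "integrable lborel (\<lambda>x. H x powr q)" using hq repr_h(2) by simp
    from C[OF EC this S um U]
    show "Lp_space (qss DIM('a) q) \<Omega> u \<and>
         Lp_norm (qss DIM('a) q) \<Omega> u \<le> C * (Lp_norm 2 \<Omega> u + Lp_norm (ereal q) \<Omega> h)"
      unfolding Lp_norm_2_representative[OF m(1) um S U] repr_h(1) .
  qed
qed

end
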